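(* Let $G$ be a Lie group with $\dim G\geq 3$, and let $H\subseteq G$ be a closed connected $1$-dimensional Lie subgroup such that $N_G(H)/H$ is finite, where $N_G(H)=\{g\in G: gHg^{-1}=H\}$. Then for every finite graph $\Gamma=(V,E)$ there is a dense open subset $U$ of $C_{G,H}$ such that for every realisation $\rho\in U$, the associated motion sheaf $\mathcal{M}_\rho$ satisfies $H^1(I(\Gamma),\mathcal{M}_\rho)=0$ if and only if the multigraph $(\dim(G)-2)\Gamma$ is $(\dim(G)-1,\dim(G))$-sparse.
   Context: $C_{G,H}$ is the set of assignments $\rho$ of subgroups to vertices and edges of $\Gamma$ with $\rho(v)=g_vHg_v^{-1}$ for some $g_v\in G$ and $\rho(e)=\bigcap_{v\in e}\rho(v)$; it is identified with $(G/N_G(H))^{V}$ (via $(g_vN_G(H))_v$) and carries the resulting manifold topology, in which "dense open" is meant. Let $\mathfrak{g}$ be the Lie algebra of $G$ and $\mathfrak{h}_x$ the Lie algebra of $\rho(x)$ (so $\mathfrak{h}_v=\mathrm{Ad}(g_v)\mathfrak{h}$, $\mathfrak{h}_e=\bigcap_{v\in e}\mathfrak{h}_v$). The associated motion sheaf $\mathcal{M}_\rho$ is the sheaf on the incidence graph $I(\Gamma)$ (vertex set $V\cup E$, an edge $v\sim e$ whenever $v\in e$) with $\mathcal{M}(x)=\mathfrak{g}/\mathfrak{h}_x$ for $x\in V\cup E$, $\mathcal{M}(v\sim e)=\mathfrak{g}/\mathfrak{h}_v$, restriction maps the identity $\mathcal{M}(v)\to\mathcal{M}(v\sim e)$ and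 the reduction $\mathfrak{g}/\mathfrak{h}_e\to\mathfrak{g}/\mathfrak{h}_v$. Sheaf cohomology on a graph: with a sign convention $[v:e]=\pm1$, $[v:e]=-[u:e]$ for each edge $e=vu$, the coboundary $d:\bigoplus_v\mathcal{F}(v)\to\bigoplus_e\mathcal{F}(e)$, $d(w)_e=\sum_{v\in e}[v:e]r^v_e(w_v)$; $H^0=\ker d$, $H^1=\operatorname{coker}d$. For $a\in\mathbb{N}$, $a\Gamma$ is the multigraph with $a$ parallel copies of each edge; a multigraph is $(d,\ell)$-sparse if every vertex subset $V'$ with $|V'|\geq2$ spans at most $d|V'|-\ell$ edges counted with multiplicity. *)

theory Defs
  imports
    "HOL-Analysis.Analysis"
    "HOL-Algebra.Group_Action"
    "HOL-Algebra.Left_Coset"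
    "HOL-Algebra.AbelCoset"
    "HOL-Algebra.Module"
begin

section \<open>Smooth manifolds and Lie groups\<close>

text \<open>\<open>k\<close>-fold continuous differentiability, meant for open \<open>S\<close>: in finite dimension a function is
  of class \<open>C\<^sup>k\<^sup>+\<^sup>1\<close> iff it is differentiable and all its directional derivatives are of class \<open>C\<^sup>k\<close>.\<close>

primrec Ck_on :: "nat \<Rightarrow> 'a::euclidean_space set \<Rightarrow> ('a \<Rightarrow> 'b::euclidean_space) \<Rightarrow> bool" where
  "Ck_on 0 S f \<longleftrightarrow> continuous_on S f"
| "Ck_on (Suc k) S f \<longleftrightarrow>
     (\<forall>x\<in>S. f differentiable (at x)) \<and> (\<forall>v. Ck_on k S (\<lambda>x. frechet_derivative f (at x) v))"

definition smooth_on :: "'a::euclidean_space set \<Rightarrow> ('a \<Rightarrow> 'b::euclidean_space) \<Rightarrow> bool" where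
  "smooth_on S f \<longleftrightarrow> (\<forall>k. Ck_on k S f)"

type_synonym ('m, 'e) chart = "'m set \<times> ('m \<Rightarrow> 'e)"

definition is_chart :: "'m topology \<Rightarrow> ('m, 'e::euclidean_space) chart \<Rightarrow> bool" where
  "is_chart T c \<longleftrightarrow> (case c of (U, \<phi>) \<Rightarrow>
     openin T U \<and> open (\<phi> ` U) \<and> homeomorphic_map (subtopology T U) (top_of_set (\<phi> ` U)) \<phi>)"

definition smoothly_compatible ::
    "('m, 'e::euclidean_space) chart \<Rightarrow> ('m, 'e) chart \<Rightarrow> bool" where
  "smoothly_compatible c c' \<longleftrightarrow> (case (c, c') of ((U, \<phi>), (U', \<phi>')) \<Rightarrow>
     smooth_on (\<phi> ` (U \<inter> U')) (\<phi>' \<circ> inv_into U \<phi>) \<and>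
     smooth_on (\<phi>' ` (U \<inter> U')) (\<phi> \<circ> inv_into U' \<phi>'))"

text \<open>Atlases are not required to be maximal. The dimension of the manifold is \<open>DIM('e)\<close>.\<close>

definition smooth_manifold :: "'m topology \<Rightarrow> ('m, 'e::euclidean_space) chart set \<Rightarrow> bool" where
  "smooth_manifold T A \<longleftrightarrow>
     Hausdorff_space T \<and> second_countable T \<and>
     (\<forall>c\<in>A. is_chart T c) \<and> (\<Union>c\<in>A. fst c) = topspace T \<and>
     (\<forall>c\<in>A. \<forall>c'\<in>A. smoothly_compatible c c')"

definition smooth_map ::
    "'m topology \<Rightarrow> ('m, 'e::euclidean_space) chart set \<Rightarrow>
     'n topology \<Rightarrow> ('n, 'f::euclidean_space) chart set \<Rightarrow> ('m \<Rightarrow> 'n) \<Rightarrow> bool" where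
  "smooth_map S A T B f \<longleftrightarrow> continuous_map S T f \<and>
     (\<forall>(U, \<phi>)\<in>A. \<forall>(W, \<psi>)\<in>B. smooth_on (\<phi> ` {x\<in>U. f x \<in> W}) (\<psi> \<circ> f \<circ> inv_into U \<phi>))"

definition product_atlas ::
    "('m, 'e::euclidean_space) chart set \<Rightarrow> ('n, 'f::euclidean_space) chart set \<Rightarrow>
     ('m \<times> 'n, 'e \<times> 'f) chart set" where
  "product_atlas A B = {(U \<times> W, \<lambda>(x, y). (\<phi> x, \<psi> y)) | U \<phi> W \<psi>. (U, \<phi>) \<in> A \<and> (W, \<psi>) \<in> B}"

definition embedded_submanifold ::
    "'m topology \<Rightarrow> ('m, 'e::euclidean_space) chart set \<Rightarrow> nat \<Rightarrow> 'm set \<Rightarrow> bool" where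
  "embedded_submanifold T A k S \<longleftrightarrow> S \<subseteq> topspace T \<and>
     (\<forall>p\<in>S. \<exists>U \<phi> L. p \<in> U \<and> is_chart T (U, \<phi>) \<and> (\<forall>c\<in>A. smoothly_compatible (U, \<phi>) c) \<and>
        subspace L \<and> dim L = k \<and> \<phi> ` (U \<inter> S) = \<phi> ` U \<inter> L)"

locale lie_group = group G
  for G :: "('g, 'b) monoid_scheme" (structure) +
  fixes T :: "'g topology" and A :: "('g, 'e::euclidean_space) chart set"
  assumes topspace_eq: "topspace T = carrier G"
    and manifold: "smooth_manifold T A"
    and smooth_mult: "smooth_map (prod_topology T T) (product_atlas A A) T A (\<lambda>(x, y). x \<otimes> y)"
    and smooth_inv: "smooth_map T A T A (\<lambda>x. inv x)"

definition closed_lie_subgroup ::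
    "('g, 'b) monoid_scheme \<Rightarrow> 'g topology \<Rightarrow> ('g, 'e::euclidean_space) chart set \<Rightarrow>
     nat \<Rightarrow> 'g set \<Rightarrow> bool" where
  "closed_lie_subgroup G T A k H \<longleftrightarrow>
     subgroup H G \<and> closedin T H \<and> embedded_submanifold T A k H"

text \<open>The tangent space at the identity, i.e. the vector space underlying the Lie algebra of \<open>G\<close>, is
  identified with the model space \<open>'e\<close> through one fixed chart around the identity. The Lie algebra
  of a closed subgroup \<open>K\<close> is its tangent space at the identity, a subspace of \<open>'e\<close>. The Lie bracket
  plays no role below.\<close>

definition id_chart ::
    "('g, 'b) monoid_scheme \<Rightarrow> ('g, 'e::euclidean_space) chart set \<Rightarrow> ('g, 'e) chart" where
  "id_chart G A = (SOME c. c \<in> A \<and> \<one>\<^bsub>G\<^esub> \<in> fst c)"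

definition lie_algebra ::
    "('g, 'b) monoid_scheme \<Rightarrow> 'g topology \<Rightarrow> ('g, 'e::euclidean_space) chart set \<Rightarrow>
     'g set \<Rightarrow> 'e set" where
  "lie_algebra G T A K = {X. \<exists>\<gamma> :: real \<Rightarrow> 'g.
     smooth_map euclideanreal {(UNIV, id)} T A \<gamma> \<and> range \<gamma> \<subseteq> K \<and> \<gamma> 0 = \<one>\<^bsub>G\<^esub> \<and>
     ((snd (id_chart G A) \<circ> \<gamma>) has_vector_derivative X) (at 0)}"


section \<open>Real vector spaces, quotients and direct sums\<close>

definition euclidean_module :: "(real, 'e::euclidean_space) module" where
  "euclidean_module = \<lparr>carrier = UNIV, mult = undefined, one = undefined,
     zero = 0, add = (+), smult = (*\<^sub>R)\<rparr>"

definition quotient_module :: "(real, 'm) module \<Rightarrow> 'm set \<Rightarrow> (real, 'm set) module" where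
  "quotient_module M N = \<lparr>carrier = a_rcosets\<^bsub>M\<^esub> N, mult = undefined, one = undefined,
     zero = N, add = set_add M, smult = (\<lambda>c X. \<Union>x\<in>X. N +>\<^bsub>M\<^esub> (c \<odot>\<^bsub>M\<^esub> x))\<rparr>"

definition direct_sum :: "'i set \<Rightarrow> ('i \<Rightarrow> (real, 'm) module) \<Rightarrow> (real, 'i \<Rightarrow> 'm) module" where
  "direct_sum I M = \<lparr>carrier = (\<Pi>\<^sub>E i\<in>I. carrier (M i)), mult = undefined, one = undefined,
     zero = (\<lambda>i\<in>I. \<zero>\<^bsub>M i\<^esub>), add = (\<lambda>x y. \<lambda>i\<in>I. x i \<oplus>\<^bsub>M i\<^esub> y i),
     smult = (\<lambda>c x. \<lambda>i\<in>I. c \<odot>\<^bsub>M i\<^esub> x i)\<rparr>"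


section \<open>Graphs and sheaf cohomology\<close>

definition finite_graph :: "'v set \<Rightarrow> 'v set set \<Rightarrow> bool" where
  "finite_graph V E \<longleftrightarrow> finite V \<and> (\<forall>e\<in>E. e \<subseteq> V \<and> card e = 2)"

record ('v, 'i) multigraph =
  verts :: "'v set"
  edges :: "'i set"
  ends :: "'i \<Rightarrow> 'v set"

definition parallel_copies :: "nat \<Rightarrow> 'v set \<Rightarrow> 'v set set \<Rightarrow> ('v, 'v set \<times> nat) multigraph" where
  "parallel_copies a V E = \<lparr>verts = V, edges = E \<times> {..<a}, ends = fst\<rparr>"

definition sparse_multigraph :: "nat \<Rightarrow> nat \<Rightarrow> ('v, 'i) multigraph \<Rightarrow> bool" where
  "sparse_multigraph d l \<Gamma> \<longleftrightarrow> (\<forall>V'\<subseteq>verts \<Gamma>. card V' \<ge> 2 \<longrightarrow>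
     int (card {i \<in> edges \<Gamma>. ends \<Gamma> i \<subseteq> V'}) \<le> int d * int (card V') - int l)"

definition incidence_graph ::
    "'v set \<Rightarrow> 'v set set \<Rightarrow> ('v + 'v set, 'v \<times> 'v set) multigraph" where
  "incidence_graph V E = \<lparr>verts = V <+> E, edges = {(v, e). e \<in> E \<and> v \<in> e},
     ends = (\<lambda>(v, e). {Inl v, Inr e})\<rparr>"

text \<open>\<open>restriction F v i\<close> is only meaningful when \<open>v\<close> is an end of the edge \<open>i\<close>.\<close>

record ('v, 'i, 'm) graph_sheaf =
  vertex_stalk :: "'v \<Rightarrow> (real, 'm) module"
  edge_stalk :: "'i \<Rightarrow> (real, 'm) module"
  restriction :: "'v \<Rightarrow> 'i \<Rightarrow> 'm \<Rightarrow> 'm"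

definition sign_convention :: "('v, 'i) multigraph \<Rightarrow> ('v \<Rightarrow> 'i \<Rightarrow> real) \<Rightarrow> bool" where
  "sign_convention \<Gamma> \<sigma> \<longleftrightarrow> (\<forall>i\<in>edges \<Gamma>. \<forall>v\<in>ends \<Gamma> i.
     \<sigma> v i \<in> {1, -1} \<and> (\<forall>u\<in>ends \<Gamma> i. u \<noteq> v \<longrightarrow> \<sigma> v i = - \<sigma> u i))"

definition C0 :: "('v, 'i) multigraph \<Rightarrow> ('v, 'i, 'm) graph_sheaf \<Rightarrow> (real, 'v \<Rightarrow> 'm) module" where
  "C0 \<Gamma> F = direct_sum (verts \<Gamma>) (vertex_stalk F)"

definition C1 :: "('v, 'i) multigraph \<Rightarrow> ('v, 'i, 'm) graph_sheaf \<Rightarrow> (real, 'i \<Rightarrow> 'm) module" where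
  "C1 \<Gamma> F = direct_sum (edges \<Gamma>) (edge_stalk F)"

definition coboundary ::
    "('v, 'i) multigraph \<Rightarrow> ('v \<Rightarrow> 'i \<Rightarrow> real) \<Rightarrow> ('v, 'i, 'm) graph_sheaf \<Rightarrow>
     ('v \<Rightarrow> 'm) \<Rightarrow> ('i \<Rightarrow> 'm)" where
  "coboundary \<Gamma> \<sigma> F w = (\<lambda>i\<in>edges \<Gamma>.
     \<Oplus>\<^bsub>edge_stalk F i\<^esub> v \<in> ends \<Gamma> i. \<sigma> v i \<odot>\<^bsub>edge_stalk F i\<^esub> restriction F v i (w v))"

definition H1 ::
    "('v, 'i) multigraph \<Rightarrow> ('v \<Rightarrow> 'i \<Rightarrow> real) \<Rightarrow> ('v, 'i, 'm) graph_sheaf \<Rightarrow>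
     (real, ('i \<Rightarrow> 'm) set) module" where
  "H1 \<Gamma> \<sigma> F = quotient_module (C1 \<Gamma> F) (coboundary \<Gamma> \<sigma> F ` carrier (C0 \<Gamma> F))"

definition is_zero_module :: "(real, 'm) module \<Rightarrow> bool" where
  "is_zero_module M \<longleftrightarrow> carrier M = {\<zero>\<^bsub>M\<^esub>}"


section \<open>Realisations and motion sheaves\<close>

abbreviation conjugate :: "('g, 'b) monoid_scheme \<Rightarrow> 'g \<Rightarrow> 'g set \<Rightarrow> 'g set" where
  "conjugate G g H \<equiv> g <#\<^bsub>G\<^esub> H #>\<^bsub>G\<^esub> (inv\<^bsub>G\<^esub> g)"

text \<open>An assignment \<open>\<rho>\<close> of subgroups has values \<open>\<rho> (Inl v)\<close> at vertices and \<open>\<rho> (Inr e)\<close> at edges.\<close>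

definition realisations ::
    "('g, 'b) monoid_scheme \<Rightarrow> 'g set \<Rightarrow> 'v set \<Rightarrow> 'v set set \<Rightarrow> ('v + 'v set \<Rightarrow> 'g set) set" where
  "realisations G H V E = {\<rho> \<in> extensional (V <+> E).
     (\<forall>v\<in>V. \<exists>g\<in>carrier G. \<rho> (Inl v) = conjugate G g H) \<and>
     (\<forall>e\<in>E. \<rho> (Inr e) = (\<Inter>v\<in>e. \<rho> (Inl v)))}"

definition coset_topology ::
    "('g, 'b) monoid_scheme \<Rightarrow> 'g topology \<Rightarrow> 'g set \<Rightarrow> 'g set topology" where
  "coset_topology G T N = topology (\<lambda>\<U>. \<U> \<subseteq> lcosets\<^bsub>G\<^esub> N \<and>
     openin T {g \<in> topspace T. g <#\<^bsub>G\<^esub> N \<in> \<U>})"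

text \<open>The set of all \<open>g\<close> conjugating \<open>H\<close> to \<open>\<rho> (Inl v)\<close> is the coset \<open>g\<^sub>v N\<^sub>G(H)\<close>, so the following map
  is the identification of realisations with \<open>(G/N\<^sub>G(H))\<^sup>V\<close>; see \<open>bij_betw_realisation_cosets\<close> below.\<close>

definition realisation_cosets ::
    "('g, 'b) monoid_scheme \<Rightarrow> 'g set \<Rightarrow> 'v set \<Rightarrow> ('v + 'v set \<Rightarrow> 'g set) \<Rightarrow> ('v \<Rightarrow> 'g set)" where
  "realisation_cosets G H V \<rho> = (\<lambda>v\<in>V. {g \<in> carrier G. conjugate G g H = \<rho> (Inl v)})"

definition realisation_topology ::
    "('g, 'b) monoid_scheme \<Rightarrow> 'g topology \<Rightarrow> 'g set \<Rightarrow> 'v set \<Rightarrow> 'v set set \<Rightarrow>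
     ('v + 'v set \<Rightarrow> 'g set) topology" where
  "realisation_topology G T H V E =
     pullback_topology (realisations G H V E) (realisation_cosets G H V)
       (product_topology (\<lambda>_. coset_topology G T (normalizer G H)) V)"

text \<open>Since \<open>\<hh>\<^sub>e \<subseteq> \<hh>\<^sub>v\<close>, adding \<open>\<hh>\<^sub>v\<close> to a coset of \<open>\<hh>\<^sub>e\<close> is the reduction \<open>\<gg>/\<hh>\<^sub>e \<rightarrow> \<gg>/\<hh>\<^sub>v\<close>.\<close>

definition motion_sheaf ::
    "('g, 'b) monoid_scheme \<Rightarrow> 'g topology \<Rightarrow> ('g, 'e::euclidean_space) chart set \<Rightarrow>
     ('v + 'v set \<Rightarrow> 'g set) \<Rightarrow> ('v + 'v set, 'v \<times> 'v set, 'e set) graph_sheaf" where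
  "motion_sheaf G T A \<rho> =
     \<lparr>vertex_stalk = (\<lambda>x. quotient_module euclidean_module (lie_algebra G T A (\<rho> x))),
      edge_stalk = (\<lambda>(v, e). quotient_module euclidean_module (lie_algebra G T A (\<rho> (Inl v)))),
      restriction = (\<lambda>x (v, e) X. case x of
          Inl _ \<Rightarrow> X
        | Inr _ \<Rightarrow> X <+>\<^bsub>euclidean_module\<^esub> lie_algebra G T A (\<rho> (Inl v)))\<rparr>"


section \<open>The topology on realisations\<close>

lemma openin_coset_topology:
  "openin (coset_topology G T N) \<U> \<longleftrightarrow>
     \<U> \<subseteq> lcosets\<^bsub>G\<^esub> N \<and> openin T {g \<in> topspace T. g <#\<^bsub>G\<^esub> N \<in> \<U>}"
proof -
  have "istopology (\<lambda>\<U>. \<U> \<subseteq> lcosets\<^bsub>G\<^esub> N \<and> openin T {g \<in> topspace T. g <#\<^bsub>G\<^esub> N \<in> \<U>})"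
    unfolding istopology_def
  proof (intro conjI allI impI)
    fix S S' assume *: "S \<subseteq> lcosets\<^bsub>G\<^esub> N \<and> openin T {g \<in> topspace T. g <#\<^bsub>G\<^esub> N \<in> S}"
      "S' \<subseteq> lcosets\<^bsub>G\<^esub> N \<and> openin T {g \<in> topspace T. g <#\<^bsub>G\<^esub> N \<in> S'}"
    have "{g \<in> topspace T. g <#\<^bsub>G\<^esub> N \<in> S \<inter> S'} =
        {g \<in> topspace T. g <#\<^bsub>G\<^esub> N \<in> S} \<inter> {g \<in> topspace T. g <#\<^bsub>G\<^esub> N \<in> S'}" by auto
    then show "openin T {g \<in> topspace T. g <#\<^bsub>G\<^esub> N \<in> S \<inter> S'}" using * by auto
    show "S \<inter> S' \<subseteq> lcosets\<^bsub>G\<^esub> N" using * by auto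
  next
    fix \<K> assume *: "\<forall>K\<in>\<K>. K \<subseteq> lcosets\<^bsub>G\<^esub> N \<and> openin T {g \<in> topspace T. g <#\<^bsub>G\<^esub> N \<in> K}"
    have "{g \<in> topspace T. g <#\<^bsub>G\<^esub> N \<in> \<Union>\<K>} = (\<Union>K\<in>\<K>. {g \<in> topspace T. g <#\<^bsub>G\<^esub> N \<in> K})" by auto
    then show "openin T {g \<in> topspace T. g <#\<^bsub>G\<^esub> N \<in> \<Union>\<K>}" using * by auto
    show "\<Union>\<K> \<subseteq> lcosets\<^bsub>G\<^esub> N" using * by auto
  qed
  then show ?thesis unfolding coset_topology_def by simp
qed

lemma topspace_coset_topology:
  assumes "topspace T = carrier G"
  shows "topspace (coset_topology G T N) = lcosets\<^bsub>G\<^esub> N"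
proof -
  have "{g \<in> topspace T. g <#\<^bsub>G\<^esub> N \<in> lcosets\<^bsub>G\<^esub> N} = topspace T"
    using assms by (auto simp: LCOSETS_def)
  then have "openin (coset_topology G T N) (lcosets\<^bsub>G\<^esub> N)"
    by (simp add: openin_coset_topology)
  then show ?thesis
    by (metis openin_coset_topology openin_subset openin_topspace subset_antisym)
qed

lemma (in group) conjugate_conjugate:
  assumes "x \<in> carrier G" "y \<in> carrier G" "H \<subseteq> carrier G"
  shows "conjugate G x (conjugate G y H) = conjugate G (x \<otimes> y) H"
proof -
  have *: "y <# H \<subseteq> carrier G" "x \<otimes> y <# H \<subseteq> carrier G"
    using assms by (simp_all add: l_coset_subset_G)
  have "x <# (y <# H #> inv y) = x <# (y <# H) #> inv y"
    using assms * by (simp add: coset_assoc)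
  also have "\<dots> = x \<otimes> y <# H #> inv y"
    using assms by (simp add: lcos_m_assoc)
  finally show ?thesis
    using assms * by (simp add: coset_mult_assoc inv_mult_group)
qed

lemma (in group) conjugate_eq_iff:
  assumes "x \<in> carrier G" "g \<in> carrier G" "H \<subseteq> carrier G"
  shows "conjugate G x H = conjugate G g H \<longleftrightarrow> inv g \<otimes> x \<in> normalizer G H"
proof -
  have one: "conjugate G \<one> K = K" if "K \<subseteq> carrier G" for K
    using that by (simp add: lcos_mult_one coset_mult_one)
  have sub: "conjugate G y H \<subseteq> carrier G" if "y \<in> carrier G" for y
    using that assms by (simp add: l_coset_subset_G r_coset_subset_G)
  have "conjugate G x H = conjugate G g H \<longleftrightarrow> conjugate G (inv g \<otimes> x) H = H"
  proof
    assume "conjugate G x H = conjugate G g H"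
    then have "conjugate G (inv g) (conjugate G x H) = conjugate G (inv g) (conjugate G g H)"
      by simp
    then show "conjugate G (inv g \<otimes> x) H = H"
      using conjugate_conjugate [of "inv g" x H] conjugate_conjugate [of "inv g" g H]
        one [of H] assms by simp
  next
    assume "conjugate G (inv g \<otimes> x) H = H"
    then have "conjugate G g (conjugate G (inv g \<otimes> x) H) = conjugate G g H" by simp
    then show "conjugate G x H = conjugate G g H"
      using conjugate_conjugate [of g "inv g \<otimes> x" H] assms by (simp add: m_assoc [symmetric])
  qed
  then show ?thesis
    using assms by (simp add: normalizer_def stabilizer_def)
qed

lemma (in group) conjugators_eq_coset:
  assumes "g \<in> carrier G" "H \<subseteq> carrier G"
  shows "{x \<in> carrier G. conjugate G x H = conjugate G g H} = g <# normalizer G H"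
proof -
  interpret N: subgroup "normalizer G H" G
    by (rule normalizer_imp_subgroup [OF assms(2)])
  show ?thesis
  proof (intro Set.set_eqI iffI)
    fix x assume "x \<in> {x \<in> carrier G. conjugate G x H = conjugate G g H}"
    then have x: "x \<in> carrier G" "inv g \<otimes> x \<in> normalizer G H"
      using conjugate_eq_iff assms by auto
    then have "x = g \<otimes> (inv g \<otimes> x)" using assms by (simp add: m_assoc [symmetric])
    then show "x \<in> g <# normalizer G H" using x unfolding l_coset_def by blast
  next
    fix x assume "x \<in> g <# normalizer G H"
    then obtain n where n: "n \<in> normalizer G H" "x = g \<otimes> n" unfolding l_coset_def by blast
    then have "x \<in> carrier G" "inv g \<otimes> x = n"
      using assms N.subset by (auto simp: m_assoc [symmetric])
    then show "x \<in> {x \<in> carrier G. conjugate G x H = conjugate G g H}"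
      using n conjugate_eq_iff [of x g H] assms by auto
  qed
qed

lemma (in group) bij_betw_realisation_cosets:
  assumes H: "H \<subseteq> carrier G" and E: "\<forall>e\<in>E. e \<subseteq> V"
  shows "bij_betw (realisation_cosets G H V) (realisations G H V E)
    (\<Pi>\<^sub>E v\<in>V. lcosets (normalizer G H))"
proof (rule bij_betwI')
  fix \<rho> \<rho>' assume \<rho>: "\<rho> \<in> realisations G H V E" and \<rho>': "\<rho>' \<in> realisations G H V E"
  show "realisation_cosets G H V \<rho> = realisation_cosets G H V \<rho>' \<longleftrightarrow> \<rho> = \<rho>'"
  proof
    assume eq: "realisation_cosets G H V \<rho> = realisation_cosets G H V \<rho>'"
    have v: "\<rho> (Inl v) = \<rho>' (Inl v)" if "v \<in> V" for v
    proof -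
      from \<rho> have "\<forall>v\<in>V. \<exists>g\<in>carrier G. \<rho> (Inl v) = conjugate G g H"
        by (simp add: realisations_def)
      with that obtain g where "g \<in> carrier G" "\<rho> (Inl v) = conjugate G g H" by blast
      moreover have "{g \<in> carrier G. conjugate G g H = \<rho> (Inl v)} =
          {g \<in> carrier G. conjugate G g H = \<rho>' (Inl v)}"
        using fun_cong [OF eq, of v] that by (simp add: realisation_cosets_def)
      ultimately show ?thesis by blast
    qed
    have e: "\<rho> (Inr e) = \<rho>' (Inr e)" if "e \<in> E" for e
    proof -
      have "(\<Inter>v\<in>e. \<rho> (Inl v)) = (\<Inter>v\<in>e. \<rho>' (Inl v))"
        using v E that by (intro INF_cong) auto
      then show ?thesis using \<rho> \<rho>' that by (simp add: realisations_def)
    qed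
    show "\<rho> = \<rho>'"
      by (rule extensionalityI [where A = "V <+> E"])
        (use \<rho> \<rho>' v e in \<open>auto simp: realisations_def\<close>)
  qed simp
next
  fix \<rho> assume \<rho>: "\<rho> \<in> realisations G H V E"
  have "{g \<in> carrier G. conjugate G g H = \<rho> (Inl v)} \<in> lcosets (normalizer G H)"
    if "v \<in> V" for v
  proof -
    from \<rho> have "\<forall>v\<in>V. \<exists>g\<in>carrier G. \<rho> (Inl v) = conjugate G g H"
      by (simp add: realisations_def)
    with that obtain g where "g \<in> carrier G" "\<rho> (Inl v) = conjugate G g H" by blast
    then show ?thesis using conjugators_eq_coset [of g H] H by (auto simp: LCOSETS_def)
  qed
  then show "realisation_cosets G H V \<rho> \<in> (\<Pi>\<^sub>E v\<in>V. lcosets (normalizer G H))"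
    by (simp add: realisation_cosets_def)
next
  fix c assume c: "c \<in> (\<Pi>\<^sub>E v\<in>V. lcosets (normalizer G H))"
  then have "\<forall>v\<in>V. \<exists>g. g \<in> carrier G \<and> c v = g <# normalizer G H"
    by (auto simp: LCOSETS_def PiE_iff)
  then obtain g where g: "\<And>v. v \<in> V \<Longrightarrow> g v \<in> carrier G"
      "\<And>v. v \<in> V \<Longrightarrow> c v = g v <# normalizer G H"
    by metis
  define \<rho> where "\<rho> = (\<lambda>x\<in>V <+> E. case x of Inl v \<Rightarrow> conjugate G (g v) H
    | Inr e \<Rightarrow> (\<Inter>v\<in>e. conjugate G (g v) H))"
  have "(\<Inter>v\<in>e. conjugate G (g v) H) = (\<Inter>v\<in>e. \<rho> (Inl v))" if "e \<in> E" for e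
    using E that by (intro INF_cong) (auto simp: \<rho>_def)
  then have "\<rho> \<in> realisations G H V E"
    using g by (auto simp: realisations_def \<rho>_def)
  moreover have "c = realisation_cosets G H V \<rho>"
  proof (rule extensionalityI [where A = V])
    fix v assume "v \<in> V"
    then show "c v = realisation_cosets G H V \<rho> v"
      using g conjugators_eq_coset [of "g v" H] H by (simp add: realisation_cosets_def \<rho>_def InlI)
  qed (use c in \<open>auto simp: realisation_cosets_def PiE_iff\<close>)
  ultimately show "\<exists>\<rho>\<in>realisations G H V E. c = realisation_cosets G H V \<rho>" by blast
qed

lemma topspace_realisation_topology:
  assumes "group G" "topspace T = carrier G" "H \<subseteq> carrier G" "\<forall>e\<in>E. e \<subseteq> V"
  shows "topspace (realisation_topology G T H V E) = realisations G H V E"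
proof -
  have "realisation_cosets G H V ` realisations G H V E =
      topspace (product_topology (\<lambda>_. coset_topology G T (normalizer G H)) V)"
    using group.bij_betw_realisation_cosets [OF assms(1,3,4)]
    by (simp add: bij_betw_def topspace_coset_topology assms(2))
  then show ?thesis
    unfolding realisation_topology_def topspace_pullback_topology by auto
qed

end

theory Submission
  imports Defs "HOL-Library.Function_Algebras"
begin

text \<open>The Lie algebra of \<open>\<rho>(v)\<close> is a line, spanned by some \<open>x v\<close>, and \<open>H\<^sup>1\<close> vanishes iff the
  system \<open>a v - c e - b v e \<in> \<real> x v\<close> (\<open>v \<in> e \<in> E\<close>) has a solution \<open>(a, c)\<close> for every \<open>b\<close>. For
  pairwise non-parallel lines a count of dimensions shows that solvability forces sparsity.
  Conversely, in the affine chart \<open>x v = p v + u\<close> the system is the parallel drawing problem of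
  Whiteley: a sparse graph admits row normals that are independent and leave every edge non-degenerate
  in the kernel, and any \<open>p\<close> in general position in that kernel makes the system solvable. Solvability
  is Zariski-open in \<open>x\<close>.

  It remains to see that the lines \<open>Ad(g) \<hh>\<close> are generic. If \<open>Ad(g) \<hh> = \<hh>\<close>, then \<open>g\<close> normalises the connected group
  \<open>H\<close>. As \<open>N(H)/H\<close> is finite, \<open>g \<mapsto> Ad(g) \<hh>\<close> is injective on a small slice transversal to \<open>H\<close>, whose
  dimension is that of the projective space of \<open>\<gg>\<close>. By invariance of domain the orbit maps of open
  sets have non-empty interior, so they meet every Zariski-dense open set.\<close>

text \<open>Put n = \<open>DIM('e)\<close>. For an edge with ends s and t, eliminating
  \<open>c e\<close> prescribes \<open>a s - a t\<close> modulo the plane spanned by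
  \<open>x s\<close> and \<open>x t\<close>, which is n - 2 equations. Each \<open>a v\<close>
  counts modulo its line, so there are n - 1 unknowns per vertex, and the common translations form
  an n-dimensional kernel: hence the constants n - 2, n - 1 and n. In the affine chart the same
  numbers read d - 1, d and d + 1 with d = n - 1, because a parallel drawing admits d translations
  and the dilation. A drawing solves the equations of its own row normals, so the normals may be
  chosen before the drawing; the one dimension by which sparsity exceeds the number of rows forces
  solutions other than translations. On the Lie side the orbit provides lines, whereas
  Zariski-openness concerns vectors. All conditions are invariant under rescaling the vectors one by
  one, so the orbit may be replaced by the cone over it; the scale factor supplies the one dimension
  that the slice lacks for invariance of domain.\<close>

instantiation "fun" :: (type, real_vector) real_vector
begin
definition scaleR_fun :: "real \<Rightarrow> ('a \<Rightarrow> 'b) \<Rightarrow> 'a \<Rightarrow> 'b" where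
  "scaleR_fun c f = (\<lambda>x. c *\<^sub>R f x)"
instance
  by standard (auto simp: scaleR_fun_def fun_eq_iff algebra_simps)
end

lemma scaleR_fun_apply [simp]: "(c *\<^sub>R f) x = c *\<^sub>R f x"
  by (simp add: scaleR_fun_def)

lemma sum_fun_apply: "(\<Sum>i\<in>I. f i) x = (\<Sum>i\<in>I. f i x)"
  by (induction I rule: infinite_finite_induct) auto

section \<open>Independent transversals\<close>

text \<open>If \<open>s\<close> avoids \<open>F\<close> but lies in \<open>T\<close>, take
  \<open>t\<close> outside \<open>T\<close>: the line \<open>t + c *\<^sub>R s\<close> misses
  \<open>T\<close> entirely, and each member of \<open>F\<close> meets it at most once, since two
  meeting points would put \<open>s\<close> into that member. So all but finitely many real
  \<open>c\<close> work.\<close>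

lemma subspace_avoid:
  fixes S :: "'a::real_vector set"
  assumes "finite F" "subspace S" "\<And>T. T \<in> F \<Longrightarrow> subspace T" "\<And>T. T \<in> F \<Longrightarrow> \<not> S \<subseteq> T"
  shows "\<exists>s\<in>S. \<forall>T\<in>F. s \<notin> T"
  using assms
proof (induction F rule: finite_induct)
  case empty
  then show ?case using subspace_0 by blast
next
  case (insert T F)
  obtain s where s: "s \<in> S" "\<forall>T\<in>F. s \<notin> T" using insert by auto
  obtain t where t: "t \<in> S" "t \<notin> T" using insert.prems(3) by blast
  show ?case
  proof (cases "s \<in> T")
    case False
    then show ?thesis using s by auto
  next
    case True
    have uniq: "c = c'" if "T' \<in> F" "t + c *\<^sub>R s \<in> T'" "t + c' *\<^sub>R s \<in> T'" for T' c c'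
    proof (rule ccontr)
      assume "c \<noteq> c'"
      have "(t + c *\<^sub>R s) - (t + c' *\<^sub>R s) \<in> T'"
        using that insert.prems(2) subspace_diff by blast
      then have "(c - c') *\<^sub>R s \<in> T'" by (simp add: algebra_simps)
      then have "(1 / (c - c')) *\<^sub>R ((c - c') *\<^sub>R s) \<in> T'"
        using that insert.prems(2) subspace_scale by blast
      then have "s \<in> T'" using \<open>c \<noteq> c'\<close> by simp
      then show False using s that by blast
    qed
    have "finite {c. \<exists>T'\<in>F. t + c *\<^sub>R s \<in> T'}"
    proof -
      have "{c. \<exists>T'\<in>F. t + c *\<^sub>R s \<in> T'} = (\<Union>T'\<in>F. {c. t + c *\<^sub>R s \<in> T'})" by auto
      moreover have "finite {c. t + c *\<^sub>R s \<in> T'}" if "T' \<in> F" for T'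
      proof (cases "{c. t + c *\<^sub>R s \<in> T'} = {}")
        case False
        then obtain c where "t + c *\<^sub>R s \<in> T'" by blast
        then have "{c. t + c *\<^sub>R s \<in> T'} \<subseteq> {c}" using uniq that by blast
        then show ?thesis using finite_subset by blast
      qed simp
      ultimately show ?thesis using insert.hyps by simp
    qed
    then obtain c where c: "c \<notin> {c. \<exists>T'\<in>F. t + c *\<^sub>R s \<in> T'}"
      using ex_new_if_finite infinite_UNIV_char_0 by blast
    have "t + c *\<^sub>R s \<notin> T"
    proof
      assume "t + c *\<^sub>R s \<in> T"
      then have "(t + c *\<^sub>R s) - c *\<^sub>R s \<in> T"
        using True insert.prems(2) by (meson insertI1 subspace_diff subspace_scale)
      then show False using t by simp
    qed
    moreover have "t + c *\<^sub>R s \<in> S"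
      using s t insert.prems(1) by (simp add: subspace_add subspace_scale)
    ultimately show ?thesis using c by blast
  qed
qed

text \<open>A rank bound for subsets of function spaces, where \<open>dim\<close> would mislead: it
  is a cardinality and hence 0 in infinite dimension. A finite independent subset is an unambiguous
  witness.\<close>

definition rank_ge :: "nat \<Rightarrow> 'a::real_vector set \<Rightarrow> bool" where
  "rank_ge m S \<longleftrightarrow> (\<exists>B. B \<subseteq> S \<and> independent B \<and> finite B \<and> card B = m)"

lemma rank_geI:
  assumes "B \<subseteq> span S" "independent B" "finite B" "m \<le> card B"
  shows "rank_ge m S"
proof -
  obtain B' where B': "B' \<subseteq> S" "independent B'" "span B' = span S"
    using maximal_independent_subset[of S] span_eq
    by (metis span_minimal span_mono subset_antisym subspace_span)
  obtain C where C: "C \<subseteq> B'" "finite C" "card C = m"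
  proof (cases "finite B'")
    case True
    then have "card B \<le> card B'" using assms B' independent_span_bound by blast
    then show ?thesis using assms(4) obtain_subset_with_card_n[of m B'] finite_subset True that
      by (metis order_trans)
  next
    case False
    then show ?thesis using infinite_arbitrarily_large that by metis
  qed
  moreover have "independent C" using B' C independent_mono by blast
  ultimately show ?thesis unfolding rank_ge_def using B' by blast
qed

lemma rank_ge_mono: "rank_ge m S \<Longrightarrow> S \<subseteq> span S' \<Longrightarrow> m' \<le> m \<Longrightarrow> rank_ge m' S'"
proof -
  assume a: "rank_ge m S" "S \<subseteq> span S'" "m' \<le> m"
  then obtain B where B: "B \<subseteq> S" "independent B" "finite B" "card B = m"
    by (auto simp: rank_ge_def)
  show ?thesis by (rule rank_geI[of B]) (use a B in auto)
qed

lemma rank_ge_insert: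
  assumes "rank_ge m S" "w \<notin> span S"
  shows "rank_ge (Suc m) (insert w S)"
proof -
  obtain B where B: "B \<subseteq> S" "independent B" "finite B" "card B = m" using assms(1) by (auto simp: rank_ge_def)
  have "w \<notin> span B" using B span_mono assms(2) by blast
  then have "independent (insert w B)" using B independent_insert by (metis)
  moreover have "w \<notin> B" using \<open>w \<notin> span B\<close> span_base by blast
  ultimately show ?thesis unfolding rank_ge_def using B
    by (intro exI[of _ "insert w B"]) auto
qed

lemma rank_ge_le_card:
  assumes "rank_ge m S" "S \<subseteq> span T" "finite T" shows "m \<le> card T"
proof -
  obtain B where B: "B \<subseteq> S" "independent B" "card B = m"
    using assms(1) by (auto simp: rank_ge_def)
  then have "B \<subseteq> span T" using assms(2) by blast
  then show ?thesis using independent_span_bound[OF assms(3) B(2)] B(3) by simp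
qed

text \<open>A greedy form of Rado's theorem: each chosen vector avoids the finitely many proper subspaces
  of \<open>A e\<close> that would spoil the rank condition for some \<open>I\<close>.\<close>

lemma generic_transversal:
  fixes A :: "'k \<Rightarrow> 'a::real_vector set"
  assumes fin: "finite E" and sub: "\<And>e. e \<in> E \<Longrightarrow> subspace (A e)"
    and rank: "\<And>I. I \<subseteq> E \<Longrightarrow> I \<noteq> {} \<Longrightarrow> rank_ge (m * card I + 1) (\<Union>e\<in>I. A e)"
  shows "\<exists>w. (\<forall>e\<in>E. \<forall>i<m. w (e, i) \<in> A e) \<and> inj_on w (E \<times> {..<m}) \<and>
    independent (w ` (E \<times> {..<m})) \<and> (\<forall>e\<in>E. \<not> A e \<subseteq> span (w ` (E \<times> {..<m})))"
proof -
  define J where "J = E \<times> {..<m}"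
  have finJ: "finite J" using fin by (simp add: J_def)
  \<comment> \<open>Invariant for the slots \<open>C\<close> filled so far: the chosen vectors
    together with the \<open>A e\<close> for \<open>e\<close> in \<open>I\<close> have rank at least
    the number of filled slots plus the number of open slots over \<open>I\<close>, plus one spare
    dimension.\<close>
  define ok where "ok w C \<longleftrightarrow> (\<forall>c\<in>C. w c \<in> A (fst c)) \<and> inj_on w C \<and> independent (w ` C) \<and>
    (\<forall>I\<subseteq>E. I \<noteq> {} \<longrightarrow> rank_ge (card C + card {j\<in>J - C. fst j \<in> I} + 1) (w ` C \<union> (\<Union>e\<in>I. A e)))"
    for w :: "'k \<times> nat \<Rightarrow> 'a" and C
  have step: "\<exists>w. ok w C" if "finite C" "C \<subseteq> J" for C
    using that
  proof (induction C rule: finite_induct)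
    case empty
    have "card {j\<in>J. fst j \<in> I} = m * card I" if "I \<subseteq> E" for I
    proof -
      have "{j\<in>J. fst j \<in> I} = I \<times> {..<m}" using that by (auto simp: J_def)
      then show ?thesis by (simp add: card_cartesian_product)
    qed
    then show ?case using rank unfolding ok_def by (auto simp: independent_empty)
  next
    case (insert c C)
    obtain w where w: "ok w C" using insert by auto
    obtain e i where c: "c = (e, i)" by (cases c)
    have e: "e \<in> E" using insert.prems c by (auto simp: J_def)
    \<comment> \<open>Only those \<open>I\<close> matter whose span does not yet contain
      \<open>A e\<close>; for them a vector outside \<open>S I\<close> raises the rank by
      one.\<close>
    define S where "S I = span (w ` C \<union> (\<Union>e\<in>I. A e))" for I
    define F where "F = {S I |I. I \<subseteq> E \<and> \<not> A e \<subseteq> S I}"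
    have "finite F"
    proof -
      have "F \<subseteq> S ` Pow E" by (auto simp: F_def)
      then show ?thesis using fin finite_subset by blast
    qed
    moreover have "subspace T" "\<not> A e \<subseteq> T" if "T \<in> F" for T
      using that unfolding F_def S_def by auto
    ultimately obtain x where x: "x \<in> A e" "\<forall>T\<in>F. x \<notin> T"
      using subspace_avoid[OF _ sub[OF e]] by blast
    define w' where "w' = w(c := x)"
    have w'C: "w' ` insert c C = insert x (w ` C)"
      using insert.hyps by (auto simp: w'_def)
    have big: "rank_ge (card C + card {j\<in>J - C. fst j \<in> I} + 1) (w ` C \<union> (\<Union>e\<in>I. A e))"
      if "I \<subseteq> E" "I \<noteq> {}" for I
      using w that unfolding ok_def by blast
    have wA: "\<forall>c\<in>C. w c \<in> A (fst c)" and winj: "inj_on w C" and windep: "independent (w ` C)"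
      using w unfolding ok_def by blast+
    \<comment> \<open>Here \<open>I = {}\<close> is used: \<open>S {}\<close> is the span of the
      vectors already chosen. The invariant for \<open>{e}\<close> provides rank beyond
      \<open>card C\<close>, so \<open>A e\<close> is not contained in that span and
      \<open>x\<close> avoids it.\<close>
    have x_notin: "x \<notin> span (w ` C)"
    proof
      assume "x \<in> span (w ` C)"
      then have "x \<in> S {}" by (simp add: S_def)
      then have "A e \<subseteq> S {}" using x(2) unfolding F_def by blast
      then have "w ` C \<union> (\<Union>e\<in>{e}. A e) \<subseteq> span (w ` C)" by (auto simp: S_def span_base)
      then have "card C + card {j\<in>J - C. fst j \<in> {e}} + 1 \<le> card (w ` C)"
        using rank_ge_le_card[OF big[of "{e}"]] e insert.hyps(1) by auto
      then show False using card_image_le[OF insert.hyps(1), of w] by linarith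
    qed
    have "ok w' (insert c C)"
      unfolding ok_def
    proof (intro conjI allI impI ballI)
      fix c' assume "c' \<in> insert c C"
      then show "w' c' \<in> A (fst c')" using wA x(1) c by (cases "c' = c") (simp_all add: w'_def)
    next
      have "x \<notin> w ` C" using x_notin span_base[of x "w ` C"] by argo
      then have "inj_on w' C" unfolding w'_def by (intro inj_on_fun_updI winj)
      moreover have "w' c \<notin> w' ` C" using \<open>x \<notin> w ` C\<close> insert.hyps by (auto simp: w'_def)
      ultimately show "inj_on w' (insert c C)" using insert.hyps by simp
    next
      show "independent (w' ` insert c C)"
        unfolding w'C by (rule independent_insertI[OF x_notin windep])
    next
      fix I assume I: "I \<subseteq> E" "I \<noteq> {}"
      have fr: "finite {j\<in>J - C. fst j \<in> I}" for I using finJ by auto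
      have rle: "card {j\<in>J - insert c C. fst j \<in> I} \<le> card {j\<in>J - C. fst j \<in> I}"
        by (rule card_mono[OF fr]) auto
      have un: "w' ` insert c C \<union> (\<Union>e\<in>I. A e) = insert x (w ` C \<union> (\<Union>e\<in>I. A e))"
        unfolding w'C by auto
      show "rank_ge (card (insert c C) + card {j\<in>J - insert c C. fst j \<in> I} + 1)
         (w' ` insert c C \<union> (\<Union>e\<in>I. A e))"
      proof (cases "A e \<subseteq> S I")
        case False
        then have "x \<notin> S I" using x(2) I unfolding F_def by blast
        then have "rank_ge (Suc (card C + card {j\<in>J - C. fst j \<in> I} + 1)) (w' ` insert c C \<union> (\<Union>e\<in>I. A e))"
          unfolding un using rank_ge_insert[OF big[OF I]] by (simp add: S_def)
        then show ?thesis
          by (rule rank_ge_mono) (use rle insert.hyps in \<open>auto simp: span_superset\<close>)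
      next
        \<comment> \<open>Adding \<open>e\<close> to \<open>I\<close> does not change the span, but
          the slot \<open>c\<close> being filled is among the open ones over
          \<open>insert e I\<close>. The old invariant for \<open>insert e I\<close> therefore
          implies the new one for \<open>I\<close>.\<close>
        case True
        have sub: "w ` C \<union> (\<Union>e\<in>insert e I. A e) \<subseteq> span (w' ` insert c C \<union> (\<Union>e\<in>I. A e))"
        proof -
          have "S I \<subseteq> span (w' ` insert c C \<union> (\<Union>e\<in>I. A e))"
            unfolding un S_def by (rule span_mono) auto
          moreover have "w ` C \<union> (\<Union>e\<in>I. A e) \<subseteq> S I" by (simp add: S_def span_superset)
          ultimately show ?thesis using True by auto
        qed
        have "{j\<in>J - C. fst j \<in> insert e I} \<supseteq> insert c {j\<in>J - insert c C. fst j \<in> I}"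
          using c insert by auto
        then have "card (insert c {j\<in>J - insert c C. fst j \<in> I}) \<le> card {j\<in>J - C. fst j \<in> insert e I}"
          using fr card_mono by blast
        moreover have "finite {j\<in>J - insert c C. fst j \<in> I}" using finJ by auto
        ultimately have "Suc (card {j\<in>J - insert c C. fst j \<in> I}) \<le> card {j\<in>J - C. fst j \<in> insert e I}"
          by simp
        then show ?thesis
          using insert.hyps by (intro rank_ge_mono[OF big[of "insert e I"] sub]) (use e I in auto)
      qed
    qed
    then show ?case by blast
  qed
  obtain w where w: "ok w J" using step finJ by blast
  \<comment> \<open>With no open slot left, only the spare dimension remains in the invariant for
    \<open>{e}\<close>: \<open>card J\<close> vectors cannot span a set of rank
    \<open>card J + 1\<close>.\<close>
  have "\<not> A e \<subseteq> span (w ` J)" if "e \<in> E" for e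
  proof
    assume "A e \<subseteq> span (w ` J)"
    then have sub: "w ` J \<union> (\<Union>e\<in>{e}. A e) \<subseteq> span (w ` J)" by (auto simp: span_base)
    have "rank_ge (card J + card {j\<in>J - J. fst j \<in> {e}} + 1) (w ` J \<union> (\<Union>e\<in>{e}. A e))"
      using w that by (auto simp: ok_def)
    then have "card J + 1 \<le> card (w ` J)"
      using rank_ge_le_card[OF _ sub] finJ by fastforce
    then show False using card_image_le[OF finJ, of w] by linarith
  qed
  moreover have "w (e, i) \<in> A e" if "e \<in> E" "i < m" for e i
    using w that by (force simp: ok_def J_def)
  ultimately show ?thesis using w unfolding ok_def J_def by blast
qed

section \<open>Stresses and sparsity\<close>

lemma independent_family_iff:
  fixes f :: "'p \<Rightarrow> 'a::real_vector"
  assumes "finite P"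
  shows "inj_on f P \<and> independent (f ` P) \<longleftrightarrow>
    (\<forall>c. (\<Sum>p\<in>P. c p *\<^sub>R f p) = 0 \<longrightarrow> (\<forall>p\<in>P. c p = 0))"
proof (intro iffI conjI allI impI ballI)
  fix c p
  assume a: "inj_on f P \<and> independent (f ` P)" and 0: "(\<Sum>p\<in>P. c p *\<^sub>R f p) = 0" and p: "p \<in> P"
  have "(\<Sum>y\<in>f ` P. c (inv_into P f y) *\<^sub>R y) = 0"
    using a 0 by (simp add: sum.reindex)
  then have "c (inv_into P f (f p)) = 0"
    using a assms p independentD[of "f ` P" "f ` P" "\<lambda>y. c (inv_into P f y)" "f p"] by blast
  then show "c p = 0" using a p by simp
next
  assume a: "\<forall>c. (\<Sum>p\<in>P. c p *\<^sub>R f p) = 0 \<longrightarrow> (\<forall>p\<in>P. c p = 0)"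
  show inj: "inj_on f P"
  proof (rule inj_onI, rule ccontr)
    fix p q assume pq: "p \<in> P" "q \<in> P" "f p = f q" "p \<noteq> q"
    define c where "c = (\<lambda>r. if r = p then 1 else if r = q then - 1 else 0 :: real)"
    have "(\<Sum>r\<in>P. c r *\<^sub>R f r) = (\<Sum>r\<in>{p, q}. c r *\<^sub>R f r)"
      using pq assms by (intro sum.mono_neutral_right) (auto simp: c_def)
    also have "\<dots> = 0" using pq by (simp add: c_def)
    finally have "c p = 0" using a pq(1) by blast
    then show False by (simp add: c_def)
  qed
  show "independent (f ` P)"
  proof (rule independent_if_scalars_zero)
    fix g y assume "(\<Sum>y\<in>f ` P. g y *\<^sub>R y) = 0" "y \<in> f ` P"
    moreover have "(\<Sum>y\<in>f ` P. g y *\<^sub>R y) = (\<Sum>p\<in>P. g (f p) *\<^sub>R f p)"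
      using inj by (simp add: sum.reindex)
    ultimately show "g y = 0" using a[rule_format, of "\<lambda>p. g (f p)"] by auto
  qed (use assms in simp)
qed

section \<open>Rows of the parallel drawing matrix\<close>

definition point_mass :: "'v \<Rightarrow> 'a \<Rightarrow> 'v \<Rightarrow> 'a::real_vector" where
  "point_mass v n = (\<lambda>z. if z = v then n else 0)"

lemma linear_point_mass: "linear (point_mass v)"
  by (rule linearI) (auto simp: point_mass_def fun_eq_iff)

text \<open>A row of the parallel drawing matrix: paired with a configuration \<open>p\<close> it
  gives the inner product of \<open>n\<close> with \<open>p u - p v\<close>, so its vanishing asks
  the edge to be orthogonal to the normal \<open>n\<close>.\<close>

definition edge_row :: "'v \<Rightarrow> 'v \<Rightarrow> 'a \<Rightarrow> 'v \<Rightarrow> 'a::real_vector" where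
  "edge_row u v n = point_mass u n - point_mass v n"

lemma linear_edge_row: "linear (edge_row u v)"
  unfolding edge_row_def using linear_point_mass by (intro linear_compose_sub)

lemma edge_row_apply: "edge_row u v n z = (if z = u then n else 0) - (if z = v then n else 0)"
  by (simp add: edge_row_def point_mass_def)

text \<open>Every vector \<open>n\<close> of \<open>D\<close> at every vertex can be moved within its connected component to the
  representative of that component, which exhibits \<open>d\<close> independent rows per non-representative.\<close>

lemma sparse_edge_rank:
  fixes D :: "'a::euclidean_space set"
  assumes V: "finite V" and I: "\<And>e. e \<in> I \<Longrightarrow> e \<subseteq> V \<and> e = {s e, t e} \<and> s e \<noteq> t e" "I \<noteq> {}"
    and D: "subspace D" "dim D = d" "d > 0"
    and sparse: "\<And>V'. V' \<subseteq> V \<Longrightarrow> 2 \<le> card V' \<Longrightarrow>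
      (d - 1) * card {e\<in>I. e \<subseteq> V'} + (d + 1) \<le> d * card V'"
  shows "rank_ge ((d - 1) * card I + 1) (\<Union>e\<in>I. edge_row (s e) (t e) ` D)"
proof -
  define S where "S = (\<Union>e\<in>I. edge_row (s e) (t e) ` D)"
  define adj where "adj = {(u, v). \<exists>e\<in>I. u \<in> e \<and> v \<in> e}"
  have "sym adj" by (auto simp: adj_def sym_def)
  then have sym: "(v, u) \<in> adj\<^sup>*" if "(u, v) \<in> adj\<^sup>*" for u v
    using that by (meson symD sym_rtrancl)
  define rep where "rep v = (SOME u. (v, u) \<in> adj\<^sup>*)" for v
  have rep: "(v, rep v) \<in> adj\<^sup>*" for v
    unfolding rep_def by (rule someI[of _ v]) simp
  have rep_eq: "rep u = rep v" if "(u, v) \<in> adj\<^sup>*" for u v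
  proof -
    have "(u, w) \<in> adj\<^sup>* \<longleftrightarrow> (v, w) \<in> adj\<^sup>*" for w
      using that sym by (meson rtrancl_trans)
    then show ?thesis unfolding rep_def by simp
  qed
  have rep_rep: "rep (rep v) = rep v" for v using rep rep_eq by metis
  have inV: "(u, v) \<in> adj\<^sup>* \<Longrightarrow> u \<in> V \<Longrightarrow> v \<in> V" for u v
    by (induction rule: rtrancl_induct) (use I(1) in \<open>auto simp: adj_def\<close>)
  obtain B where B: "B \<subseteq> D" "independent B" "span B = D" "card B = d" "finite B"
    using basis_subspace_exists[OF D(1)] D(2) by metis
  define P where "P = {v\<in>V. rep v \<noteq> v} \<times> B"
  define f where "f = (\<lambda>(v, b::'a). edge_row v (rep v) b)"
  have finP: "finite P" using V B by (simp add: P_def)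
  have fam: "inj_on f P \<and> independent (f ` P)"
    unfolding independent_family_iff[OF finP]
  proof (intro allI impI ballI)
    fix c p assume 0: "(\<Sum>p\<in>P. c p *\<^sub>R f p) = 0" and "p \<in> P"
    then obtain v0 b0 where p: "p = (v0, b0)" "v0 \<in> V" "rep v0 \<noteq> v0" "b0 \<in> B" by (auto simp: P_def)
    \<comment> \<open>Rows end in representatives, all different from \<open>v0\<close>, so at the
      coordinate \<open>v0\<close> only the rows starting there survive, and the basis
      \<open>B\<close> separates them.\<close>
    have ne: "v0 \<noteq> rep v" for v using p(3) rep_rep[of v] by auto
    have "(0 :: 'a) = (\<Sum>p\<in>P. c p *\<^sub>R f p) v0" using 0 by simp
    also have "\<dots> = (\<Sum>p\<in>P. c p *\<^sub>R f p v0)" by (simp add: sum_fun_apply)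
    also have "\<dots> = (\<Sum>v\<in>{v\<in>V. rep v \<noteq> v}. \<Sum>b\<in>B. c (v, b) *\<^sub>R f (v, b) v0)"
      unfolding P_def by (simp add: sum.cartesian_product)
    also have "\<dots> = (\<Sum>v\<in>{v\<in>V. rep v \<noteq> v}. if v = v0 then \<Sum>b\<in>B. c (v0, b) *\<^sub>R b else 0)"
      using p ne by (intro sum.cong) (auto simp: f_def edge_row_apply)
    also have "\<dots> = (\<Sum>b\<in>B. c (v0, b) *\<^sub>R b)" using p V by simp
    finally have "(\<Sum>b\<in>B. c (v0, b) *\<^sub>R b) = 0" by simp
    then have "c (v0, b0) = 0"
      using independentD[OF B(2) B(5) subset_refl _ p(4), of "\<lambda>b. c (v0, b)"] by simp
    then show "c p = 0" using p by simp
  qed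
  have path: "edge_row u v b \<in> span S" if "(u, v) \<in> adj\<^sup>*" "b \<in> D" for u v b
    using that(1)
  proof (induction rule: rtrancl_induct)
    case base
    have "edge_row u u b = 0" by (simp add: edge_row_def)
    then show ?case by (metis span_zero)
  next
    case (step v w)
    then obtain e where e: "e \<in> I" "v \<in> e" "w \<in> e" by (auto simp: adj_def)
    have base: "edge_row (s e) (t e) b \<in> span S"
      using e that(2) by (intro span_base) (auto simp: S_def)
    have "v \<in> {s e, t e}" "w \<in> {s e, t e}" using I(1)[OF e(1)] e by auto
    then have "edge_row v w b \<in> {0, edge_row (s e) (t e) b, - edge_row (s e) (t e) b}"
      by (auto simp: edge_row_def)
    then have "edge_row v w b \<in> span S" using base span_neg span_zero by auto
    moreover have "edge_row u w b = edge_row u v b + edge_row v w b" by (simp add: edge_row_def)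
    ultimately show ?case using step.IH span_add by metis
  qed
  have fS: "f ` P \<subseteq> span S" using path rep B(1) by (auto simp: f_def P_def)
  define C where "C r = {v\<in>V. rep v = r}" for r
  define R where "R = rep ` V"
  have finR: "finite R" using V by (simp add: R_def)
  have finI: "finite I"
    using finite_subset[of I "Pow V"] I(1) V by blast
  have R_V: "R \<subseteq> V" using rep inV by (auto simp: R_def)
  have R_rep: "R = {v\<in>V. rep v = v}" using R_V rep_rep by (auto simp: R_def intro: rev_image_eqI)
  have cardV: "card V = (\<Sum>r\<in>R. card (C r))"
    using sum.image_gen[OF V, of "\<lambda>_. 1::nat" rep] by (simp add: R_def C_def)
  have e_rep: "rep (s e) = rep (t e)" if "e \<in> I" for e
    using that I(1)[OF that] by (intro rep_eq r_into_rtrancl) (auto simp: adj_def)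
  have cls: "{e\<in>I. rep (s e) = r} = {e\<in>I. e \<subseteq> C r}" for r
  proof -
    have "rep (s e) = r \<longleftrightarrow> e \<subseteq> C r" if "e \<in> I" for e
    proof -
      have "e \<subseteq> C r \<longleftrightarrow> (\<forall>v\<in>{s e, t e}. v \<in> C r)" using I(1)[OF that] by blast
      moreover have "s e \<in> V" "t e \<in> V" using I(1)[OF that] by auto
      ultimately show ?thesis using e_rep[OF that] by (simp add: C_def)
    qed
    then show ?thesis by blast
  qed
  have "(\<lambda>e. rep (s e)) ` I \<subseteq> R" using I(1) by (auto simp: R_def)
  then have cardI: "card I = (\<Sum>r\<in>R. card {e\<in>I. e \<subseteq> C r})"
    unfolding cls[symmetric] using sum.group[OF finI finR, of "\<lambda>e. rep (s e)" "\<lambda>_. 1::nat"] by simp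
  \<comment> \<open>Sparsity with the constant \<open>d + 1\<close>, split on each component into
    \<open>d\<close> for its representative plus one. A single vertex spans no edge and gives
    equality without the plus one.\<close>
  have le: "(d - 1) * card {e\<in>I. e \<subseteq> C r} + d + (if card (C r) \<ge> 2 then 1 else 0) \<le> d * card (C r)"
    if "r \<in> R" for r
  proof (cases "card (C r) \<ge> 2")
    case True
    then show ?thesis using sparse[of "C r"] by (auto simp: C_def)
  next
    case False
    have "r \<in> C r" using that R_rep by (auto simp: C_def)
    moreover have "finite (C r)" using V by (simp add: C_def)
    ultimately have c1: "card (C r) = 1" using False card_gt_0_iff[of "C r"] by (cases "card (C r)") auto
    have "{e\<in>I. e \<subseteq> C r} = {}"
    proof (rule ccontr)
      assume "{e\<in>I. e \<subseteq> C r} \<noteq> {}"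
      then obtain e where "e \<in> I" "e \<subseteq> C r" by blast
      then have "card {s e, t e} \<le> card (C r)" "s e \<noteq> t e"
        using I(1) card_mono \<open>finite (C r)\<close> by metis+
      then show False using c1 by simp
    qed
    then have "card {e\<in>I. e \<subseteq> C r} = 0" by (simp only: card.empty)
    then show ?thesis using c1 by simp
  qed
  obtain e where e: "e \<in> I" using I(2) by blast
  define r where "r = rep (s e)"
  have "r \<in> R" using I(1)[OF e] by (auto simp: r_def R_def)
  have "e \<subseteq> C r" using cls[of r] e by (auto simp: r_def)
  moreover have "finite (C r)" using V by (simp add: C_def)
  ultimately have "card {s e, t e} \<le> card (C r)" using I(1)[OF e] card_mono by metis
  moreover have "card {s e, t e} = 2" using I(1)[OF e] by (metis card_2_iff)
  ultimately have r2: "card (C r) \<ge> 2" by simp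
  \<comment> \<open>Since \<open>I\<close> is non-empty, some component has at least two vertices;
    it contributes the \<open>+ 1\<close> of the conclusion.\<close>
  have "(1::nat) \<le> (\<Sum>r\<in>R. if card (C r) \<ge> 2 then 1 else 0)"
    using member_le_sum[of r R "\<lambda>r. if card (C r) \<ge> 2 then 1 else 0 :: nat"] \<open>r \<in> R\<close> finR r2 by simp
  then have "(d - 1) * card I + d * card R + 1 \<le>
      (\<Sum>r\<in>R. (d - 1) * card {e\<in>I. e \<subseteq> C r} + d + (if card (C r) \<ge> 2 then 1 else 0))"
    unfolding cardI by (simp add: sum.distrib sum_distrib_left)
  also have "\<dots> \<le> d * card V"
    unfolding cardV sum_distrib_left by (rule sum_mono) (rule le)
  finally have ineq: "(d - 1) * card I + d * card R + 1 \<le> d * card V" .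
  have "{v\<in>V. rep v \<noteq> v} = V - R" using R_rep by auto
  then have "card P = (card V - card R) * d"
    using card_Diff_subset[OF finR R_V] B by (simp add: P_def card_cartesian_product)
  then have "(d - 1) * card I + 1 \<le> card P"
    using ineq by (simp add: algebra_simps diff_mult_distrib)
  also have "card P = card (f ` P)" using fam by (simp add: card_image)
  finally show ?thesis
    unfolding S_def[symmetric] using fam finP by (intro rank_geI[OF fS]) auto
qed

text \<open>The adjoint form of solvability. \<open>l\<close> is a functional on the right-hand
  sides \<open>b\<close>; the three hypotheses say that it annihilates the contributions of
  \<open>a\<close>, of \<open>c\<close> and of the multiples of \<open>x v\<close>, and the
  conclusion that only 0 does so. In this form the condition is the injectivity of a matrix with
  entries polynomial in \<open>x\<close>.\<close>

definition stress_free :: "'v set \<Rightarrow> 'v set set \<Rightarrow> ('v \<Rightarrow> 'a::euclidean_space) \<Rightarrow> bool" where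
  "stress_free V E x \<longleftrightarrow> (\<forall>l. (\<forall>v\<in>V. (\<Sum>e\<in>{e\<in>E. v \<in> e}. l v e) = 0) \<longrightarrow>
     (\<forall>e\<in>E. (\<Sum>v\<in>e. l v e) = 0) \<longrightarrow> (\<forall>e\<in>E. \<forall>v\<in>e. l v e \<bullet> x v = 0) \<longrightarrow>
     (\<forall>e\<in>E. \<forall>v\<in>e. l v e = 0))"

text \<open>The Riesz vector of \<open>f\<close> along the coordinate \<open>v\<close>, read off on
  the basis. It turns an abstract functional on the function space into one vector per
  coordinate.\<close>

lemma linear_functional_point_mass:
  fixes f :: "('v \<Rightarrow> 'a::euclidean_space) \<Rightarrow> real"
  assumes "linear f"
  shows "f (point_mass v y) = (\<Sum>b\<in>Basis. f (point_mass v b) *\<^sub>R b) \<bullet> y"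
proof -
  have "f (point_mass v y) = f (point_mass v (\<Sum>b\<in>Basis. (y \<bullet> b) *\<^sub>R b))"
    by (simp add: euclidean_representation)
  also have "\<dots> = (\<Sum>b\<in>Basis. (y \<bullet> b) * f (point_mass v b))"
  proof -
    have g: "linear (\<lambda>z. f (point_mass v z))"
      using linear_compose[OF linear_point_mass assms, of v] by (simp add: o_def)
    show ?thesis by (simp add: linear_sum[OF g] linear_cmul[OF g])
  qed
  also have "\<dots> = (\<Sum>b\<in>Basis. f (point_mass v b) *\<^sub>R b) \<bullet> y"
    unfolding inner_sum_left inner_scaleR_left
    by (intro sum.cong refl) (metis inner_commute mult.commute)
  finally show ?thesis .
qed

text \<open>In the affine chart \<open>x v = p v + u\<close> a stress is a linear dependence between the rows of the
  parallel drawing problem of \<open>p\<close>. One chooses generic row normals first, and then \<open>p\<close> in the kernel of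
  these rows.\<close>

lemma sparse_imp_stress_free:
  fixes E :: "'v set set"
  assumes V: "finite V" and E: "\<And>e. e \<in> E \<Longrightarrow> e \<subseteq> V \<and> card e = 2"
    and n: "DIM('a::euclidean_space) \<ge> 3"
    and sparse: "\<And>V'. V' \<subseteq> V \<Longrightarrow> 2 \<le> card V' \<Longrightarrow>
      (DIM('a) - 2) * card {e\<in>E. e \<subseteq> V'} + DIM('a) \<le> (DIM('a) - 1) * card V'"
  shows "\<exists>x :: 'v \<Rightarrow> 'a. stress_free V E x"
proof -
  define d where "d = DIM('a) - 1"
  define m where "m = DIM('a) - 2"
  have dm: "d - 1 = m" "d + 1 = DIM('a)" "m + 2 = DIM('a)" "d > 0" using n by (auto simp: d_def m_def)
  have finE: "finite E" using finite_subset[of E "Pow V"] E V by blast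
  have "\<exists>u v. e = {u, v} \<and> u \<noteq> v" if "e \<in> E" for e using E[OF that] by (auto simp: card_2_iff)
  then obtain s t where st: "\<And>e. e \<in> E \<Longrightarrow> e = {s e, t e} \<and> s e \<noteq> t e" by metis
  \<comment> \<open>The affine chart: \<open>D\<close> is the hyperplane orthogonal to the unit
    vector \<open>u0\<close>, and configurations are sought in the form \<open>p v + u0\<close> with
    \<open>p v\<close> in \<open>D\<close>.\<close>
  obtain u0 :: 'a where u0: "u0 \<in> Basis" using nonempty_Basis by blast
  have u0u0: "u0 \<bullet> u0 = 1" using u0 by (simp add: inner_Basis)
  define D where "D = {y. y \<bullet> u0 = 0}"
  have D: "subspace D" by (auto simp: D_def subspace_def inner_add_left)
  have D_inner: "u0 \<bullet> y = 0" "y \<bullet> u0 = 0" if "y \<in> D" for y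
    using that by (auto simp: D_def inner_commute)
  have "u0 \<noteq> 0" using u0 nonzero_Basis by blast
  then have dimD: "dim D = d" using dim_hyperplane[of u0] by (simp add: D_def d_def inner_commute)
  have rank: "rank_ge (m * card I + 1) (\<Union>e\<in>I. edge_row (s e) (t e) ` D)" if "I \<subseteq> E" "I \<noteq> {}" for I
  proof -
    have "(d - 1) * card {e\<in>I. e \<subseteq> V'} + (d + 1) \<le> d * card V'" if "V' \<subseteq> V" "2 \<le> card V'" for V'
    proof -
      have "card {e\<in>I. e \<subseteq> V'} \<le> card {e\<in>E. e \<subseteq> V'}"
        using \<open>I \<subseteq> E\<close> finE by (intro card_mono) auto
      then have "m * card {e\<in>I. e \<subseteq> V'} \<le> m * card {e\<in>E. e \<subseteq> V'}" by (rule mult_le_mono2)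
      moreover have "m * card {e\<in>E. e \<subseteq> V'} + (d + 1) \<le> d * card V'"
        using sparse[OF that, folded m_def d_def, folded dm(2)] .
      ultimately show ?thesis unfolding dm(1) by linarith
    qed
    moreover have "e \<subseteq> V \<and> e = {s e, t e} \<and> s e \<noteq> t e" if "e \<in> I" for e
    proof -
      have "e \<in> E" using that \<open>I \<subseteq> E\<close> by blast
      then show ?thesis using E[of e] st[of e] by argo
    qed
    ultimately show ?thesis
      using sparse_edge_rank[OF V _ \<open>I \<noteq> {}\<close> D dimD dm(4), of s t] unfolding dm(1) by meson
  qed
  have subA: "subspace (edge_row (s e) (t e) ` D)" for e
    using linear_subspace_image[OF linear_edge_row D] .
  define J where "J = E \<times> {..<m}"
  have finJ: "finite J" using finE by (simp add: J_def)
  obtain w where w: "\<And>e i. e \<in> E \<Longrightarrow> i < m \<Longrightarrow> w (e, i) \<in> edge_row (s e) (t e) ` D"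
    "inj_on w J" "independent (w ` J)" "\<And>e. e \<in> E \<Longrightarrow> \<not> edge_row (s e) (t e) ` D \<subseteq> span (w ` J)"
    using generic_transversal[OF finE subA rank] unfolding J_def by blast
  have "\<forall>j\<in>J. \<exists>n. n \<in> D \<and> w j = edge_row (s (fst j)) (t (fst j)) n"
    using w(1) by (auto simp: J_def)
  then obtain n where n: "\<And>j. j \<in> J \<Longrightarrow> n j \<in> D"
    "\<And>j. j \<in> J \<Longrightarrow> w j = edge_row (s (fst j)) (t (fst j)) (n j)"
    by metis
  have windep: "c j = 0" if "(\<Sum>j\<in>J. c j *\<^sub>R w j) = 0" "j \<in> J" for c j
    using independent_family_iff[OF finJ, of w] w(2,3) that by blast
  define K where "K = {p :: 'v \<Rightarrow> 'a. (\<forall>v. p v \<in> D) \<and> (\<forall>j\<in>J. n j \<bullet> p (s (fst j)) = n j \<bullet> p (t (fst j)))}"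
  have K: "subspace K"
    unfolding K_def subspace_def
    using D by (auto simp: subspace_0 subspace_add subspace_scale inner_add_right)
  define Q where "Q e = {p :: 'v \<Rightarrow> 'a. p (s e) = p (t e)}" for e
  have Q: "subspace (Q e)" for e by (auto simp: Q_def subspace_def)
  \<comment> \<open>A row of \<open>e\<close> outside the span of all chosen rows is detected by a
    functional vanishing on the chosen ones. Projected to \<open>D\<close>, its Riesz vectors form a
    configuration in the kernel \<open>K\<close> that separates the ends of
    \<open>e\<close>.\<close>
  have KQ: "\<not> K \<subseteq> Q e" if e: "e \<in> E" for e
  proof -
    obtain y where y: "y \<in> D" "edge_row (s e) (t e) y \<notin> span (w ` J)" using w(4)[OF e] by blast
    then have "independent (insert (edge_row (s e) (t e) y) (w ` J))"
      using w(3) by (simp add: independent_insertI)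
    then obtain f :: "('v \<Rightarrow> 'a) \<Rightarrow> real" where f: "linear f"
      "\<forall>z\<in>insert (edge_row (s e) (t e) y) (w ` J). f z = (if z = edge_row (s e) (t e) y then 1 else 0)"
      using linear_independent_extend
        [of "insert (edge_row (s e) (t e) y) (w ` J)" "\<lambda>z. if z = edge_row (s e) (t e) y then 1 else 0"] by blast
    have fw: "f (w j) = 0" if "j \<in> J" for j
      using f(2) that y(2) span_base by (metis image_eqI insertI2)
    have fy: "f (edge_row (s e) (t e) y) = 1" using f(2) by simp
    define q where "q v = (\<Sum>b\<in>Basis. f (point_mass v b) *\<^sub>R b)" for v
    have fq: "f (point_mass v z) = q v \<bullet> z" for v z
      unfolding q_def by (rule linear_functional_point_mass[OF f(1)])
    have f_row: "f (edge_row u v z) = (q u - q v) \<bullet> z" for u v z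
      unfolding edge_row_def linear_diff[OF f(1)] fq by (simp add: inner_diff_left)
    define p where "p v = q v - (q v \<bullet> u0) *\<^sub>R u0" for v
    have p_q: "z \<bullet> (p u - p v) = (q u - q v) \<bullet> z" if "z \<in> D" for u v z
      using D_inner[OF that] by (simp add: p_def algebra_simps inner_commute)
    have "p \<in> K"
      unfolding K_def
    proof (intro CollectI conjI ballI allI)
      fix v show "p v \<in> D" by (simp add: p_def D_def inner_diff_left u0u0)
    next
      fix j assume "j \<in> J"
      then have "n j \<bullet> (p (s (fst j)) - p (t (fst j))) = 0"
        using fw n f_row p_q by simp
      then show "n j \<bullet> p (s (fst j)) = n j \<bullet> p (t (fst j))"
        by (simp add: inner_diff_right)
    qed
    moreover have "p \<notin> Q e"
      using p_q[OF y(1), of "s e" "t e"] f_row[of "s e" "t e" y] fy by (auto simp: Q_def)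
    ultimately show ?thesis by blast
  qed
  \<comment> \<open>Each edge is non-degenerate in some kernel element; since finitely many proper
    subspaces do not cover \<open>K\<close>, one kernel element serves all edges.\<close>
  obtain p where p: "p \<in> K" "\<forall>T\<in>Q ` E. p \<notin> T"
    using subspace_avoid[of "Q ` E" K] finE K Q KQ by blast
  have pD: "p v \<in> D" for v using p by (auto simp: K_def)
  define x where "x v = p v + u0" for v
  have "stress_free V E x"
    unfolding stress_free_def
  proof (intro allI impI)
    fix l :: "'v \<Rightarrow> 'v set \<Rightarrow> 'a"
    assume vert: "\<forall>v\<in>V. (\<Sum>e\<in>{e\<in>E. v \<in> e}. l v e) = 0" and edge: "\<forall>e\<in>E. (\<Sum>v\<in>e. l v e) = 0"
      and perp: "\<forall>e\<in>E. \<forall>v\<in>e. l v e \<bullet> x v = 0"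
    define pr where "pr y = y - (y \<bullet> u0) *\<^sub>R u0" for y :: 'a
    have pr_D: "pr y \<in> D" for y by (simp add: pr_def D_def inner_diff_left u0u0)
    have lin_pr: "linear pr" unfolding pr_def
      by (rule linearI) (auto simp: algebra_simps)
    have opp: "l (t e) e = - l (s e) e" if "e \<in> E" for e
    proof -
      have "(\<Sum>v\<in>{s e, t e}. l v e) = 0" using edge st that by metis
      moreover have "(\<Sum>v\<in>{s e, t e}. l v e) = l (s e) e + l (t e) e"
        using conjunct2[OF st[OF that]] by simp
      ultimately show ?thesis by (simp add: eq_neg_iff_add_eq_0 add.commute)
    qed
    have ends: "s e \<in> e" "t e \<in> e" if "e \<in> E" for e using st[OF that] by auto
    \<comment> \<open>The normals of \<open>e\<close> are \<open>m\<close> independent vectors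
      orthogonal to \<open>u0\<close> and to \<open>r = p (s e) - p (t e)\<close>. The space
      orthogonal to these two vectors has dimension \<open>DIM('a) - 2 = m\<close>, so the normals
      span it, and it contains the projected stress.\<close>
    have coeffs: "\<exists>c. pr (l (s e) e) = (\<Sum>i<m. c i *\<^sub>R n (e, i))" if e: "e \<in> E" for e
    proof -
      define r where "r = p (s e) - p (t e)"
      have "r \<noteq> 0" using p(2) e by (auto simp: r_def Q_def)
      have "r \<in> D" using pD D by (simp add: r_def subspace_diff)
      define L where "L = {y \<in> UNIV. \<forall>x\<in>span {u0, r}. orthogonal x y}"
      have ru: "r \<bullet> u0 = 0" "u0 \<bullet> r = 0" using D_inner \<open>r \<in> D\<close> by auto
      have "r \<notin> span {u0}"
        using \<open>r \<noteq> 0\<close> u0u0 ru by (auto simp: span_singleton)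
      then have ind: "independent {u0, r}"
        using \<open>u0 \<noteq> 0\<close> independent_insertI[of r "{u0}"] by (simp add: insert_commute)
      have "r \<noteq> u0" using ru u0u0 by auto
      then have "dim (span {u0, r}) = 2" using ind dim_eq_card_independent[OF ind] by simp
      then have dimL: "dim L = m"
        using dim_subspace_orthogonal_to_vectors[of "span {u0, r}" "UNIV :: 'a set"] dm
        by (simp add: L_def)
      have L_eq: "y \<in> L \<longleftrightarrow> y \<bullet> u0 = 0 \<and> y \<bullet> r = 0" for y
      proof
        assume "y \<bullet> u0 = 0 \<and> y \<bullet> r = 0"
        then have "\<And>x. x \<in> {u0, r} \<Longrightarrow> orthogonal y x" by (auto simp: orthogonal_def)
        then show "y \<in> L" unfolding L_def
          using orthogonal_to_span orthogonal_commute by blast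
      next
        assume "y \<in> L"
        then show "y \<bullet> u0 = 0 \<and> y \<bullet> r = 0"
          unfolding L_def orthogonal_def using span_base[of _ "{u0, r}"] by (auto simp: inner_commute)
      qed
      have nJ: "(e, i) \<in> J" if "i < m" for i using e that by (simp add: J_def)
      have fam: "inj_on (\<lambda>i. n (e, i)) {..<m} \<and> independent ((\<lambda>i. n (e, i)) ` {..<m})"
        unfolding independent_family_iff[OF finite_lessThan]
      proof (intro allI impI ballI)
        fix c i assume 0: "(\<Sum>i<m. c i *\<^sub>R n (e, i)) = 0" and i: "i \<in> {..<m}"
        define c' where "c' = (\<lambda>(e', i). if e' = e then c i else 0)"
        have "(\<Sum>j\<in>J. c' j *\<^sub>R w j) = (\<Sum>e'\<in>E. \<Sum>i<m. c' (e', i) *\<^sub>R w (e', i))"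
          unfolding J_def by (simp add: sum.cartesian_product)
        also have "\<dots> = (\<Sum>e'\<in>E. if e' = e then \<Sum>i<m. c i *\<^sub>R w (e, i) else 0)"
          by (intro sum.cong) (auto simp: c'_def)
        also have "\<dots> = (\<Sum>i<m. c i *\<^sub>R edge_row (s e) (t e) (n (e, i)))"
          using finE e n(2) nJ by simp
        also have "\<dots> = edge_row (s e) (t e) (\<Sum>i<m. c i *\<^sub>R n (e, i))"
          by (simp add: linear_sum[OF linear_edge_row] linear_cmul[OF linear_edge_row])
        also have "\<dots> = 0" unfolding 0 by (rule linear_0[OF linear_edge_row])
        finally have "c' (e, i) = 0" using windep nJ i by blast
        then show "c i = 0" by (simp add: c'_def)
      qed
      have "(\<lambda>i. n (e, i)) ` {..<m} \<subseteq> L"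
      proof (intro image_subsetI)
        fix i assume "i \<in> {..<m}"
        then have j: "(e, i) \<in> J" using nJ by simp
        then have "n (e, i) \<bullet> r = 0" using p(1) by (force simp: K_def r_def inner_diff_right)
        then show "n (e, i) \<in> L" using n(1)[OF j] D_inner by (simp add: L_eq)
      qed
      then have L_span: "L \<subseteq> span ((\<lambda>i. n (e, i)) ` {..<m})"
        using fam dimL by (intro card_ge_dim_independent) (auto simp: card_image)
      have "l (s e) e \<bullet> x (s e) = 0" "l (s e) e \<bullet> x (t e) = 0"
        using perp e ends opp[OF e] by force+
      \<comment> \<open>The value \<open>l (s e) e\<close> is orthogonal to \<open>x\<close> at both
        ends because the values of \<open>l\<close> at the two ends are opposite; in the difference
        the summand \<open>u0\<close> cancels.\<close>
      then have "l (s e) e \<bullet> r = 0" by (simp add: r_def x_def algebra_simps)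
      then have "pr (l (s e) e) \<in> L"
        using ru by (simp add: L_eq pr_def inner_diff_left u0u0)
      then have "pr (l (s e) e) \<in> span ((\<lambda>i. n (e, i)) ` {..<m})" using L_span by blast
      then obtain u where "pr (l (s e) e) = (\<Sum>y\<in>(\<lambda>i. n (e, i)) ` {..<m}. u y *\<^sub>R y)"
        by (auto simp: span_finite)
      then show ?thesis using fam by (intro exI[of _ "\<lambda>i. u (n (e, i))"]) (simp add: sum.reindex)
    qed
    then obtain c where c: "\<And>e. e \<in> E \<Longrightarrow> pr (l (s e) e) = (\<Sum>i<m. c e i *\<^sub>R n (e, i))" by metis
    \<comment> \<open>The coordinate \<open>z\<close> of this sum is the image under
      \<open>pr\<close> of the equilibrium condition of the stress at the vertex
      \<open>z\<close>.\<close>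
    have "(\<Sum>j\<in>J. c (fst j) (snd j) *\<^sub>R w j) = 0"
    proof
      fix z
      have "(\<Sum>j\<in>J. c (fst j) (snd j) *\<^sub>R w j) =
          (\<Sum>e\<in>E. \<Sum>i<m. c e i *\<^sub>R edge_row (s e) (t e) (n (e, i)))"
        unfolding J_def sum.cartesian_product using n(2) by (intro sum.cong) (auto simp: J_def)
      also have "\<dots> = (\<Sum>e\<in>E. edge_row (s e) (t e) (pr (l (s e) e)))"
        using c by (simp add: linear_sum[OF linear_edge_row] linear_cmul[OF linear_edge_row])
      finally have "(\<Sum>j\<in>J. c (fst j) (snd j) *\<^sub>R w j) z =
          (\<Sum>e\<in>E. edge_row (s e) (t e) (pr (l (s e) e)) z)" by (simp add: sum_fun_apply)
      also have "\<dots> = (\<Sum>e\<in>E. if z \<in> e then pr (l z e) else 0)"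
      proof (intro sum.cong refl)
        fix e assume e: "e \<in> E"
        have "z \<in> e \<longleftrightarrow> z = s e \<or> z = t e" using st[OF e] by blast
        moreover have "pr (l (t e) e) = - pr (l (s e) e)"
          using opp[OF e] linear_neg[OF lin_pr] by simp
        ultimately show "edge_row (s e) (t e) (pr (l (s e) e)) z = (if z \<in> e then pr (l z e) else 0)"
          using st[OF e] by (auto simp: edge_row_apply)
      qed
      also have "\<dots> = (\<Sum>e\<in>{e\<in>E. z \<in> e}. pr (l z e))"
        using finE by (simp add: sum.inter_filter)
      also have "\<dots> = pr (\<Sum>e\<in>{e\<in>E. z \<in> e}. l z e)" by (simp add: linear_sum[OF lin_pr])
      also have "\<dots> = 0"
      proof (cases "z \<in> V")
        case True
        then show ?thesis using vert linear_0[OF lin_pr] by simp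
      next
        case False
        then have "{e\<in>E. z \<in> e} = {}" using E by blast
        then show ?thesis using linear_0[OF lin_pr] by (simp only: sum.empty)
      qed
      finally show "(\<Sum>j\<in>J. c (fst j) (snd j) *\<^sub>R w j) z = 0 z" by simp
    qed
    then have c0: "c e i = 0" if "e \<in> E" "i < m" for e i
      using windep[of "\<lambda>j. c (fst j) (snd j)" "(e, i)"] that by (simp add: J_def)
    have ls: "l (s e) e = 0" if e: "e \<in> E" for e
    proof -
      have "pr (l (s e) e) = 0" using c[OF e] c0[OF e] by simp
      then have le: "l (s e) e = (l (s e) e \<bullet> u0) *\<^sub>R u0" by (simp add: pr_def)
      have "l (s e) e \<bullet> x (s e) = 0" using perp e ends by blast
      \<comment> \<open>At this point \<open>l (s e) e\<close> is a multiple of \<open>u0\<close>;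
        orthogonality to \<open>x (s e)\<close>, which has height 1 over \<open>D\<close>, makes the
        multiple zero.\<close>
      moreover have "u0 \<bullet> x (s e) = 1" using D_inner[OF pD] u0u0 by (simp add: x_def inner_add_right)
      ultimately have "l (s e) e \<bullet> u0 = 0"
        using le by (metis inner_scaleR_left mult.right_neutral)
      then show ?thesis using le by simp
    qed
    show "\<forall>e\<in>E. \<forall>v\<in>e. l v e = 0"
    proof (intro ballI)
      fix e v assume "e \<in> E" "v \<in> e"
      then have "v = s e \<or> v = t e" using st by blast
      then show "l v e = 0" using ls opp \<open>e \<in> E\<close> by auto
    qed
  qed
  then show ?thesis by blast
qed

text \<open>Duality: a functional vanishing on the image of the coboundary is a stress.\<close>

lemma stress_free_imp_solvable:
  fixes x :: "'v \<Rightarrow> 'a::euclidean_space"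
  assumes V: "finite V" and E: "\<And>e. e \<in> E \<Longrightarrow> e \<subseteq> V" and sf: "stress_free V E x"
  shows "\<exists>a c. \<forall>e\<in>E. \<forall>v\<in>e. \<exists>t. a v - c e - b v e = t *\<^sub>R x v"
proof -
  define P where "P = (SIGMA e:E. e)"
  have P_iff: "(e, v) \<in> P \<longleftrightarrow> e \<in> E \<and> v \<in> e" for e v by (auto simp: P_def)
  have finE: "finite E" using finite_subset[of E "Pow V"] E V by blast
  have fin_e: "finite e" if "e \<in> E" for e using E[OF that] V finite_subset by blast
  have finP: "finite P" using finE fin_e by (simp add: P_def)
  define im where "im = (\<lambda>(a :: 'v \<Rightarrow> 'a, c :: 'v set \<Rightarrow> 'a, t :: 'v set \<times> 'v \<Rightarrow> real).
    \<lambda>p. if p \<in> P then a (snd p) - c (fst p) - t p *\<^sub>R x (snd p) else 0)"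
  define S where "S = range im"
  have im_apply: "im (a, c, t) p = (if p \<in> P then a (snd p) - c (fst p) - t p *\<^sub>R x (snd p) else 0)"
    for a c t p by (simp add: im_def)
  have S: "subspace S"
    unfolding subspace_def
  proof (intro conjI ballI allI)
    have "im (0, 0, 0) = 0" by (auto simp: fun_eq_iff im_apply)
    then show "0 \<in> S" unfolding S_def by (metis rangeI)
  next
    fix y z assume "y \<in> S" "z \<in> S"
    then obtain a c t a' c' t' where "y = im (a, c, t)" "z = im (a', c', t')"
      unfolding S_def by (metis imageE prod_cases3)
    then have "y + z = im (a + a', c + c', t + t')"
      by (auto simp: fun_eq_iff im_apply algebra_simps)
    then show "y + z \<in> S" unfolding S_def by (metis rangeI)
  next
    fix r y assume "y \<in> S"
    then obtain a c t where "y = im (a, c, t)"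
      unfolding S_def by (metis imageE prod_cases3)
    then have "r *\<^sub>R y = im (r *\<^sub>R a, r *\<^sub>R c, r *\<^sub>R t)"
      by (auto simp: fun_eq_iff im_apply algebra_simps)
    then show "r *\<^sub>R y \<in> S" unfolding S_def by (metis rangeI)
  qed
  define \<beta> where "\<beta> p = (if p \<in> P then b (snd p) (fst p) else 0)" for p
  have "\<beta> \<in> S"
  proof (rule ccontr)
    assume nS: "\<beta> \<notin> S"
    \<comment> \<open>A functional separating \<open>\<beta>\<close> from \<open>S\<close> comes
      from extending a basis of \<open>S\<close> by \<open>\<beta>\<close>; the argument is purely
      algebraic and valid in infinite dimension.\<close>
    obtain B where B: "B \<subseteq> S" "independent B" "S \<subseteq> span B"
      using maximal_independent_subset[of S] by metis
    have spB: "span B \<subseteq> S" using B(1) S span_minimal by metis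
    then have "\<beta> \<notin> span B" using nS by (meson subsetD)
    then have "independent (insert \<beta> B)" using B(2) by (rule independent_insertI)
    then obtain f where f: "linear f" "\<forall>y\<in>insert \<beta> B. f y = (if y = \<beta> then 1 else 0 :: real)"
      using linear_independent_extend[of "insert \<beta> B" "\<lambda>y. if y = \<beta> then 1 else 0"] by metis
    have "f y = 0" if "y \<in> B" for y
    proof -
      have "y \<noteq> \<beta>" using that B(1) nS by (meson subsetD)
      then show ?thesis using f(2) that by simp
    qed
    then have fS: "f y = 0" if "y \<in> S" for y
      using linear_eq_0_on_span[OF f(1), of B y] that B(3) by (meson subsetD)
    define l where "l v e = (\<Sum>k\<in>Basis. f (point_mass (e, v) k) *\<^sub>R k)" for v e
    have fl: "f (point_mass p y) = l (snd p) (fst p) \<bullet> y" for p y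
      unfolding l_def prod.collapse by (rule linear_functional_point_mass[OF f(1)])
    have f_expand: "f y = (\<Sum>p\<in>P. l (snd p) (fst p) \<bullet> y p)" if "\<And>p. p \<notin> P \<Longrightarrow> y p = 0" for y
    proof -
      have "y = (\<Sum>p\<in>P. point_mass p (y p))"
        using that finP by (simp add: fun_eq_iff sum_fun_apply point_mass_def)
      then have "f y = f (\<Sum>p\<in>P. point_mass p (y p))" by (rule arg_cong)
      also have "\<dots> = (\<Sum>p\<in>P. f (point_mass p (y p)))" by (rule linear_sum[OF f(1)])
      finally show ?thesis unfolding fl .
    qed
    have f_im: "(\<Sum>e\<in>E. \<Sum>v\<in>e. l v e \<bullet> (a v - c e - t (e, v) *\<^sub>R x v)) = 0" for a c t
    proof -
      have "0 = f (im (a, c, t))" using fS[of "im (a, c, t)"] by (simp add: S_def)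
      also have "\<dots> = (\<Sum>p\<in>P. l (snd p) (fst p) \<bullet> im (a, c, t) p)"
        by (rule f_expand) (auto simp: im_apply)
      also have "\<dots> = (\<Sum>p\<in>P. l (snd p) (fst p) \<bullet> (a (snd p) - c (fst p) - t p *\<^sub>R x (snd p)))"
        by (intro sum.cong refl) (simp add: im_apply)
      also have "\<dots> = (\<Sum>e\<in>E. \<Sum>v\<in>e. l v e \<bullet> (a v - c e - t (e, v) *\<^sub>R x v))"
        unfolding P_def using finE fin_e by (subst sum.Sigma) (auto intro!: sum.cong)
      finally show ?thesis by simp
    qed
    have 1: "(\<Sum>e\<in>{e\<in>E. v0 \<in> e}. l v0 e) = 0" for v0
    proof -
      \<comment> \<open>Testing with the sum itself as the value of \<open>a\<close> at
        \<open>v0\<close> yields \<open>y \<bullet> y = 0\<close>. The equations at the edges are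
        obtained in the same way.\<close>
      define y where "y = (\<Sum>e\<in>{e\<in>E. v0 \<in> e}. l v0 e)"
      have "0 = (\<Sum>e\<in>E. \<Sum>v\<in>e. l v e \<bullet> (point_mass v0 y v - 0 - 0 *\<^sub>R x v))"
        using f_im[of "point_mass v0 y" "\<lambda>_. 0" "\<lambda>_. 0"] by simp
      also have "\<dots> = (\<Sum>e\<in>E. \<Sum>v\<in>e. if v = v0 then l v0 e \<bullet> y else 0)"
        by (intro sum.cong refl) (simp add: point_mass_def)
      also have "\<dots> = (\<Sum>e\<in>E. if v0 \<in> e then l v0 e \<bullet> y else 0)"
        by (intro sum.cong refl) (simp add: fin_e)
      also have "\<dots> = (\<Sum>e\<in>{e\<in>E. v0 \<in> e}. l v0 e \<bullet> y)"
        by (rule sum.inter_filter[OF finE, symmetric])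
      also have "\<dots> = y \<bullet> y" unfolding inner_sum_left[symmetric] y_def ..
      finally show ?thesis by (simp add: y_def)
    qed
    have 2: "(\<Sum>v\<in>e0. l v e0) = 0" if "e0 \<in> E" for e0
    proof -
      define y where "y = (\<Sum>v\<in>e0. l v e0)"
      have "0 = (\<Sum>e\<in>E. \<Sum>v\<in>e. l v e \<bullet> (0 - point_mass e0 y e - 0 *\<^sub>R x v))"
        using f_im[of "\<lambda>_. 0" "point_mass e0 y" "\<lambda>_. 0"] by simp
      also have "\<dots> = (\<Sum>e\<in>E. if e = e0 then - (\<Sum>v\<in>e0. l v e0 \<bullet> y) else 0)"
        by (intro sum.cong refl) (auto simp: point_mass_def sum_negf)
      also have "\<dots> = - (\<Sum>v\<in>e0. l v e0 \<bullet> y)" using finE that by simp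
      also have "\<dots> = - (y \<bullet> y)" unfolding inner_sum_left[symmetric] y_def ..
      finally show ?thesis by (simp add: y_def)
    qed
    have 3: "l v0 e0 \<bullet> x v0 = 0" if "e0 \<in> E" "v0 \<in> e0" for v0 e0
    proof -
      have "0 = (\<Sum>e\<in>E. \<Sum>v\<in>e. l v e \<bullet> (0 - 0 - point_mass (e0, v0) 1 (e, v) *\<^sub>R x v))"
        using f_im[of "\<lambda>_. 0" "\<lambda>_. 0" "point_mass (e0, v0) 1"] by simp
      also have "\<dots> = (\<Sum>e\<in>E. if e = e0 then (\<Sum>v\<in>e0. if v = v0 then - (l v0 e0 \<bullet> x v0) else 0) else 0)"
        by (intro sum.cong refl) (auto simp: point_mass_def intro!: sum.cong sum.neutral)
      also have "\<dots> = - (l v0 e0 \<bullet> x v0)"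
        using finE that fin_e by simp
      finally show ?thesis by simp
    qed
    have zero: "\<forall>e\<in>E. \<forall>v\<in>e. l v e = 0"
      using sf[unfolded stress_free_def, THEN spec[of _ l]] 1 2 3 by blast
    have "f \<beta> = (\<Sum>p\<in>P. l (snd p) (fst p) \<bullet> \<beta> p)" by (rule f_expand) (simp add: \<beta>_def)
    also have "\<dots> = 0" using zero by (intro sum.neutral) (auto simp: P_def)
    finally show False using f(2) by simp
  qed
  then obtain a c t where eq: "\<beta> = im (a, c, t)"
    unfolding S_def by (metis imageE prod_cases3)
  have "a v - c e - b v e = t (e, v) *\<^sub>R x v" if "e \<in> E" "v \<in> e" for e v
    using fun_cong[OF eq, of "(e, v)"] that by (simp add: \<beta>_def im_apply P_iff algebra_simps)
  then show ?thesis by blast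
qed

text \<open>Gauging: translating all \<open>a v\<close> by a common vector and along \<open>x v\<close> does not affect solvability, so
  \<open>a v\<close> may be taken in a complement of \<open>x v\<close>, zero at \<open>v0\<close> and in a complement of the plane spanned by
  \<open>x v0\<close> and \<open>x v1\<close> at \<open>v1\<close>.\<close>

lemma solvable_imp_sparse:
  fixes x :: "'v \<Rightarrow> 'a::euclidean_space"
  assumes V: "finite V" and E: "\<And>e. e \<in> E \<Longrightarrow> card e = 2"
    and gen: "\<And>u v. u \<in> V \<Longrightarrow> v \<in> V \<Longrightarrow> u \<noteq> v \<Longrightarrow> x u \<notin> span {x v}"
    and solv: "\<And>b. \<exists>a c. \<forall>e\<in>E. \<forall>v\<in>e. \<exists>t. a v - c e - b v e = t *\<^sub>R x v"
    and V': "V' \<subseteq> V" "2 \<le> card V'"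
  shows "(DIM('a) - 2) * card {e\<in>E. e \<subseteq> V'} + DIM('a) \<le> (DIM('a) - 1) * card V'"
proof -
  define E' where "E' = {e\<in>E. e \<subseteq> V'}"
  have finV': "finite V'" using V V' finite_subset by blast
  have finE': "finite E'" using finite_subset[of E' "Pow V'"] finV' by (auto simp: E'_def)
  have "\<exists>u v. e = {u, v} \<and> u \<noteq> v" if "e \<in> E'" for e
    using that E[of e] by (auto simp: card_2_iff E'_def)
  then obtain s t where st: "\<And>e. e \<in> E' \<Longrightarrow> e = {s e, t e} \<and> s e \<noteq> t e" by metis
  have st_V': "s e \<in> V'" "t e \<in> V'" "s e \<in> e" "t e \<in> e" "e \<in> E" if "e \<in> E'" for e
  proof -
    have "{s e, t e} \<subseteq> V'" using st[OF that] that by (auto simp: E'_def)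
    then show "s e \<in> V'" "t e \<in> V'" by auto
    show "s e \<in> e" "t e \<in> e" using st[OF that] by auto
    show "e \<in> E" using that by (simp add: E'_def)
  qed
  obtain v0 v1 where v01: "v0 \<in> V'" "v1 \<in> V'" "v0 \<noteq> v1"
    using V'(2) by (metis card_le_Suc_iff card_1_singletonE insertCI numeral_2_eq_2 obtain_subset_with_card_n card_2_iff subset_iff)
  have x0: "x v \<noteq> 0" if "v \<in> V'" for v
  proof -
    obtain u where "u \<in> V'" "u \<noteq> v" using v01 by metis
    then have "x v \<notin> span {x u}" using gen V'(1) that by (metis subsetD)
    then show ?thesis using span_zero by metis
  qed
  have ex1: "\<exists>B. finite B \<and> card B = DIM('a) - 1 \<and> span (insert (x v) B) = UNIV" if "v \<in> V'" for v
  proof -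
    have "independent {x v}" using x0 that by simp
    then obtain B where B: "{x v} \<subseteq> B" "independent B" "UNIV \<subseteq> span B"
      using maximal_independent_subset_extend[of "{x v}" UNIV] by auto
    then have "card B = DIM('a)" "finite B"
      using basis_card_eq_dim[of B UNIV] finiteI_independent by (auto simp: dim_UNIV)
    then show ?thesis using B by (intro exI[of _ "B - {x v}"]) (auto simp: insert_absorb)
  qed
  have ex2: "\<exists>B. finite B \<and> card B = DIM('a) - 2 \<and> span (insert (x v1) (insert (x v0) B)) = UNIV"
  proof -
    have ne: "x v1 \<notin> span {x v0}" using gen v01 V'(1) by (metis subsetD)
    then have "independent {x v1, x v0}" using x0 v01 by (intro independent_insertI) (auto simp: independent_empty)
    then obtain B where B: "{x v1, x v0} \<subseteq> B" "independent B" "UNIV \<subseteq> span B"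
      using maximal_independent_subset_extend[of "{x v1, x v0}" UNIV] by auto
    have "x v1 \<noteq> x v0" using ne span_base by (metis insertI1)
    moreover have "card B = DIM('a)" "finite B"
      using B basis_card_eq_dim[of B UNIV] finiteI_independent by (auto simp: dim_UNIV)
    moreover have "insert (x v1) (insert (x v0) (B - {x v1, x v0})) = B" using B(1) by auto
    moreover have "span B = UNIV" using B(3) by auto
    ultimately show ?thesis using B(1)
      by (intro exI[of _ "B - {x v1, x v0}"]) (simp add: card_Diff_subset)
  qed
  obtain B1 where B1: "\<And>v. v \<in> V' \<Longrightarrow> finite (B1 v)" "\<And>v. v \<in> V' \<Longrightarrow> card (B1 v) = DIM('a) - 1"
      "\<And>v. v \<in> V' \<Longrightarrow> span (insert (x v) (B1 v)) = UNIV" using ex1 by metis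
  obtain B2 where B2: "finite B2" "card B2 = DIM('a) - 2"
      "span (insert (x v1) (insert (x v0) B2)) = UNIV" using ex2 by metis
  \<comment> \<open>The gauge in numbers: no unknown at \<open>v0\<close>,
    \<open>DIM('a) - 2\<close> at \<open>v1\<close> and \<open>DIM('a) - 1\<close> at every other
    vertex of \<open>V'\<close>.\<close>
  define B where "B v = (if v = v0 then {} else if v = v1 then B2 else B1 v)" for v
  have finB: "finite (B v)" if "v \<in> V'" for v using that B1 B2 by (simp add: B_def)
  \<comment> \<open>The effect of the displacement \<open>y\<close> at \<open>v\<close> on the edges
    of \<open>E'\<close>, after \<open>c e\<close> has been eliminated by subtracting the equation
    at \<open>t e\<close> from the one at \<open>s e\<close>.\<close>
  define \<gamma> where "\<gamma> v y = (\<lambda>e. if e \<in> E' then edge_row (s e) (t e) y v else 0)" for v and y :: 'a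
  have lin\<gamma>: "linear (\<gamma> v)" for v
    by (rule linearI) (auto simp: \<gamma>_def fun_eq_iff edge_row_apply algebra_simps)
  define T1 where "T1 = (\<lambda>(v, b). \<gamma> v b) ` (SIGMA v:V'. B v)"
  define T2 where "T2 = (\<lambda>e. point_mass e (x (s e))) ` E'"
  define T3 where "T3 = (\<lambda>e. point_mass e (x (t e))) ` E'"
  define T where "T = T1 \<union> T2 \<union> T3"
  have finT: "finite T" using finV' finB finE' by (auto simp: T_def T1_def T2_def T3_def)
  have "card (SIGMA v:V'. B v) = (\<Sum>v\<in>V'. card (B v))" using finV' finB by simp
  also have "\<dots> = (\<Sum>v\<in>{v0, v1}. card (B v)) + (\<Sum>v\<in>V' - {v0, v1}. card (B v))"
    using v01 finV' by (intro sum.subset_diff[of "{v0, v1}" V' "\<lambda>v. card (B v)", THEN trans]) auto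
  also have "(\<Sum>v\<in>{v0, v1}. card (B v)) = DIM('a) - 2" using v01 B2 by (simp add: B_def)
  also have "(\<Sum>v\<in>V' - {v0, v1}. card (B v)) = (card V' - 2) * (DIM('a) - 1)"
  proof -
    have "(\<Sum>v\<in>V' - {v0, v1}. card (B v)) = (\<Sum>v\<in>V' - {v0, v1}. DIM('a) - 1)"
      using B1 by (intro sum.cong) (auto simp: B_def)
    then show ?thesis using v01 by (simp add: card_Diff_subset numeral_2_eq_2)
  qed
  finally have cT1: "card T1 \<le> (DIM('a) - 2) + (card V' - 2) * (DIM('a) - 1)"
    unfolding T1_def using card_image_le[of "SIGMA v:V'. B v"] finV' finB by (metis finite_SigmaI)
  have "card T \<le> card T1 + card T2 + card T3"
    unfolding T_def by (meson add_le_mono card_Un_le le_refl le_trans)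
  also have "\<dots> \<le> ((DIM('a) - 2) + (card V' - 2) * (DIM('a) - 1)) + card E' + card E'"
    unfolding T2_def T3_def using card_image_le[OF finE'] cT1 by (intro add_mono) auto
  finally have cT: "card T \<le> ((DIM('a) - 2) + (card V' - 2) * (DIM('a) - 1)) + 2 * card E'" by simp
  \<comment> \<open>A right-hand side concentrated at the incidence of \<open>s e0\<close> with
    \<open>e0\<close> leaves \<open>point_mass e0 b\<close> after this subtraction, and a solution
    of the system expresses it through \<open>T\<close>.\<close>
  have unit: "point_mass e0 b \<in> span T" if e0: "e0 \<in> E'" for e0 b
  proof -
    define \<beta> where "\<beta> v e = (if e = e0 \<and> v = s e0 then b else 0)" for v e
    obtain a c where ac: "\<forall>e\<in>E. \<forall>v\<in>e. \<exists>t. a v - c e - \<beta> v e = t *\<^sub>R x v" using solv[of \<beta>] by blast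
    obtain k m r1 where r1: "a v1 - a v0 = k *\<^sub>R x v1 + m *\<^sub>R x v0 + r1" "r1 \<in> span B2"
    proof -
      have "a v1 - a v0 \<in> span (insert (x v1) (insert (x v0) B2))" using B2(3) by simp
      then obtain k where "a v1 - a v0 - k *\<^sub>R x v1 \<in> span (insert (x v0) B2)"
        unfolding span_insert[of "x v1"] by blast
      then obtain m where "a v1 - a v0 - k *\<^sub>R x v1 - m *\<^sub>R x v0 \<in> span B2"
        unfolding span_insert[of "x v0"] by blast
      then show ?thesis
        by (intro that[of k m "a v1 - a v0 - k *\<^sub>R x v1 - m *\<^sub>R x v0"]) auto
    qed
    \<comment> \<open>The common translation to be removed: it agrees with \<open>a v0\<close>
      modulo \<open>x v0\<close>, and \<open>m\<close> is such that it differs from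
      \<open>a v1\<close> by a multiple of \<open>x v1\<close> plus a vector in the span of
      \<open>B2\<close>.\<close>
    define y where "y = a v0 + m *\<^sub>R x v0"
    have "\<exists>k r. a v = y + k *\<^sub>R x v + r \<and> r \<in> span (B v)" if v: "v \<in> V'" for v
    proof -
      consider "v = v0" | "v = v1" | "v \<noteq> v0" "v \<noteq> v1" by blast
      then show ?thesis
      proof cases
        case 1
        then show ?thesis
          by (intro exI[of _ "- m"] exI[of _ 0]) (simp add: y_def B_def)
      next
        case 2
        have "a v1 = y + k *\<^sub>R x v1 + r1" using r1(1) by (simp add: y_def algebra_simps)
        then show ?thesis using 2 r1(2) v01 by (intro exI[of _ k] exI[of _ r1]) (simp add: B_def)
      next
        case 3
        have "a v - y \<in> span (insert (x v) (B1 v))" using B1(3)[OF v] by simp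
        then obtain k where "a v - y - k *\<^sub>R x v \<in> span (B1 v)" unfolding span_insert by blast
        then show ?thesis using 3
          by (intro exI[of _ k] exI[of _ "a v - y - k *\<^sub>R x v"]) (simp add: B_def)
      qed
    qed
    then obtain k r where kr: "\<And>v. v \<in> V' \<Longrightarrow> a v = y + k v *\<^sub>R x v + r v"
      "\<And>v. v \<in> V' \<Longrightarrow> r v \<in> span (B v)" by metis
    have "\<exists>p q. point_mass e0 b e = r (s e) - r (t e) + p *\<^sub>R x (s e) + q *\<^sub>R x (t e)"
      if e: "e \<in> E'" for e
    proof -
      have inc: "\<exists>t. a v - c e - \<beta> v e = t *\<^sub>R x v" if "v \<in> e" for v
        using bspec[OF bspec[OF ac st_V'(5)[OF e]] that] .
      from inc[OF st_V'(3)[OF e]] obtain p where p: "a (s e) - c e - \<beta> (s e) e = p *\<^sub>R x (s e)" ..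
      from inc[OF st_V'(4)[OF e]] obtain q where q: "a (t e) - c e - \<beta> (t e) e = q *\<^sub>R x (t e)" ..
      have "\<beta> (s e) e = point_mass e0 b e" by (simp add: \<beta>_def point_mass_def)
      moreover have "\<beta> (t e) e = 0" using conjunct2[OF st[OF e]] by (auto simp: \<beta>_def)
      ultimately have "point_mass e0 b e = a (s e) - a (t e) - p *\<^sub>R x (s e) + q *\<^sub>R x (t e)"
        using p q by (simp add: algebra_simps)
      also have "\<dots> = r (s e) - r (t e) + (k (s e) - p) *\<^sub>R x (s e) + (q - k (t e)) *\<^sub>R x (t e)"
        using kr(1)[OF st_V'(1)[OF e]] kr(1)[OF st_V'(2)[OF e]] by (simp add: algebra_simps)
      finally show ?thesis by blast
    qed
    then obtain p q where pq: "\<And>e. e \<in> E' \<Longrightarrow>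
      point_mass e0 b e = r (s e) - r (t e) + p e *\<^sub>R x (s e) + q e *\<^sub>R x (t e)" by metis
    have "point_mass e0 b = (\<Sum>v\<in>V'. \<gamma> v (r v)) +
      ((\<Sum>e\<in>E'. p e *\<^sub>R point_mass e (x (s e))) + (\<Sum>e\<in>E'. q e *\<^sub>R point_mass e (x (t e))))"
      (is "_ = ?R")
    proof
      fix e
      show "point_mass e0 b e = ?R e"
      proof (cases "e \<in> E'")
        case True
        have "(\<Sum>v\<in>V'. \<gamma> v (r v) e) = (\<Sum>v\<in>V'. (if v = s e then r v else 0) - (if v = t e then r v else 0))"
          using True by (intro sum.cong) (auto simp: \<gamma>_def edge_row_apply)
        also have "\<dots> = r (s e) - r (t e)"
          using st_V'(1,2)[OF True] finV' by (simp add: sum_subtractf)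
        finally have 1: "(\<Sum>v\<in>V'. \<gamma> v (r v) e) = r (s e) - r (t e)" .
        have 2: "(\<Sum>e'\<in>E'. p e' *\<^sub>R point_mass e' (x (s e')) e) = p e *\<^sub>R x (s e)"
        proof -
          have "(\<Sum>e'\<in>E'. p e' *\<^sub>R point_mass e' (x (s e')) e) = (\<Sum>e'\<in>E'. if e' = e then p e *\<^sub>R x (s e) else 0)"
            by (intro sum.cong) (auto simp: point_mass_def)
          then show ?thesis using True finE' by simp
        qed
        have 3: "(\<Sum>e'\<in>E'. q e' *\<^sub>R point_mass e' (x (t e')) e) = q e *\<^sub>R x (t e)"
        proof -
          have "(\<Sum>e'\<in>E'. q e' *\<^sub>R point_mass e' (x (t e')) e) = (\<Sum>e'\<in>E'. if e' = e then q e *\<^sub>R x (t e) else 0)"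
            by (intro sum.cong) (auto simp: point_mass_def)
          then show ?thesis using True finE' by simp
        qed
        show ?thesis using pq[OF True] by (simp add: sum_fun_apply 1 2 3)
      next
        case False
        have pm: "point_mass e' z e = 0" if "e' \<in> E'" for e' and z :: 'a
          using False that by (auto simp: point_mass_def)
        have "(\<Sum>e'\<in>E'. p e' *\<^sub>R point_mass e' (x (s e')) e) = 0"
          "(\<Sum>e'\<in>E'. q e' *\<^sub>R point_mass e' (x (t e')) e) = 0"
          by (simp_all add: pm)
        then show ?thesis using False pm[OF e0] by (simp add: sum_fun_apply \<gamma>_def)
      qed
    qed
    moreover have "\<gamma> v (r v) \<in> span T" if "v \<in> V'" for v
    proof -
      have "\<gamma> v ` span (B v) = span (\<gamma> v ` B v)" by (rule linear_span_image[OF lin\<gamma>, symmetric])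
      then have "\<gamma> v (r v) \<in> span (\<gamma> v ` B v)" using kr(2)[OF that] by (metis imageI)
      moreover have "\<gamma> v ` B v \<subseteq> T" using that by (auto simp: T_def T1_def)
      ultimately show ?thesis using span_mono by (metis subsetD)
    qed
    moreover have "point_mass e (x (s e)) \<in> span T" "point_mass e (x (t e)) \<in> span T" if "e \<in> E'" for e
      using that by (auto intro!: span_base simp: T_def T2_def T3_def)
    ultimately show ?thesis
      by (simp only:) (intro span_add span_sum span_scale; simp)
  qed
  define F where "F = (\<lambda>(e, b). point_mass e b :: 'v set \<Rightarrow> 'a)"
  have fam: "inj_on F (E' \<times> Basis) \<and> independent (F ` (E' \<times> Basis))"
    unfolding independent_family_iff[OF finite_cartesian_product[OF finE' finite_Basis]]
  proof (intro allI impI ballI)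
    fix c p assume 0: "(\<Sum>p\<in>E' \<times> Basis. c p *\<^sub>R F p) = 0" and "p \<in> E' \<times> (Basis :: 'a set)"
    then obtain e0 b0 where p: "p = (e0, b0)" "e0 \<in> E'" "b0 \<in> Basis" by blast
    have "0 = (\<Sum>p\<in>E' \<times> Basis. c p *\<^sub>R F p) e0" using 0 by simp
    also have "\<dots> = (\<Sum>e\<in>E'. \<Sum>b\<in>Basis. c (e, b) *\<^sub>R point_mass e b e0)"
      by (simp add: sum_fun_apply F_def sum.cartesian_product case_prod_unfold)
    also have "\<dots> = (\<Sum>e\<in>E'. if e = e0 then \<Sum>b\<in>Basis. c (e0, b) *\<^sub>R b else 0)"
      by (intro sum.cong) (auto simp: point_mass_def)
    also have "\<dots> = (\<Sum>b\<in>Basis. c (e0, b) *\<^sub>R b)" using p finE' by simp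
    finally have "(\<Sum>b\<in>Basis. c (e0, b) *\<^sub>R b) = 0" by simp
    then have "(\<Sum>b\<in>Basis. c (e0, b) *\<^sub>R b) \<bullet> b0 = 0" by simp
    then show "c p = 0" using p by simp
  qed
  have "F ` (E' \<times> Basis) \<subseteq> span T" using unit by (auto simp: F_def)
  then have "card (F ` (E' \<times> Basis)) \<le> card T"
    using independent_span_bound[OF finT] fam by blast
  \<comment> \<open>The unit vectors are independent and spanned by \<open>T\<close>. Moving the two
    line multiples per edge, counted in \<open>T2\<close> and \<open>T3\<close>, to the left turns
    the factor \<open>DIM('a)\<close> into \<open>DIM('a) - 2\<close>.\<close>
  then have "card E' * DIM('a) \<le> card T" using fam by (simp add: card_image card_cartesian_product)
  then have le: "card E' * DIM('a) \<le> ((DIM('a) - 2) + (card V' - 2) * (DIM('a) - 1)) + 2 * card E'"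
    using cT by linarith
  have "DIM('a) \<ge> 2"
  proof -
    have "card {x v0, x v1} \<le> DIM('a)"
      using gen[of v1 v0] x0 v01 V'(1) independent_insertI[of "x v1" "{x v0}"]
        independent_bound[of "{x v1, x v0}"] by (auto simp: insert_commute)
    moreover have "x v0 \<noteq> x v1" using gen[of v0 v1] v01 V'(1) span_base[of "x v1" "{x v1}"]
      by (metis insertI1 subsetD)
    ultimately show ?thesis by simp
  qed
  then obtain i where i: "DIM('a) = i + 2" by (metis add.commute le_Suc_ex)
  obtain j where j: "card V' = j + 2" using V'(2) by (metis add.commute le_Suc_ex)
  show ?thesis
    using le unfolding E'_def[symmetric] i j by (simp add: algebra_simps)
qed

section \<open>Zariski-open conditions on configurations\<close>

text \<open>Polynomials in the coordinates of the vectors; each involves only finitely many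
  vertices, also when the vertex type is infinite.\<close>

inductive polynomial_fun :: "(('v \<Rightarrow> 'a::euclidean_space) \<Rightarrow> real) \<Rightarrow> bool" where
  const: "polynomial_fun (\<lambda>_. c)"
| coord: "polynomial_fun (\<lambda>x. x v \<bullet> b)"
| add: "polynomial_fun f \<Longrightarrow> polynomial_fun g \<Longrightarrow> polynomial_fun (\<lambda>x. f x + g x)"
| mult: "polynomial_fun f \<Longrightarrow> polynomial_fun g \<Longrightarrow> polynomial_fun (\<lambda>x. f x * g x)"

lemma polynomial_fun_diff:
  assumes "polynomial_fun f" "polynomial_fun g" shows "polynomial_fun (\<lambda>x. f x - g x)"
  using polynomial_fun.add[OF assms(1) polynomial_fun.mult[OF polynomial_fun.const[of "-1"] assms(2)]]
  by simp

lemma polynomial_fun_sum: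
  "(\<And>i. i \<in> I \<Longrightarrow> polynomial_fun (f i)) \<Longrightarrow> polynomial_fun (\<lambda>x. \<Sum>i\<in>I. f i x)"
  by (induction I rule: infinite_finite_induct)
    (auto intro: polynomial_fun.const polynomial_fun.add)

lemma polynomial_fun_inner: "polynomial_fun (\<lambda>x :: 'v \<Rightarrow> 'a::euclidean_space. x u \<bullet> x v)"
proof -
  have "(\<lambda>x. x u \<bullet> x v) = (\<lambda>x :: 'v \<Rightarrow> 'a. \<Sum>b\<in>Basis. (x u \<bullet> b) * (x v \<bullet> b))"
    by (rule ext) (rule euclidean_inner)
  moreover have "polynomial_fun (\<lambda>x :: 'v \<Rightarrow> 'a. \<Sum>b\<in>Basis. (x u \<bullet> b) * (x v \<bullet> b))"
    by (intro polynomial_fun_sum polynomial_fun.mult polynomial_fun.coord)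
  ultimately show ?thesis by simp
qed

lemma polynomial_fun_continuous: "polynomial_fun f \<Longrightarrow> continuous_on UNIV f"
  by (induction rule: polynomial_fun.induct)
    (auto intro!: continuous_on_const continuous_on_inner continuous_on_product_coordinates
      continuous_on_add continuous_on_mult)

lemma polynomial_fun_line:
  "polynomial_fun f \<Longrightarrow> \<exists>p. \<forall>t. f (\<lambda>v. y v + t *\<^sub>R (z v - y v)) = poly p t"
proof (induction rule: polynomial_fun.induct)
  case (const c)
  show ?case by (rule exI[of _ "[:c:]"]) simp
next
  case (coord v b)
  show ?case
    by (rule exI[of _ "[:y v \<bullet> b, (z v - y v) \<bullet> b:]"]) (simp add: inner_add_left)
next
  case (add f g)
  then show ?case by (metis poly_add)
next
  case (mult f g)
  then show ?case by (metis poly_mult)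
qed

text \<open>Zariski-open conditions: non-empty ones are dense, since a polynomial which does not vanish
  identically on a line has finitely many zeros there.\<close>

definition zariski_open :: "(('v \<Rightarrow> 'a::euclidean_space) \<Rightarrow> bool) \<Rightarrow> bool" where
  "zariski_open Q \<longleftrightarrow> (\<forall>x. Q x \<longrightarrow> (\<exists>D. polynomial_fun D \<and> D x \<noteq> 0 \<and> (\<forall>y. D y \<noteq> 0 \<longrightarrow> Q y)))"

lemma zariski_openD:
  assumes "zariski_open Q" "Q x"
  obtains D where "polynomial_fun D" "D x \<noteq> 0" "\<And>y. D y \<noteq> 0 \<Longrightarrow> Q y"
proof -
  from assms have "\<exists>D. polynomial_fun D \<and> D x \<noteq> 0 \<and> (\<forall>y. D y \<noteq> 0 \<longrightarrow> Q y)"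
    unfolding zariski_open_def by simp
  with that show ?thesis by blast
qed

lemma zariski_open_imp_open:
  assumes "zariski_open Q" shows "open {x. Q x}"
  unfolding open_subopen[of "{x. Q x}"]
proof
  fix x assume "x \<in> {x. Q x}"
  then have "Q x" by simp
  then obtain D where D: "polynomial_fun D" "D x \<noteq> 0" "\<And>y. D y \<noteq> 0 \<Longrightarrow> Q y"
    using zariski_openD[OF assms] by blast
  have "open (D -` (- {0}))"
    using polynomial_fun_continuous[OF D(1)] by (intro open_vimage) auto
  then show "\<exists>T. open T \<and> x \<in> T \<and> T \<subseteq> {x. Q x}"
    using D by (intro exI[of _ "D -` (- {0})"]) auto
qed

lemma zariski_open_dense:
  fixes Q :: "('v \<Rightarrow> 'a::euclidean_space) \<Rightarrow> bool"
  assumes "zariski_open Q" "Q z" "open W" "y \<in> W"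
  shows "\<exists>x\<in>W. Q x"
proof -
  obtain D where D: "polynomial_fun D" "D z \<noteq> 0" "\<And>y. D y \<noteq> 0 \<Longrightarrow> Q y"
    using zariski_openD[OF assms(1,2)] by blast
  define \<gamma> where "\<gamma> t = (\<lambda>v. y v + t *\<^sub>R (z v - y v))" for t :: real
  obtain p where p: "\<forall>t. D (\<gamma> t) = poly p t"
    using polynomial_fun_line[OF D(1)] unfolding \<gamma>_def by blast
  have "\<gamma> 1 = z" by (simp add: \<gamma>_def)
  then have "p \<noteq> 0" using p D(2) by (metis poly_0)
  then have fin: "finite {t. poly p t = 0}" by (rule poly_roots_finite)
  have "continuous_on UNIV \<gamma>"
    unfolding \<gamma>_def by (intro continuous_on_coordinatewise_then_product continuous_intros)
  then have "open (\<gamma> -` W)" using assms(3) by (intro open_vimage) auto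
  moreover have "0 \<in> \<gamma> -` W" using assms(4) by (simp add: \<gamma>_def)
  ultimately have "infinite (\<gamma> -` W)" using finite_imp_not_open by blast
  then obtain t where "t \<in> \<gamma> -` W" "poly p t \<noteq> 0"
    using fin finite_subset[of "\<gamma> -` W" "{t. poly p t = 0}"] by blast
  then show ?thesis using p D(3) by (metis vimageE)
qed

lemma zariski_open_conj:
  assumes "zariski_open Q" "zariski_open R" shows "zariski_open (\<lambda>x. Q x \<and> R x)"
  unfolding zariski_open_def
proof (intro allI impI)
  fix x assume QR: "Q x \<and> R x"
  obtain D where D: "polynomial_fun D" "D x \<noteq> 0" "\<And>y. D y \<noteq> 0 \<Longrightarrow> Q y"
    using zariski_openD[OF assms(1)] QR by blast
  obtain D' where D': "polynomial_fun D'" "D' x \<noteq> 0" "\<And>y. D' y \<noteq> 0 \<Longrightarrow> R y"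
    using zariski_openD[OF assms(2)] QR by blast
  show "\<exists>D. polynomial_fun D \<and> D x \<noteq> 0 \<and> (\<forall>y. D y \<noteq> 0 \<longrightarrow> Q y \<and> R y)"
    using D D' by (intro exI[of _ "\<lambda>x. D x * D' x"] conjI polynomial_fun.mult) auto
qed

text \<open>Irreducibility of the configuration space: one set is open in the product topology and
  the other is dense.\<close>

lemma zariski_open_conj_ex:
  assumes "zariski_open Q" "zariski_open R" "\<exists>x. Q x" "\<exists>x. R x"
  shows "\<exists>x. Q x \<and> R x"
proof -
  obtain x y where "Q x" "R y" using assms by blast
  then show ?thesis
    using zariski_open_dense[OF assms(2) \<open>R y\<close> zariski_open_imp_open[OF assms(1)], of x] by auto
qed

lemma zariski_open_const: "zariski_open (\<lambda>_. True)"
  unfolding zariski_open_def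
  by (intro allI impI exI[of _ "\<lambda>_. 1"] conjI polynomial_fun.const) simp_all

text \<open>Openness and non-emptiness are proved together, because the non-emptiness of an
  intersection rests on the openness of both parts.\<close>

lemma zariski_open_ball:
  fixes Q :: "'i \<Rightarrow> ('v \<Rightarrow> 'a::euclidean_space) \<Rightarrow> bool"
  assumes "finite I" "\<And>i. i \<in> I \<Longrightarrow> zariski_open (Q i)" "\<And>i. i \<in> I \<Longrightarrow> \<exists>x. Q i x"
  shows "zariski_open (\<lambda>x. \<forall>i\<in>I. Q i x) \<and> (\<exists>x. \<forall>i\<in>I. Q i x)"
  using assms
proof (induction I rule: finite_induct)
  case empty
  then show ?case using zariski_open_const by simp
next
  case (insert i I)
  then have "zariski_open (\<lambda>x. \<forall>i\<in>I. Q i x)" "\<exists>x. \<forall>i\<in>I. Q i x" "zariski_open (Q i)" "\<exists>x. Q i x"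
    by auto
  then show ?case
    using zariski_open_conj[of "Q i" "\<lambda>x. \<forall>i\<in>I. Q i x"]
      zariski_open_conj_ex[of "Q i" "\<lambda>x. \<forall>i\<in>I. Q i x"] by simp
qed

text \<open>Fraction-free Gaussian elimination on the column \<open>j\<close>.\<close>

lemma zariski_open_injective:
  assumes "finite J" "\<And>i j. polynomial_fun (M i j)"
  shows "zariski_open (\<lambda>x. \<forall>c. (\<forall>i. (\<Sum>j\<in>J. M i j x * c j) = 0) \<longrightarrow> (\<forall>j\<in>J. c j = 0))"
  using assms
proof (induction J arbitrary: M rule: finite_induct)
  case empty
  then show ?case using zariski_open_const by simp
next
  case (insert j J)
  \<comment> \<open>Row \<open>i'\<close> cleared in the column \<open>k\<close> by means of the
    pivot row \<open>i\<close>; cross-multiplication instead of division keeps the entries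
    polynomial.\<close>
  define N where "N i k = (\<lambda>i' l x. M i k x * M i' l x - M i' k x * M i l x)" for i k
  have N: "polynomial_fun (N i k i' l)" for i k i' l
    unfolding N_def using insert.prems by (intro polynomial_fun_diff polynomial_fun.mult)
  define ker where "ker M J x \<longleftrightarrow> (\<forall>c. (\<forall>i. (\<Sum>j\<in>J. M i j x * c j) = 0) \<longrightarrow> (\<forall>j\<in>J. c j = (0::real)))"
    for M :: "'b \<Rightarrow> 'a \<Rightarrow> ('c \<Rightarrow> 'd) \<Rightarrow> real" and J x
  have IH: "zariski_open (ker (N i k) J)" for i k
    unfolding ker_def using insert.IH[OF N] .
  have eq: "(\<Sum>l\<in>J. N i j i' l x * c l) =
      M i j x * (\<Sum>l\<in>J. M i' l x * c l) - M i' j x * (\<Sum>l\<in>J. M i l x * c l)" for i i' x c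
    by (simp add: N_def algebra_simps sum_distrib_left sum_subtractf)
  have split: "(\<Sum>l\<in>insert j J. M i l x * c l) = M i j x * c j + (\<Sum>l\<in>J. M i l x * c l)" for i x c
    using insert.hyps by simp
  have up: "ker M (insert j J) x" if "M i j x \<noteq> 0" "ker (N i j) J x" for i x
    unfolding ker_def
  proof (intro allI impI)
    fix c assume a: "\<forall>i. (\<Sum>l\<in>insert j J. M i l x * c l) = 0"
    have s: "(\<Sum>l\<in>J. M i' l x * c l) = - (M i' j x * c j)" for i'
      using a[rule_format, of i'] unfolding split by linarith
    have "(\<Sum>l\<in>J. N i j i' l x * c l) = 0" for i'
      unfolding eq s by (simp add: algebra_simps)
    then have c0: "\<forall>l\<in>J. c l = 0" using that(2) unfolding ker_def by blast
    then have "M i j x * c j = 0" using s[of i] by simp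
    then show "\<forall>l\<in>insert j J. c l = 0" using that(1) c0 by simp
  qed
  \<comment> \<open>Injectivity makes the column \<open>j\<close> non-zero, so a pivot exists, and a
    kernel vector of the reduced matrix lifts to the original one by back substitution.\<close>
  have down: "\<exists>i. M i j x \<noteq> 0 \<and> ker (N i j) J x" if k: "ker M (insert j J) x" for x
  proof -
    have "\<exists>i. M i j x \<noteq> 0"
    proof (rule ccontr)
      assume "\<not> (\<exists>i. M i j x \<noteq> 0)"
      then have "\<forall>i. (\<Sum>l\<in>insert j J. M i l x * (if l = j then 1 else 0)) = 0"
        using insert.hyps by (auto intro!: sum.neutral)
      then show False
        using k[unfolded ker_def, THEN spec[of _ "\<lambda>l. if l = j then 1 else 0"]] by simp
    qed
    then obtain i where i: "M i j x \<noteq> 0" ..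
    have "ker (N i j) J x"
      unfolding ker_def
    proof (intro allI impI)
      fix c assume a: "\<forall>i'. (\<Sum>l\<in>J. N i j i' l x * c l) = 0"
      define c' where "c' = c(j := - (\<Sum>l\<in>J. M i l x * c l) / M i j x)"
      have cc: "(\<Sum>l\<in>J. M i' l x * c' l) = (\<Sum>l\<in>J. M i' l x * c l)" for i'
        using insert.hyps by (intro sum.cong) (auto simp: c'_def)
      have "M i j x * (\<Sum>l\<in>insert j J. M i' l x * c' l) = 0" for i'
        using a[rule_format, of i'] i unfolding split cc eq by (simp add: c'_def field_simps)
      then have "\<forall>i'. (\<Sum>l\<in>insert j J. M i' l x * c' l) = 0" using i by simp
      then have "\<forall>l\<in>insert j J. c' l = 0" using k[unfolded ker_def, THEN spec[of _ c']] by blast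
      then show "\<forall>l\<in>J. c l = 0" using insert.hyps(2) unfolding c'_def by (metis fun_upd_other insertCI)
    qed
    then show ?thesis using i by blast
  qed
  have "zariski_open (ker M (insert j J))"
    unfolding zariski_open_def
  proof (intro allI impI)
    fix x assume "ker M (insert j J) x"
    then obtain i where i: "M i j x \<noteq> 0" "ker (N i j) J x" using down by blast
    obtain D where D: "polynomial_fun D" "D x \<noteq> 0" "\<And>y. D y \<noteq> 0 \<Longrightarrow> ker (N i j) J y"
      using zariski_openD[where Q = "ker (N i j) J", OF IH i(2)] by blast
    show "\<exists>D. polynomial_fun D \<and> D x \<noteq> 0 \<and> (\<forall>y. D y \<noteq> 0 \<longrightarrow> ker M (insert j J) y)"
      using D i insert.prems by (intro exI[of _ "\<lambda>x. M i j x * D x"] conjI polynomial_fun.mult allI impI up) auto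
  qed
  then show ?case unfolding ker_def .
qed

text \<open>The coordinates of \<open>l\<close> are finitely many unknowns, indexed by an incidence
  and a basis vector, and the three kinds of stress equations are the rows of a matrix whose entries
  are constants or coordinates of \<open>x\<close>. To be stress-free means that this matrix is
  injective.\<close>

lemma zariski_open_stress_free:
  assumes V: "finite V" and E: "\<And>e. e \<in> E \<Longrightarrow> e \<subseteq> V"
  shows "zariski_open (stress_free V E :: ('v \<Rightarrow> 'a::euclidean_space) \<Rightarrow> bool)"
proof -
  have finE: "finite E" using finite_subset[of E "Pow V"] E V by blast
  have fin_e: "finite e" if "e \<in> E" for e using E[OF that] V finite_subset by blast
  define J where "J = (SIGMA e:E. e \<times> (Basis :: 'a set))"
  have finJ: "finite J" using finE fin_e by (simp add: J_def)
  define M :: "('v \<times> 'a) + ('v set \<times> 'a) + ('v \<times> 'v set) \<Rightarrow> 'v set \<times> 'v \<times> 'a \<Rightarrow> ('v \<Rightarrow> 'a) \<Rightarrow> real"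
    where "M i j x = (case j of (e, v, b) \<Rightarrow> case i of
        Inl (v0, b0) \<Rightarrow> if v0 \<in> V \<and> v = v0 then b \<bullet> b0 else 0
      | Inr (Inl (e0, b0)) \<Rightarrow> if e = e0 then b \<bullet> b0 else 0
      | Inr (Inr (v0, e0)) \<Rightarrow> if v = v0 \<and> e = e0 then x v0 \<bullet> b else 0)" for i j x
  have poly: "polynomial_fun (M i j)" for i j
  proof -
    obtain e v b where j: "j = (e, v, b)" by (cases j)
    consider v0 b0 where "i = Inl (v0, b0)" | e0 b0 where "i = Inr (Inl (e0, b0))"
      | v0 e0 where "i = Inr (Inr (v0, e0))"
      by (metis obj_sumE prod.exhaust)
    then show ?thesis
    proof cases
      case 1
      show ?thesis unfolding M_def j 1 prod.case sum.case by (rule polynomial_fun.const)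
    next
      case 2
      show ?thesis unfolding M_def j 2 prod.case sum.case by (rule polynomial_fun.const)
    next
      case 3
      show ?thesis
      proof (cases "v = v0 \<and> e = e0")
        case True
        show ?thesis unfolding M_def j 3 prod.case sum.case if_P[OF True] by (rule polynomial_fun.coord)
      next
        case False
        show ?thesis unfolding M_def j 3 prod.case sum.case if_not_P[OF False] by (rule polynomial_fun.const)
      qed
    qed
  qed
  define vec where "vec c v e = (\<Sum>b\<in>Basis. c (e, v, b) *\<^sub>R b)"
    for c :: "'v set \<times> 'v \<times> 'a \<Rightarrow> real" and v e
  have sumJ: "(\<Sum>j\<in>J. g j) = (\<Sum>e\<in>E. \<Sum>v\<in>e. \<Sum>b\<in>Basis. g (e, v, b))" for g :: "_ \<Rightarrow> real"
    unfolding J_def using finE fin_e by (simp add: sum.Sigma sum.cartesian_product case_prod_unfold)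
  have rowV: "(\<Sum>j\<in>J. M (Inl (v0, b0)) j x * c j) =
      (if v0 \<in> V then (\<Sum>e\<in>{e\<in>E. v0 \<in> e}. vec c v0 e) \<bullet> b0 else 0)" for v0 b0 x c
  proof (cases "v0 \<in> V")
    case True
    have "(\<Sum>j\<in>J. M (Inl (v0, b0)) j x * c j) =
        (\<Sum>e\<in>E. \<Sum>v\<in>e. if v = v0 then vec c v0 e \<bullet> b0 else 0)"
      unfolding sumJ using True
      by (intro sum.cong refl) (auto simp: M_def vec_def inner_sum_left mult.commute)
    also have "\<dots> = (\<Sum>e\<in>E. if v0 \<in> e then vec c v0 e \<bullet> b0 else 0)"
      by (intro sum.cong refl) (simp add: fin_e)
    also have "\<dots> = (\<Sum>e\<in>{e\<in>E. v0 \<in> e}. vec c v0 e \<bullet> b0)"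
      by (rule sum.inter_filter[OF finE, symmetric])
    finally show ?thesis using True by (simp add: inner_sum_left)
  next
    case False
    then show ?thesis unfolding sumJ by (simp add: M_def)
  qed
  have rowE: "(\<Sum>j\<in>J. M (Inr (Inl (e0, b0))) j x * c j) =
      (if e0 \<in> E then (\<Sum>v\<in>e0. vec c v e0) \<bullet> b0 else 0)" for e0 b0 x c
  proof -
    have "(\<Sum>j\<in>J. M (Inr (Inl (e0, b0))) j x * c j) =
        (\<Sum>e\<in>E. if e = e0 then (\<Sum>v\<in>e0. vec c v e0 \<bullet> b0) else 0)"
      unfolding sumJ
      by (intro sum.cong refl) (auto simp: M_def vec_def inner_sum_left mult.commute)
    then show ?thesis using finE by (simp add: inner_sum_left)
  qed
  have rowP: "(\<Sum>j\<in>J. M (Inr (Inr (v0, e0))) j x * c j) =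
      (if e0 \<in> E \<and> v0 \<in> e0 then x v0 \<bullet> vec c v0 e0 else 0)" for v0 e0 x c
  proof -
    have "(\<Sum>j\<in>J. M (Inr (Inr (v0, e0))) j x * c j) =
        (\<Sum>e\<in>E. if e = e0 then (\<Sum>v\<in>e. if v = v0 then x v0 \<bullet> vec c v0 e0 else 0) else 0)"
      unfolding sumJ
    proof (intro sum.cong refl)
      fix e
      have "(\<Sum>b\<in>Basis. M (Inr (Inr (v0, e0))) (e, v, b) x * c (e, v, b)) =
          (if v = v0 \<and> e = e0 then x v0 \<bullet> vec c v0 e0 else 0)" for v
      proof (cases "v = v0 \<and> e = e0")
        case True
        then show ?thesis by (simp add: M_def vec_def inner_sum_right mult.commute)
      next
        case False
        then have "M (Inr (Inr (v0, e0))) (e, v, b) x = 0" for b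
          unfolding M_def prod.case sum.case by (rule if_not_P)
        then show ?thesis unfolding if_not_P[OF False] by simp
      qed
      then show "(\<Sum>v\<in>e. \<Sum>b\<in>Basis. M (Inr (Inr (v0, e0))) (e, v, b) x * c (e, v, b)) =
          (if e = e0 then (\<Sum>v\<in>e. if v = v0 then x v0 \<bullet> vec c v0 e0 else 0) else 0)"
        by simp
    qed
    then show ?thesis using finE fin_e by simp
  qed
  have "stress_free V E x \<longleftrightarrow>
      (\<forall>c. (\<forall>i. (\<Sum>j\<in>J. M i j x * c j) = 0) \<longrightarrow> (\<forall>j\<in>J. c j = 0))" for x
  proof
    assume sf: "stress_free V E x"
    show "\<forall>c. (\<forall>i. (\<Sum>j\<in>J. M i j x * c j) = 0) \<longrightarrow> (\<forall>j\<in>J. c j = 0)"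
    proof (intro allI impI)
      fix c assume a: "\<forall>i. (\<Sum>j\<in>J. M i j x * c j) = 0"
      have 1: "(\<Sum>e\<in>{e\<in>E. v \<in> e}. vec c v e) = 0" if "v \<in> V" for v
        using a rowV[of v _ x c] that by (metis inner_eq_zero_iff)
      have 2: "(\<Sum>v\<in>e. vec c v e) = 0" if "e \<in> E" for e
        using a rowE[of e _ x c] that by (metis inner_eq_zero_iff)
      have 3: "vec c v e \<bullet> x v = 0" if "e \<in> E" "v \<in> e" for e v
        using a rowP[of v e x c] that by (metis inner_commute)
      have 4: "\<forall>e\<in>E. \<forall>v\<in>e. vec c v e = 0"
        using sf[unfolded stress_free_def, THEN spec[of _ "vec c"]] 1 2 3 by blast
      show "\<forall>j\<in>J. c j = 0"
      proof
        fix j assume "j \<in> J"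
        then obtain e v b where j: "j = (e, v, b)" "e \<in> E" "v \<in> e" "b \<in> Basis" by (auto simp: J_def)
        then have "vec c v e \<bullet> b = 0" using 4 by simp
        then show "c j = 0" using j by (simp add: vec_def)
      qed
    qed
  next
    assume a: "\<forall>c. (\<forall>i. (\<Sum>j\<in>J. M i j x * c j) = 0) \<longrightarrow> (\<forall>j\<in>J. c j = 0)"
    show "stress_free V E x"
      unfolding stress_free_def
    proof (intro allI impI ballI)
      fix l :: "'v \<Rightarrow> 'v set \<Rightarrow> 'a" and e v
      assume l: "\<forall>v\<in>V. (\<Sum>e\<in>{e\<in>E. v \<in> e}. l v e) = 0" "\<forall>e\<in>E. (\<Sum>v\<in>e. l v e) = 0"
        "\<forall>e\<in>E. \<forall>v\<in>e. l v e \<bullet> x v = 0" and ev: "e \<in> E" "v \<in> e"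
      have l3: "x v \<bullet> l v e = 0" if "e \<in> E" "v \<in> e" for e v
        using l(3) that by (simp add: inner_commute)
      define c where "c = (\<lambda>(e, v, b). l v e \<bullet> b)"
      have vc: "vec c v e = l v e" for v e
        by (simp add: vec_def c_def euclidean_representation)
      have "(\<Sum>j\<in>J. M i j x * c j) = 0" for i
      proof -
        consider v b where "i = Inl (v, b)" | e b where "i = Inr (Inl (e, b))" | v e where "i = Inr (Inr (v, e))"
          by (metis obj_sumE prod.exhaust)
        then show ?thesis
          by cases (use l(1,2) l3 in \<open>simp_all add: rowV rowE rowP vc\<close>)
      qed
      then have "\<forall>j\<in>J. c j = 0" using a by blast
      then have "\<forall>b\<in>Basis. l v e \<bullet> b = 0" using ev by (auto simp: J_def c_def)
      then show "l v e = 0" by (simp add: euclidean_all_zero_iff)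
    qed
  qed
  then have "stress_free V E = (\<lambda>x. \<forall>c. (\<forall>i. (\<Sum>j\<in>J. M i j x * c j) = 0) \<longrightarrow> (\<forall>j\<in>J. c j = 0))"
    by (rule ext)
  then show ?thesis using zariski_open_injective[OF finJ poly] by simp
qed

text \<open>\<open>D\<close> is the Gram determinant of the two vectors: for non-zero
  \<open>x v\<close> it is the squared length of \<open>x v\<close> times that of the component
  \<open>y\<close> of \<open>x u\<close> orthogonal to \<open>x v\<close>.\<close>

lemma zariski_open_nonparallel:
  "zariski_open (\<lambda>x :: 'v \<Rightarrow> 'a::euclidean_space. x u \<notin> span {x v} \<and> x v \<noteq> 0)"
proof -
  define D where "D = (\<lambda>x :: 'v \<Rightarrow> 'a. (x u \<bullet> x u) * (x v \<bullet> x v) - (x u \<bullet> x v) * (x u \<bullet> x v))"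
  have D: "polynomial_fun D"
    unfolding D_def by (intro polynomial_fun_diff polynomial_fun.mult polynomial_fun_inner)
  have "D x \<noteq> 0 \<longleftrightarrow> x u \<notin> span {x v} \<and> x v \<noteq> 0" for x
  proof
    assume 0: "D x \<noteq> 0"
    have "x v \<noteq> 0" using 0 by (auto simp: D_def)
    moreover have "x u \<notin> span {x v}" using 0 by (auto simp: D_def span_singleton)
    ultimately show "x u \<notin> span {x v} \<and> x v \<noteq> 0" by blast
  next
    assume a: "x u \<notin> span {x v} \<and> x v \<noteq> 0"
    define k where "k = (x u \<bullet> x v) / (x v \<bullet> x v)"
    define y where "y = x u - k *\<^sub>R x v"
    have "k *\<^sub>R x v \<in> span {x v}" by (intro span_scale span_base) simp
    then have "y \<noteq> 0" using a unfolding y_def by (metis right_minus_eq)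
    then have "(y \<bullet> y) * (x v \<bullet> x v) \<noteq> 0" using a by simp
    moreover have "(y \<bullet> y) * (x v \<bullet> x v) = D x"
    proof -
      have k: "k * (x v \<bullet> x v) = x u \<bullet> x v" using a by (simp add: k_def)
      have "y \<bullet> x v = 0" by (simp add: y_def inner_diff_left k)
      then have "y \<bullet> (k *\<^sub>R x v) = 0" by simp
      then have "y \<bullet> y = y \<bullet> x u" unfolding y_def inner_diff_right by simp
      also have "\<dots> = x u \<bullet> x u - k * (x u \<bullet> x v)"
        by (simp add: y_def inner_diff_left inner_diff_right inner_commute)
      finally have "(y \<bullet> y) * (x v \<bullet> x v) =
          (x u \<bullet> x u) * (x v \<bullet> x v) - (x u \<bullet> x v) * (k * (x v \<bullet> x v))"
        by (simp add: left_diff_distrib mult.assoc mult.left_commute)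
      then show ?thesis unfolding k D_def .
    qed
    ultimately show "D x \<noteq> 0" by simp
  qed
  then show ?thesis unfolding zariski_open_def using D by blast
qed

section \<open>Smooth maps\<close>

lemma Ck_on_subset: "Ck_on k S f \<Longrightarrow> T \<subseteq> S \<Longrightarrow> Ck_on k T f"
  by (induction k arbitrary: f) (auto intro: continuous_on_subset)

lemma Ck_on_SucD: "Ck_on (Suc k) S f \<Longrightarrow> Ck_on k S f"
proof (induction k arbitrary: f)
  case 0
  then show ?case
    by (auto intro!: continuous_at_imp_continuous_on differentiable_imp_continuous_within)
next
  case (Suc k)
  then show ?case by (metis Ck_on.simps(2))
qed

lemma Ck_on_cong:
  assumes "open S" "\<And>x. x \<in> S \<Longrightarrow> f x = g x" "Ck_on k S f"
  shows "Ck_on k S g"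
  using assms(2,3)
proof (induction k arbitrary: f g)
  case 0
  then show ?case by (simp cong: continuous_on_cong)
next
  case (Suc k)
  have der: "(g has_derivative frechet_derivative f (at x)) (at x)" if "x \<in> S" for x
  proof -
    have "(f has_derivative frechet_derivative f (at x)) (at x)"
      using Suc.prems(2) that frechet_derivative_works by auto
    then show ?thesis
      using has_derivative_transform_within_open[of f _ x UNIV S g] assms(1) that Suc.prems(1) by blast
  qed
  have "Ck_on k S (\<lambda>x. frechet_derivative g (at x) v)" for v
  proof (rule Suc.IH)
    show "Ck_on k S (\<lambda>x. frechet_derivative f (at x) v)" using Suc.prems(2) by simp
    show "frechet_derivative f (at x) v = frechet_derivative g (at x) v" if "x \<in> S" for x
      using frechet_derivative_at[OF der[OF that]] by simp
  qed
  then show ?case using der unfolding Ck_on.simps differentiable_def by blast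
qed

lemma Ck_on_local:
  assumes "\<And>x. x \<in> S \<Longrightarrow> \<exists>N. open N \<and> x \<in> N \<and> Ck_on k N f"
  shows "Ck_on k S f"
  using assms
proof (induction k arbitrary: f)
  case 0
  show ?case
    unfolding Ck_on.simps
  proof (rule continuous_at_imp_continuous_on, rule ballI)
    fix x assume "x \<in> S"
    then obtain N where "open N" "x \<in> N" "continuous_on N f" using 0 by (metis Ck_on.simps(1))
    then show "isCont f x" using continuous_on_eq_continuous_at by blast
  qed
next
  case (Suc k)
  have "f differentiable (at x)" if x: "x \<in> S" for x
    using Suc.prems[OF x] by (metis Ck_on.simps(2))
  moreover have "Ck_on k S (\<lambda>x. frechet_derivative f (at x) v)" for v
    by (rule Suc.IH) (metis Suc.prems Ck_on.simps(2))
  ultimately show ?case by simp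
qed

lemma Ck_on_const: "Ck_on k S (\<lambda>_. c)"
  by (induction k arbitrary: c) (auto simp: frechet_derivative_const)

lemma Ck_on_bounded_linear:
  assumes "bounded_linear f" shows "Ck_on k S f"
proof (cases k)
  case 0
  then show ?thesis using assms by (simp add: linear_continuous_on)
next
  case (Suc j)
  have "(f has_derivative f) (at x)" for x
    using assms bounded_linear_imp_has_derivative by blast
  note der = this
  have "f differentiable (at x)" for x unfolding differentiable_def using der by blast
  moreover have "frechet_derivative f (at x) = f" for x by (rule frechet_derivative_at[OF der, symmetric])
  ultimately show ?thesis by (simp add: Suc Ck_on_const)
qed

lemma Ck_on_SucI:
  assumes "open S" "\<And>x. x \<in> S \<Longrightarrow> (f has_derivative D x) (at x)"
    "\<And>v. Ck_on k S (\<lambda>x. D x v)"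
  shows "Ck_on (Suc k) S f"
proof -
  have "D x v = frechet_derivative f (at x) v" if "x \<in> S" for x v
    using frechet_derivative_at[OF assms(2)[OF that]] by simp
  then have "Ck_on k S (\<lambda>x. frechet_derivative f (at x) v)" for v
    by (rule Ck_on_cong[OF assms(1) _ assms(3)])
  then show ?thesis using assms(2) unfolding Ck_on.simps differentiable_def by blast
qed

lemma Ck_on_has_derivative:
  assumes "Ck_on (Suc k) S f" "x \<in> S"
  shows "(f has_derivative frechet_derivative f (at x)) (at x)"
  using assms frechet_derivative_works by auto

lemma Ck_on_bounded_linear_compose:
  assumes "bounded_linear L" "open S" "Ck_on k S f"
  shows "Ck_on k S (\<lambda>x. L (f x))"
  using assms(3)
proof (induction k arbitrary: f)
  case 0
  then show ?case using assms(1) by (simp add: bounded_linear.continuous_on)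
next
  case (Suc k)
  show ?case
    by (rule Ck_on_SucI[OF assms(2) bounded_linear.has_derivative[OF assms(1) Ck_on_has_derivative[OF Suc.prems]]])
      (use Suc in auto)
qed

lemma Ck_on_add:
  assumes "open S" "Ck_on k S f" "Ck_on k S g"
  shows "Ck_on k S (\<lambda>x. f x + g x)"
  using assms(2,3)
proof (induction k arbitrary: f g)
  case 0
  then show ?case by (simp add: continuous_on_add)
next
  case (Suc k)
  show ?case
    by (rule Ck_on_SucI[OF assms(1) has_derivative_add[OF Ck_on_has_derivative[OF Suc.prems(1)]
            Ck_on_has_derivative[OF Suc.prems(2)]]])
      (use Suc in auto)
qed

lemma Ck_on_sum:
  assumes "open S" "\<And>i. i \<in> I \<Longrightarrow> Ck_on k S (f i)"
  shows "Ck_on k S (\<lambda>x. \<Sum>i\<in>I. f i x)"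
  using assms(2)
  by (induction I rule: infinite_finite_induct) (auto intro: Ck_on_const Ck_on_add[OF assms(1)])

lemma Ck_on_scaleR:
  assumes "open S" "Ck_on k S f" "Ck_on k S g"
  shows "Ck_on k S (\<lambda>x. f x *\<^sub>R g x)"
  using assms(2,3)
proof (induction k arbitrary: f g)
  case 0
  then show ?case by (simp add: continuous_on_scaleR)
next
  case (Suc k)
  have 1: "Ck_on k S f" "Ck_on k S g" using Suc.prems Ck_on_SucD by blast+
  have 2: "Ck_on k S (\<lambda>x. frechet_derivative f (at x) v)" "Ck_on k S (\<lambda>x. frechet_derivative g (at x) v)" for v
    using Suc.prems by auto
  show ?case
    by (rule Ck_on_SucI[OF assms(1) has_derivative_scaleR[OF Ck_on_has_derivative[OF Suc.prems(1)]
            Ck_on_has_derivative[OF Suc.prems(2)]]])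
      (auto intro!: Ck_on_add[OF assms(1)] Suc.IH 1 2)
qed

lemma Ck_on_Pair:
  assumes "open S" "Ck_on k S f" "Ck_on k S g"
  shows "Ck_on k S (\<lambda>x. (f x, g x))"
proof -
  have "Ck_on k S (\<lambda>x. (f x, 0))" "Ck_on k S (\<lambda>x. (0, g x))"
    using assms by (auto intro!: Ck_on_bounded_linear_compose[of "\<lambda>y. (y, 0)"]
        Ck_on_bounded_linear_compose[of "\<lambda>y. (0, y)"] bounded_linear_Pair bounded_linear_ident bounded_linear_zero)
  then show ?thesis using Ck_on_add[OF assms(1)] by fastforce
qed

lemma Ck_on_compose:
  assumes "open S" "Ck_on k S g" "Ck_on k T f" "\<And>x. x \<in> S \<Longrightarrow> g x \<in> T"
  shows "Ck_on k S (\<lambda>x. f (g x))"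
  using assms(2,3)
proof (induction k arbitrary: f)
  case 0
  then show ?case using assms(4) by (auto intro: continuous_on_compose2)
next
  case (Suc k)
  \<comment> \<open>The chain rule expanded along the basis: the derivative becomes a finite sum of
    scalar functions times directional derivatives of \<open>f\<close> in fixed directions, composed
    with \<open>g\<close>. To these the induction hypothesis applies.\<close>
  define D where "D x v = (\<Sum>b\<in>Basis. (frechet_derivative g (at x) v \<bullet> b) *\<^sub>R frechet_derivative f (at (g x)) b)"
    for x v
  have der: "((\<lambda>x. f (g x)) has_derivative D x) (at x)" if "x \<in> S" for x
  proof -
    have g: "(g has_derivative frechet_derivative g (at x)) (at x)"
      using Suc.prems(1) that Ck_on_has_derivative by blast
    have f: "(f has_derivative frechet_derivative f (at (g x))) (at (g x))"
      using Suc.prems(2) assms(4)[OF that] Ck_on_has_derivative by blast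
    have lin: "linear (frechet_derivative f (at (g x)))"
      using f has_derivative_linear by blast
    have expand: "frechet_derivative f (at (g x)) w = (\<Sum>b\<in>Basis. (w \<bullet> b) *\<^sub>R frechet_derivative f (at (g x)) b)" for w
    proof -
      have "frechet_derivative f (at (g x)) w = frechet_derivative f (at (g x)) (\<Sum>b\<in>Basis. (w \<bullet> b) *\<^sub>R b)"
        by (simp add: euclidean_representation)
      then show ?thesis by (simp add: linear_sum[OF lin] linear_cmul[OF lin])
    qed
    have "D x = frechet_derivative f (at (g x)) \<circ> frechet_derivative g (at x)"
      unfolding D_def o_def by (intro ext expand[symmetric])
    then show ?thesis using diff_chain_at[OF g f] by (simp add: o_def)
  qed
  have CkD: "Ck_on k S (\<lambda>x. D x v)" for v
    unfolding D_def
  proof (intro Ck_on_sum Ck_on_scaleR assms(1))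
    fix b :: 'b
    have "Ck_on k S (\<lambda>x. frechet_derivative g (at x) v)" using Suc.prems(1) by simp
    then show "Ck_on k S (\<lambda>x. frechet_derivative g (at x) v \<bullet> b)"
      by (intro Ck_on_bounded_linear_compose[of "\<lambda>y. y \<bullet> b"] assms(1) bounded_linear_inner_left)
    show "Ck_on k S (\<lambda>x. frechet_derivative f (at (g x)) b)"
      using Suc.IH[of "\<lambda>y. frechet_derivative f (at y) b"] Suc.prems Ck_on_SucD by auto
  qed
  show ?case by (rule Ck_on_SucI[OF assms(1)], erule der, rule CkD)
qed

lemma smooth_on_subset: "smooth_on S f \<Longrightarrow> T \<subseteq> S \<Longrightarrow> smooth_on T f"
  unfolding smooth_on_def using Ck_on_subset by blast

lemma smooth_on_cong:
  "open S \<Longrightarrow> (\<And>x. x \<in> S \<Longrightarrow> f x = g x) \<Longrightarrow> smooth_on S f \<Longrightarrow> smooth_on S g"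
  unfolding smooth_on_def using Ck_on_cong by blast

lemma smooth_on_local:
  assumes "\<And>x. x \<in> S \<Longrightarrow> \<exists>N. open N \<and> x \<in> N \<and> smooth_on N f"
  shows "smooth_on S f"
  unfolding smooth_on_def
proof
  fix k show "Ck_on k S f"
    by (rule Ck_on_local) (metis assms smooth_on_def)
qed

lemma smooth_on_compose:
  "open S \<Longrightarrow> smooth_on S g \<Longrightarrow> smooth_on T f \<Longrightarrow> (\<And>x. x \<in> S \<Longrightarrow> g x \<in> T) \<Longrightarrow> smooth_on S (\<lambda>x. f (g x))"
  unfolding smooth_on_def using Ck_on_compose by blast

lemma smooth_on_Pair:
  "open S \<Longrightarrow> smooth_on S f \<Longrightarrow> smooth_on S g \<Longrightarrow> smooth_on S (\<lambda>x. (f x, g x))"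
  unfolding smooth_on_def using Ck_on_Pair by blast

lemma smooth_on_bounded_linear: "bounded_linear f \<Longrightarrow> smooth_on S f"
  unfolding smooth_on_def using Ck_on_bounded_linear by blast

lemma smooth_on_const: "smooth_on S (\<lambda>_. c)"
  unfolding smooth_on_def using Ck_on_const by blast

lemma smooth_on_add:
  "open S \<Longrightarrow> smooth_on S f \<Longrightarrow> smooth_on S g \<Longrightarrow> smooth_on S (\<lambda>x. f x + g x)"
  unfolding smooth_on_def using Ck_on_add by blast

lemma smooth_on_imp_continuous_on: "smooth_on S f \<Longrightarrow> continuous_on S f"
  unfolding smooth_on_def using Ck_on.simps(1) by blast

lemma smooth_on_has_derivative:
  "smooth_on S f \<Longrightarrow> x \<in> S \<Longrightarrow> (f has_derivative frechet_derivative f (at x)) (at x)"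
  unfolding smooth_on_def using Ck_on_has_derivative by blast

lemma smooth_on_frechet_derivative: "smooth_on S f \<Longrightarrow> smooth_on S (\<lambda>x. frechet_derivative f (at x) v)"
  unfolding smooth_on_def by (metis Ck_on.simps(2))

text \<open>The sine keeps the curve inside a chart although it is defined on the whole real line.\<close>

lemma smooth_on_sin_curve:
  assumes "c \<noteq> 0" shows "smooth_on UNIV (\<lambda>t::real. a + (c * sin (t / c)) *\<^sub>R w)"
proof -
  \<comment> \<open>The phase \<open>\<theta>\<close> makes the family closed under differentiation,
    which shifts the phase by \<open>pi / 2\<close> and rescales \<open>z\<close>.\<close>
  have "Ck_on k UNIV (\<lambda>t::real. sin (t / c + \<theta>) *\<^sub>R z)" for k \<theta> and z :: 'a
  proof (induction k arbitrary: \<theta> z)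
    case 0
    show ?case by (auto intro!: continuous_intros simp: divide_inverse)
  next
    case (Suc k)
    have der: "((\<lambda>t. sin (t / c + \<theta>) *\<^sub>R z) has_derivative
        (\<lambda>v. sin (x / c + (\<theta> + pi / 2)) *\<^sub>R ((v / c) *\<^sub>R z))) (at x)" for x
    proof -
      have "((\<lambda>t. sin (t / c + \<theta>)) has_real_derivative cos (x / c + \<theta>) * (1 / c)) (at x)"
        using assms by (auto intro!: derivative_eq_intros)
      then have "((\<lambda>t. sin (t / c + \<theta>) *\<^sub>R z) has_derivative
          (\<lambda>v. (cos (x / c + \<theta>) * (1 / c) * v) *\<^sub>R z)) (at x)"
        unfolding has_field_derivative_def
        by (rule bounded_linear.has_derivative[OF bounded_linear_scaleR_left])
      moreover have sin: "sin (x / c + (\<theta> + pi / 2)) = cos (x / c + \<theta>)"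
        unfolding add.assoc[symmetric] by (simp only: sin_add sin_pi_half cos_pi_half)
      ultimately show ?thesis unfolding sin by simp
    qed
    show ?case by (rule Ck_on_SucI[OF open_UNIV der]) (rule Suc)
  qed
  from this[of _ 0 "c *\<^sub>R w"] have "smooth_on UNIV (\<lambda>t::real. (c * sin (t / c)) *\<^sub>R w)"
    by (simp add: smooth_on_def mult.commute)
  then show ?thesis by (intro smooth_on_add smooth_on_const) auto
qed

section \<open>Charts and smooth maps between manifolds\<close>

lemma chart_inj:
  assumes "is_chart T (U, \<phi>)" shows "inj_on \<phi> U"
proof -
  have "openin T U" "homeomorphic_map (subtopology T U) (top_of_set (\<phi> ` U)) \<phi>"
    using assms by (auto simp: is_chart_def)
  then show ?thesis
    using homeomorphic_imp_injective_map topspace_subtopology_subset openin_subset by metis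
qed

lemma chart_open: "is_chart T (U, \<phi>) \<Longrightarrow> openin T U"
  by (simp add: is_chart_def)

lemma chart_open_image:
  assumes "is_chart T (U, \<phi>)" "openin T W" "W \<subseteq> U" shows "open (\<phi> ` W)"
proof -
  have *: "openin T U" "homeomorphic_map (subtopology T U) (top_of_set (\<phi> ` U)) \<phi>" "open (\<phi> ` U)"
    using assms by (auto simp: is_chart_def)
  have "openin (subtopology T U) W" using assms(2,3) by (simp add: openin_open_subtopology[OF *(1)])
  then have "openin (top_of_set (\<phi> ` U)) (\<phi> ` W)"
    using homeomorphic_map_openness_eq[OF *(2), of W] by simp
  then show ?thesis using *(3) openin_open_eq by blast
qed

lemma chart_continuous:
  assumes "is_chart T (U, \<phi>)"
  shows "continuous_map (subtopology T U) euclidean \<phi>"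
proof -
  have "homeomorphic_map (subtopology T U) (top_of_set (\<phi> ` U)) \<phi>"
    using assms by (simp add: is_chart_def)
  then have "continuous_map (subtopology T U) (top_of_set (\<phi> ` U)) \<phi>"
    by (rule homeomorphic_imp_continuous_map)
  then show ?thesis by (simp add: continuous_map_in_subtopology)
qed

lemma chart_inverse_continuous:
  assumes "is_chart T (U, \<phi>)"
  shows "continuous_map (top_of_set (\<phi> ` U)) T (inv_into U \<phi>)"
proof -
  have *: "openin T U" "homeomorphic_map (subtopology T U) (top_of_set (\<phi> ` U)) \<phi>"
    using assms by (auto simp: is_chart_def)
  have ts: "topspace (subtopology T U) = U"
    using *(1) openin_subset topspace_subtopology_subset by metis
  obtain g where g: "homeomorphic_maps (subtopology T U) (top_of_set (\<phi> ` U)) \<phi> g"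
    using *(2) homeomorphic_map_maps by metis
  have "continuous_map (top_of_set (\<phi> ` U)) (subtopology T U) (inv_into U \<phi>)"
  proof (rule continuous_map_eq)
    show "continuous_map (top_of_set (\<phi> ` U)) (subtopology T U) g"
      using g by (simp add: homeomorphic_maps_def)
    fix y assume "y \<in> topspace (top_of_set (\<phi> ` U))"
    then obtain x where x: "x \<in> U" "y = \<phi> x" by auto
    have "g (\<phi> x) = x" using g x ts by (simp add: homeomorphic_maps_def)
    then show "g y = inv_into U \<phi> y" using x chart_inj[OF assms] by simp
  qed
  then show ?thesis by (simp add: continuous_map_in_subtopology)
qed

text \<open>The covering half of being a manifold. Composition of smooth maps rests on it alone, and
  it passes to products directly.\<close>

definition chart_cover :: "'m topology \<Rightarrow> ('m, 'e::euclidean_space) chart set \<Rightarrow> bool" where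
  "chart_cover T A \<longleftrightarrow> (\<forall>c\<in>A. is_chart T c) \<and> (\<Union>c\<in>A. fst c) = topspace T"

lemma chart_coverD:
  assumes "chart_cover T A" "p \<in> topspace T"
  obtains U \<phi> where "(U, \<phi>) \<in> A" "is_chart T (U, \<phi>)" "p \<in> U"
proof -
  obtain c where c: "c \<in> A" "p \<in> fst c" using assms unfolding chart_cover_def by blast
  then show ?thesis using assms(1) that[of "fst c" "snd c"] by (simp add: chart_cover_def)
qed

lemma smooth_manifold_chart_cover: "smooth_manifold T A \<Longrightarrow> chart_cover T A"
  by (simp add: smooth_manifold_def chart_cover_def)

lemma openin_chart_preimage:
  assumes "continuous_map S T f" "openin S U" "openin T W"
  shows "openin S {x\<in>U. f x \<in> W}"
proof -
  have "{x\<in>U. f x \<in> W} = U \<inter> {x\<in>topspace S. f x \<in> W}" using openin_subset[OF assms(2)] by auto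
  then show ?thesis using assms(2) openin_continuous_map_preimage[OF assms(1,3)] by (simp add: openin_Int)
qed

text \<open>Smoothness is local, so near each point one may factor through a chart of
  \<open>B\<close> around the intermediate point \<open>f x\<close>.\<close>

lemma smooth_map_compose:
  assumes A: "chart_cover S A" and B: "chart_cover T B" and C: "chart_cover R C"
    and f: "smooth_map S A T B f" and g: "smooth_map T B R C g"
  shows "smooth_map S A R C (\<lambda>x. g (f x))"
proof -
  have cf: "continuous_map S T f" and cg: "continuous_map T R g"
    using f g by (auto simp: smooth_map_def)
  have cgf: "continuous_map S R (\<lambda>x. g (f x))"
    using continuous_map_compose[OF cf cg] by (simp add: o_def)
  have "smooth_on (\<phi> ` {x\<in>U. g (f x) \<in> W}) (\<xi> \<circ> (\<lambda>x. g (f x)) \<circ> inv_into U \<phi>)"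
    if U: "(U, \<phi>) \<in> A" and W: "(W, \<xi>) \<in> C" for U \<phi> W \<xi>
  proof (rule smooth_on_local)
    fix y assume "y \<in> \<phi> ` {x\<in>U. g (f x) \<in> W}"
    then obtain x where x: "x \<in> U" "g (f x) \<in> W" "y = \<phi> x" by blast
    have chU: "is_chart S (U, \<phi>)" and chW: "is_chart R (W, \<xi>)"
      using A C U W by (auto simp: chart_cover_def)
    have "x \<in> topspace S" using x chart_open[OF chU] openin_subset by blast
    then have "f x \<in> topspace T" using cf by (auto simp: continuous_map_def)
    then obtain V \<psi> where V: "(V, \<psi>) \<in> B" "is_chart T (V, \<psi>)" "f x \<in> V"
      using chart_coverD[OF B] by blast
    define N where "N = {x\<in>U. f x \<in> V} \<inter> {x\<in>U. g (f x) \<in> W}"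
    have "openin S N" unfolding N_def
      by (intro openin_Int openin_chart_preimage[OF cf] openin_chart_preimage[OF cgf]
          chart_open[OF chU] chart_open[OF chW] chart_open[OF V(2)])
    then have oN: "open (\<phi> ` N)" by (rule chart_open_image[OF chU]) (auto simp: N_def)
    have inv: "inv_into U \<phi> (\<phi> x) = x" if "x \<in> U" for x using chart_inj[OF chU] that by simp
    have inv': "inv_into V \<psi> (\<psi> x) = x" if "x \<in> V" for x using chart_inj[OF V(2)] that by simp
    have 1: "smooth_on (\<phi> ` N) (\<psi> \<circ> f \<circ> inv_into U \<phi>)"
      by (rule smooth_on_subset[of "\<phi> ` {x\<in>U. f x \<in> V}"])
        (use f U V(1) in \<open>auto simp: smooth_map_def N_def\<close>)
    have 2: "smooth_on (\<psi> ` {x\<in>V. g x \<in> W}) (\<xi> \<circ> g \<circ> inv_into V \<psi>)"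
      using g W V(1) by (auto simp: smooth_map_def)
    have "smooth_on (\<phi> ` N) (\<lambda>y. (\<xi> \<circ> g \<circ> inv_into V \<psi>) ((\<psi> \<circ> f \<circ> inv_into U \<phi>) y))"
      by (rule smooth_on_compose[OF oN 1 2]) (auto simp: N_def inv)
    then have "smooth_on (\<phi> ` N) (\<xi> \<circ> (\<lambda>x. g (f x)) \<circ> inv_into U \<phi>)"
      by (rule smooth_on_cong[OF oN, rotated]) (auto simp: N_def inv inv')
    then show "\<exists>N. open N \<and> y \<in> N \<and> smooth_on N (\<xi> \<circ> (\<lambda>x. g (f x)) \<circ> inv_into U \<phi>)"
      using oN x V(3) by (intro exI[of _ "\<phi> ` N"]) (auto simp: N_def)
  qed
  then show ?thesis using cgf by (auto simp: smooth_map_def)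
qed

lemma smooth_map_id:
  assumes "\<And>c c'. c \<in> A \<Longrightarrow> c' \<in> B \<Longrightarrow> smoothly_compatible c c'"
  shows "smooth_map T A T B (\<lambda>x. x)"
  unfolding smooth_map_def
proof (intro conjI ballI, simp, clarify)
  fix U \<phi> W \<psi> assume "(U, \<phi>) \<in> A" "(W, \<psi>) \<in> B"
  then have "smooth_on (\<phi> ` (U \<inter> W)) (\<psi> \<circ> inv_into U \<phi>)"
    using assms by (auto simp: smoothly_compatible_def)
  moreover have "{x\<in>U. x \<in> W} = U \<inter> W" by auto
  ultimately show "smooth_on (\<phi> ` {x\<in>U. x \<in> W}) (\<psi> \<circ> (\<lambda>x. x) \<circ> inv_into U \<phi>)" by (simp add: o_def)
qed

lemma smooth_map_const:
  assumes "p \<in> topspace T" shows "smooth_map S A T B (\<lambda>_. p)"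
  unfolding smooth_map_def using assms by (auto simp: o_def smooth_on_const)

lemma smooth_map_Pair:
  assumes A: "chart_cover S A" and B: "chart_cover T B" and C: "chart_cover R C"
    and f: "smooth_map S A T B f" and g: "smooth_map S A R C g"
  shows "smooth_map S A (prod_topology T R) (product_atlas B C) (\<lambda>x. (f x, g x))"
proof -
  have cf: "continuous_map S T f" and cg: "continuous_map S R g"
    using f g by (auto simp: smooth_map_def)
  have "smooth_on (\<phi> ` {x\<in>U. (f x, g x) \<in> V \<times> W})
      ((\<lambda>(x, y). (\<psi> x, \<xi> y)) \<circ> (\<lambda>x. (f x, g x)) \<circ> inv_into U \<phi>)"
    if U: "(U, \<phi>) \<in> A" and V: "(V, \<psi>) \<in> B" and W: "(W, \<xi>) \<in> C" for U \<phi> V \<psi> W \<xi>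
  proof -
    have chU: "is_chart S (U, \<phi>)" and chW: "is_chart R (W, \<xi>)" and chV: "is_chart T (V, \<psi>)"
      using A B C U V W by (auto simp: chart_cover_def)
    have eq: "{x\<in>U. (f x, g x) \<in> V \<times> W} = {x\<in>U. f x \<in> V} \<inter> {x\<in>U. g x \<in> W}" by auto
    have "openin S ({x\<in>U. f x \<in> V} \<inter> {x\<in>U. g x \<in> W})"
      by (intro openin_Int openin_chart_preimage[OF cf] openin_chart_preimage[OF cg]
          chart_open[OF chU] chart_open[OF chW] chart_open[OF chV])
    then have o: "open (\<phi> ` ({x\<in>U. f x \<in> V} \<inter> {x\<in>U. g x \<in> W}))"
      by (rule chart_open_image[OF chU]) auto
    have 1: "smooth_on (\<phi> ` ({x\<in>U. f x \<in> V} \<inter> {x\<in>U. g x \<in> W})) (\<psi> \<circ> f \<circ> inv_into U \<phi>)"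
      by (rule smooth_on_subset[of "\<phi> ` {x\<in>U. f x \<in> V}"])
        (use f U V in \<open>auto simp: smooth_map_def\<close>)
    have 2: "smooth_on (\<phi> ` ({x\<in>U. f x \<in> V} \<inter> {x\<in>U. g x \<in> W})) (\<xi> \<circ> g \<circ> inv_into U \<phi>)"
      by (rule smooth_on_subset[of "\<phi> ` {x\<in>U. g x \<in> W}"])
        (use g U W in \<open>auto simp: smooth_map_def\<close>)
    show ?thesis unfolding eq using smooth_on_Pair[OF o 1 2] by (simp add: o_def)
  qed
  then show ?thesis
    using cf cg unfolding smooth_map_def product_atlas_def
    by (auto simp: continuous_map_paired)
qed

lemma inv_into_prod:
  assumes "inj_on \<phi> U" "inj_on \<psi> W" "a \<in> \<phi> ` U" "b \<in> \<psi> ` W"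
  shows "inv_into (U \<times> W) (\<lambda>(x, y). (\<phi> x, \<psi> y)) (a, b) = (inv_into U \<phi> a, inv_into W \<psi> b)"
proof -
  have "inj_on (\<lambda>(x, y). (\<phi> x, \<psi> y)) (U \<times> W)" using assms(1,2) by (auto simp: inj_on_def)
  then show ?thesis
    by (rule inv_into_f_eq) (use assms(3,4) in \<open>auto simp: inv_into_into f_inv_into_f\<close>)
qed

lemma image_prod: "(\<lambda>(x, y). (\<phi> x, \<psi> y)) ` (U \<times> W) = (\<phi> ` U) \<times> (\<psi> ` W)"
  by auto

lemma is_chart_prod:
  assumes "is_chart T (U, \<phi>)" "is_chart R (W, \<psi>)"
  shows "is_chart (prod_topology T R) (U \<times> W, \<lambda>(x, y). (\<phi> x, \<psi> y))"
proof -
  have 1: "openin T U" "homeomorphic_map (subtopology T U) (top_of_set (\<phi> ` U)) \<phi>" "open (\<phi> ` U)"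
    and 2: "openin R W" "homeomorphic_map (subtopology R W) (top_of_set (\<psi> ` W)) \<psi>" "open (\<psi> ` W)"
    using assms by (auto simp: is_chart_def)
  obtain f g where "homeomorphic_maps (subtopology T U) (top_of_set (\<phi> ` U)) \<phi> f"
    "homeomorphic_maps (subtopology R W) (top_of_set (\<psi> ` W)) \<psi> g"
    using 1(2) 2(2) homeomorphic_map_maps by metis
  then have "homeomorphic_maps (prod_topology (subtopology T U) (subtopology R W))
      (prod_topology (top_of_set (\<phi> ` U)) (top_of_set (\<psi> ` W)))
      (\<lambda>(x, y). (\<phi> x, \<psi> y)) (\<lambda>(x, y). (f x, g y))"
    unfolding homeomorphic_maps_prod by blast
  then have "homeomorphic_map (subtopology (prod_topology T R) (U \<times> W))
      (top_of_set ((\<lambda>(x, y). (\<phi> x, \<psi> y)) ` (U \<times> W))) (\<lambda>(x, y). (\<phi> x, \<psi> y))"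
    unfolding image_prod subtopology_Times prod_topology_subtopology_eu[symmetric]
    by (rule homeomorphic_maps_imp_map)
  moreover have "openin (prod_topology T R) (U \<times> W)"
    using 1(1) 2(1) by (simp add: openin_prod_Times_iff)
  moreover have "open ((\<lambda>(x, y). (\<phi> x, \<psi> y)) ` (U \<times> W))"
    unfolding image_prod using 1(3) 2(3) by (rule open_Times)
  ultimately show ?thesis by (simp add: is_chart_def)
qed

lemma chart_cover_prod:
  assumes "chart_cover T A" "chart_cover R B"
  shows "chart_cover (prod_topology T R) (product_atlas A B)"
proof -
  have "(\<Union>c\<in>product_atlas A B. fst c) = (\<Union>c\<in>A. fst c) \<times> (\<Union>c\<in>B. fst c)"
    by (auto simp: product_atlas_def) (metis fst_conv mem_Sigma_iff)+
  then show ?thesis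
    using assms is_chart_prod by (fastforce simp: chart_cover_def product_atlas_def)
qed

lemma smooth_map_fst:
  assumes A: "chart_cover T A" and B: "chart_cover R B"
    and compat: "\<And>c c'. c \<in> A \<Longrightarrow> c' \<in> A \<Longrightarrow> smoothly_compatible c c'"
  shows "smooth_map (prod_topology T R) (product_atlas A B) T A fst"
proof -
  have "smooth_on ((\<lambda>(x, y). (\<phi> x, \<psi> y)) ` {p\<in>U \<times> W. fst p \<in> U'})
      (\<phi>' \<circ> fst \<circ> inv_into (U \<times> W) (\<lambda>(x, y). (\<phi> x, \<psi> y)))"
    if U: "(U, \<phi>) \<in> A" and W: "(W, \<psi>) \<in> B" and U': "(U', \<phi>') \<in> A" for U \<phi> W \<psi> U' \<phi>'
  proof -
    have ch: "is_chart T (U, \<phi>)" "is_chart R (W, \<psi>)" "is_chart T (U', \<phi>')"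
      using A B U W U' by (auto simp: chart_cover_def)
    have eq: "(\<lambda>(x, y). (\<phi> x, \<psi> y)) ` {p\<in>U \<times> W. fst p \<in> U'} = \<phi> ` (U \<inter> U') \<times> \<psi> ` W" by force
    have o: "open (\<phi> ` (U \<inter> U') \<times> \<psi> ` W)"
      using ch by (intro open_Times chart_open_image[OF ch(1)] chart_open_image[OF ch(2)] openin_Int)
        (auto intro: chart_open)
    have 1: "smooth_on (\<phi> ` (U \<inter> U')) (\<phi>' \<circ> inv_into U \<phi>)"
      using compat[OF U U'] by (simp add: smoothly_compatible_def)
    have "smooth_on (\<phi> ` (U \<inter> U') \<times> \<psi> ` W) (\<lambda>p. (\<phi>' \<circ> inv_into U \<phi>) (fst p))"
      by (rule smooth_on_compose[OF o smooth_on_bounded_linear[OF bounded_linear_fst] 1]) auto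
    then show ?thesis unfolding eq
      by (rule smooth_on_cong[OF o, rotated])
        (auto simp: inv_into_prod[OF chart_inj[OF ch(1)] chart_inj[OF ch(2)]])
  qed
  then show ?thesis unfolding smooth_map_def by (auto simp: product_atlas_def continuous_map_fst)
qed

lemma smooth_map_snd:
  assumes A: "chart_cover T A" and B: "chart_cover R B"
    and compat: "\<And>c c'. c \<in> B \<Longrightarrow> c' \<in> B \<Longrightarrow> smoothly_compatible c c'"
  shows "smooth_map (prod_topology T R) (product_atlas A B) R B snd"
proof -
  have "smooth_on ((\<lambda>(x, y). (\<phi> x, \<psi> y)) ` {p\<in>U \<times> W. snd p \<in> W'})
      (\<psi>' \<circ> snd \<circ> inv_into (U \<times> W) (\<lambda>(x, y). (\<phi> x, \<psi> y)))"
    if U: "(U, \<phi>) \<in> A" and W: "(W, \<psi>) \<in> B" and W': "(W', \<psi>') \<in> B" for U \<phi> W \<psi> W' \<psi>'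
  proof -
    have ch: "is_chart T (U, \<phi>)" "is_chart R (W, \<psi>)" "is_chart R (W', \<psi>')"
      using A B U W W' by (auto simp: chart_cover_def)
    have eq: "(\<lambda>(x, y). (\<phi> x, \<psi> y)) ` {p\<in>U \<times> W. snd p \<in> W'} = \<phi> ` U \<times> \<psi> ` (W \<inter> W')" by force
    have o: "open (\<phi> ` U \<times> \<psi> ` (W \<inter> W'))"
      using ch by (intro open_Times chart_open_image[OF ch(1)] chart_open_image[OF ch(2)] openin_Int)
        (auto intro: chart_open)
    have 1: "smooth_on (\<psi> ` (W \<inter> W')) (\<psi>' \<circ> inv_into W \<psi>)"
      using compat[OF W W'] by (simp add: smoothly_compatible_def)
    have "smooth_on (\<phi> ` U \<times> \<psi> ` (W \<inter> W')) (\<lambda>p. (\<psi>' \<circ> inv_into W \<psi>) (snd p))"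
      by (rule smooth_on_compose[OF o smooth_on_bounded_linear[OF bounded_linear_snd] 1]) auto
    then show ?thesis unfolding eq
      by (rule smooth_on_cong[OF o, rotated])
        (auto simp: inv_into_prod[OF chart_inj[OF ch(1)] chart_inj[OF ch(2)]])
  qed
  then show ?thesis unfolding smooth_map_def by (auto simp: product_atlas_def continuous_map_snd)
qed

lemma smooth_map_coordinates:
  assumes A: "chart_cover S A" and B: "chart_cover T B" and f: "smooth_map S A T B f"
    and U: "(U, \<phi>) \<in> A" and W: "(W, \<psi>) \<in> B"
  shows "open (\<phi> ` {x\<in>U. f x \<in> W})"
    and "smooth_on (\<phi> ` {x\<in>U. f x \<in> W}) (\<lambda>a. \<psi> (f (inv_into U \<phi> a)))"
proof -
  have ch: "is_chart S (U, \<phi>)" "is_chart T (W, \<psi>)" using assms by (auto simp: chart_cover_def)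
  have "continuous_map S T f" using f by (simp add: smooth_map_def)
  then have "openin S {x\<in>U. f x \<in> W}" using ch by (intro openin_chart_preimage chart_open)
  then show "open (\<phi> ` {x\<in>U. f x \<in> W})" by (rule chart_open_image[OF ch(1)]) auto
  show "smooth_on (\<phi> ` {x\<in>U. f x \<in> W}) (\<lambda>a. \<psi> (f (inv_into U \<phi> a)))"
    using f U W by (auto simp: smooth_map_def o_def)
qed

text \<open>The inverse of a product chart splits into the inverses of its factors; in this form the
  partial derivatives of the group operations can be taken.\<close>

lemma smooth_map_coordinates2:
  assumes A: "chart_cover S A" and A': "chart_cover S' A'" and B: "chart_cover T B"
    and f: "smooth_map (prod_topology S S') (product_atlas A A') T B f"
    and U: "(U, \<phi>) \<in> A" and U': "(U', \<phi>') \<in> A'" and W: "(W, \<psi>) \<in> B"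
  defines "\<Omega> \<equiv> {(a, b). a \<in> \<phi> ` U \<and> b \<in> \<phi>' ` U' \<and> f (inv_into U \<phi> a, inv_into U' \<phi>' b) \<in> W}"
  shows "open \<Omega>"
    and "smooth_on \<Omega> (\<lambda>p. \<psi> (f (inv_into U \<phi> (fst p), inv_into U' \<phi>' (snd p))))"
proof -
  have ch: "is_chart S (U, \<phi>)" "is_chart S' (U', \<phi>')" using assms by (auto simp: chart_cover_def)
  have mem: "(U \<times> U', \<lambda>(x, y). (\<phi> x, \<phi>' y)) \<in> product_atlas A A'"
    using U U' by (auto simp: product_atlas_def)
  have inv: "inv_into (U \<times> U') (\<lambda>(x, y). (\<phi> x, \<phi>' y)) p = (inv_into U \<phi> (fst p), inv_into U' \<phi>' (snd p))"
    if "p \<in> \<Omega>" for p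
    using that inv_into_prod[OF chart_inj[OF ch(1)] chart_inj[OF ch(2)]] by (auto simp: \<Omega>_def)
  have eq: "(\<lambda>(x, y). (\<phi> x, \<phi>' y)) ` {p\<in>U \<times> U'. f p \<in> W} = \<Omega>"
  proof (intro equalityI subsetI)
    fix p assume "p \<in> (\<lambda>(x, y). (\<phi> x, \<phi>' y)) ` {p\<in>U \<times> U'. f p \<in> W}"
    then show "p \<in> \<Omega>" using chart_inj[OF ch(1)] chart_inj[OF ch(2)] by (auto simp: \<Omega>_def)
  next
    fix p assume "p \<in> \<Omega>"
    then obtain x y where "p = (\<phi> x, \<phi>' y)" "x \<in> U" "y \<in> U'" "f (x, y) \<in> W"
      using chart_inj[OF ch(1)] chart_inj[OF ch(2)] by (auto simp: \<Omega>_def)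
    then show "p \<in> (\<lambda>(x, y). (\<phi> x, \<phi>' y)) ` {p\<in>U \<times> U'. f p \<in> W}" by force
  qed
  note * = smooth_map_coordinates[OF chart_cover_prod[OF A A'] B f mem W, unfolded eq]
  show "open \<Omega>" by (rule *(1))
  show "smooth_on \<Omega> (\<lambda>p. \<psi> (f (inv_into U \<phi> (fst p), inv_into U' \<phi>' (snd p))))"
    by (rule smooth_on_cong[OF *(1) _ *(2)]) (simp add: inv)
qed

section \<open>Estimates from bounds on derivatives\<close>

lemma vanishing_of_derivative_bound:
  fixes f :: "real \<Rightarrow> 'a::real_normed_vector"
  assumes r: "r > 0" and der: "\<And>t. \<bar>t\<bar> \<le> r \<Longrightarrow> (f has_vector_derivative f' t) (at t)"
    and bound: "\<And>t. \<bar>t\<bar> \<le> r \<Longrightarrow> norm (f' t) \<le> K * norm (f t)" and "f 0 = 0"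
  shows "\<exists>\<delta>>0. \<forall>t. \<bar>t\<bar> \<le> \<delta> \<longrightarrow> f t = 0"
proof -
  define K' where "K' = max K 1"
  have K': "K' > 0" "norm (f' t) \<le> K' * norm (f t)" if "\<bar>t\<bar> \<le> r" for t
  proof -
    show "K' > 0" by (simp add: K'_def)
    have "K * norm (f t) \<le> K' * norm (f t)" by (intro mult_right_mono) (auto simp: K'_def)
    then show "norm (f' t) \<le> K' * norm (f t)" using bound[OF that] by linarith
  qed
  have K'0: "K' > 0" by (simp add: K'_def)
  \<comment> \<open>For \<open>\<bar>t\<bar> \<le> \<delta>\<close> the maximum of
    \<open>norm (f t)\<close> is at most half of itself by the mean value inequality, since
    \<open>f\<close> vanishes at 0; hence \<open>f\<close> vanishes throughout. Passing from
    \<open>K\<close> to \<open>max K 1\<close> makes the division legitimate.\<close>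
  define \<delta> where "\<delta> = min r (1 / (2 * K'))"
  have \<delta>: "\<delta> > 0" "\<delta> \<le> r" "K' * \<delta> \<le> 1 / 2"
  proof -
    show "\<delta> > 0" "\<delta> \<le> r" using r K'0 by (auto simp: \<delta>_def)
    have "K' * \<delta> \<le> K' * (1 / (2 * K'))" using K'0 by (intro mult_left_mono) (auto simp: \<delta>_def)
    then show "K' * \<delta> \<le> 1 / 2" using K'0 by simp
  qed
  have cont: "continuous_on {-\<delta>..\<delta>} f"
  proof (intro continuous_at_imp_continuous_on ballI)
    fix t assume "t \<in> {-\<delta>..\<delta>}"
    then have "\<bar>t\<bar> \<le> r" using \<delta> by auto
    from has_vector_derivative_continuous[OF der[OF this]] show "isCont f t" .
  qed
  obtain t0 where t0: "t0 \<in> {-\<delta>..\<delta>}" "\<forall>t\<in>{-\<delta>..\<delta>}. norm (f t) \<le> norm (f t0)"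
  proof -
    have "\<exists>x\<in>{-\<delta>..\<delta>}. \<forall>y\<in>{-\<delta>..\<delta>}. norm (f y) \<le> norm (f x)"
      by (rule continuous_attains_sup) (use \<delta> in \<open>auto intro: continuous_on_norm[OF cont]\<close>)
    then show ?thesis using that by blast
  qed
  have "norm (f t0 - f 0) \<le> (K' * norm (f t0)) * norm (t0 - 0)"
  proof (rule differentiable_bound[of "{-\<delta>..\<delta>}" f "\<lambda>t h. h *\<^sub>R f' t"])
    fix t assume t: "t \<in> {-\<delta>..\<delta>}"
    then show "(f has_derivative (\<lambda>h. h *\<^sub>R f' t)) (at t within {-\<delta>..\<delta>})"
      using der[of t] \<delta> unfolding has_vector_derivative_def by (auto intro: has_derivative_at_withinI)
    have "norm (f' t) \<le> K' * norm (f t)" using K'(2)[of t] t \<delta> by auto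
    also have "\<dots> \<le> K' * norm (f t0)" using t0 t K'0 by (intro mult_left_mono) auto
    finally have "norm (f' t) \<le> K' * norm (f t0)" .
    then show "onorm (\<lambda>h. h *\<^sub>R f' t) \<le> K' * norm (f t0)"
      by (intro onorm_le) (simp add: mult.commute[of "K' * _"] mult_left_mono)
  qed (use t0 \<delta> in auto)
  also have "\<dots> \<le> (K' * norm (f t0)) * \<delta>"
    using t0(1) K'0 by (intro mult_left_mono) auto
  also have "\<dots> = (K' * \<delta>) * norm (f t0)" by simp
  also have "\<dots> \<le> (1 / 2) * norm (f t0)" using \<delta>(3) by (intro mult_right_mono) auto
  finally have "norm (f t0) \<le> 0" using \<open>f 0 = 0\<close> by simp
  then show ?thesis using t0(2) \<delta>(1) by (intro exI[of _ \<delta>]) fastforce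
qed

lemma linear_norm_le_sum_Basis:
  fixes f :: "'a::euclidean_space \<Rightarrow> 'b::real_normed_vector"
  assumes "linear f" "\<And>b. b \<in> Basis \<Longrightarrow> norm (f b) \<le> B"
  shows "norm (f w) \<le> real DIM('a) * B * norm w"
proof -
  have "f w = f (\<Sum>b\<in>Basis. (w \<bullet> b) *\<^sub>R b)" by (simp add: euclidean_representation)
  also have "\<dots> = (\<Sum>b\<in>Basis. (w \<bullet> b) *\<^sub>R f b)"
    by (simp add: linear_sum[OF assms(1)] linear_cmul[OF assms(1)])
  finally have "norm (f w) = norm (\<Sum>b\<in>Basis. (w \<bullet> b) *\<^sub>R f b)" by simp
  also have "\<dots> \<le> (\<Sum>b\<in>(Basis :: 'a set). norm w * B)"
  proof (rule sum_norm_le)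
    fix b :: 'a assume b: "b \<in> Basis"
    show "norm ((w \<bullet> b) *\<^sub>R f b) \<le> norm w * B"
      using Basis_le_norm[OF b, of w] assms(2)[OF b] by (simp add: mult_mono)
  qed
  finally show ?thesis by (simp add: mult_ac)
qed

text \<open>On a compact ball the finitely many basis derivatives are bounded by continuity, and the
  mean value inequality applies because the ball is convex.\<close>

lemma smooth_on_locally_lipschitz:
  fixes f :: "'a::euclidean_space \<Rightarrow> 'b::euclidean_space"
  assumes S: "open S" and f: "smooth_on S f" and a: "a \<in> S"
  shows "\<exists>\<epsilon>>0. \<exists>K. cball a \<epsilon> \<subseteq> S \<and> (\<forall>x\<in>cball a \<epsilon>. \<forall>y\<in>cball a \<epsilon>. norm (f x - f y) \<le> K * norm (x - y))"
proof -
  obtain \<epsilon> where \<epsilon>: "\<epsilon> > 0" "cball a \<epsilon> \<subseteq> S" using S a open_contains_cball by blast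
  have "\<exists>B. \<forall>x\<in>cball a \<epsilon>. norm (frechet_derivative f (at x) b) \<le> B" for b
  proof -
    have "continuous_on (cball a \<epsilon>) (\<lambda>x. frechet_derivative f (at x) b)"
      using smooth_on_imp_continuous_on[OF smooth_on_frechet_derivative[OF f]] \<epsilon>(2)
        continuous_on_subset by blast
    then have "bounded ((\<lambda>x. frechet_derivative f (at x) b) ` cball a \<epsilon>)"
      by (intro compact_imp_bounded compact_continuous_image compact_cball)
    then show ?thesis by (auto simp: bounded_iff)
  qed
  then obtain B where B: "\<And>x b. x \<in> cball a \<epsilon> \<Longrightarrow> norm (frechet_derivative f (at x) b) \<le> B b" by metis
  define K where "K = real DIM('a) * (\<Sum>b\<in>Basis. B b)"
  have "norm (f x - f y) \<le> K * norm (x - y)" if "x \<in> cball a \<epsilon>" "y \<in> cball a \<epsilon>" for x y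
  proof (rule differentiable_bound[of "cball a \<epsilon>" f "\<lambda>x. frechet_derivative f (at x)"])
    fix z assume z: "z \<in> cball a \<epsilon>"
    have der: "(f has_derivative frechet_derivative f (at z)) (at z)"
      using smooth_on_has_derivative[OF f] z \<epsilon>(2) by blast
    then show "(f has_derivative frechet_derivative f (at z)) (at z within cball a \<epsilon>)"
      by (rule has_derivative_at_withinI)
    have "0 \<le> B b" for b using B[OF z, of b] norm_ge_zero order_trans by blast
    then have "norm (frechet_derivative f (at z) b) \<le> (\<Sum>b\<in>Basis. B b)" if "b \<in> Basis" for b
      using B[OF z, of b] member_le_sum[of b Basis B] that by fastforce
    then have "norm (frechet_derivative f (at z) w) \<le> K * norm w" for w
      unfolding K_def using linear_norm_le_sum_Basis has_derivative_linear[OF der] by blast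
    then show "onorm (frechet_derivative f (at z)) \<le> K" by (rule onorm_le)
  qed (use that in auto)
  then show ?thesis using \<epsilon> by blast
qed

lemma smooth_on_partial_derivative:
  assumes "smooth_on \<Omega> F" "(a, b) \<in> \<Omega>"
  shows "((\<lambda>y. F (a, y)) has_derivative (\<lambda>w. frechet_derivative F (at (a, b)) (0, w))) (at b)"
proof -
  have "((\<lambda>y. (a, y)) has_derivative (\<lambda>w. (0, w))) (at b)"
    by (auto intro!: derivative_eq_intros)
  from diff_chain_at[OF this smooth_on_has_derivative[OF assms]] show ?thesis by (simp add: o_def)
qed

text \<open>If \<open>F (a, \<cdot>)\<close> is the identity near \<open>a\<close>, then by continuity of the derivative \<open>F (y, \<cdot>)\<close> is
  close to a translation, uniformly for \<open>y\<close> near \<open>a\<close>.\<close>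

lemma smooth_on_near_translation:
  fixes F :: "'a::euclidean_space \<times> 'a \<Rightarrow> 'a"
  assumes \<Omega>: "open \<Omega>" "(a, a) \<in> \<Omega>" and F: "smooth_on \<Omega> F"
    and N: "open N" "a \<in> N" "\<And>y. y \<in> N \<Longrightarrow> F (a, y) = y"
  shows "\<exists>\<epsilon>>0. ball a \<epsilon> \<times> ball a \<epsilon> \<subseteq> \<Omega> \<and> (\<forall>y\<in>ball a \<epsilon>. \<forall>z\<in>ball a \<epsilon>.
    norm (F (y, z) - F (y, y) - (z - y)) \<le> (1 / 2) * norm (z - y))"
proof -
  define D where "D p w = frechet_derivative F (at p) (0, w)" for p w
  have Da: "D (a, a) w = w" for w
  proof -
    have "((\<lambda>y. y) has_derivative (\<lambda>w. w)) (at a)" by (rule has_derivative_ident)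
    then have "((\<lambda>y. F (a, y)) has_derivative (\<lambda>w. w)) (at a)"
      by (rule has_derivative_transform_within_open[OF _ N(1,2)]) (simp add: N(3))
    from has_derivative_unique[OF smooth_on_partial_derivative[OF F \<Omega>(2)] this]
    show ?thesis by (metis D_def)
  qed
  \<comment> \<open>Chosen such that a deviation of at most \<open>\<eta>\<close> on each basis
    vector is an operator deviation of at most 1 / 2.\<close>
  define \<eta> where "\<eta> = 1 / (2 * real DIM('a))"
  have \<eta>: "\<eta> > 0" by (simp add: \<eta>_def)
  define \<Omega>' where "\<Omega>' = {p\<in>\<Omega>. \<forall>b\<in>Basis. dist (D p b) b < \<eta>}"
  have cont: "continuous_on \<Omega> (\<lambda>p. D p b)" for b
    unfolding D_def using smooth_on_imp_continuous_on[OF smooth_on_frechet_derivative[OF F]] .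
  have "open \<Omega>'"
  proof -
    have "\<Omega>' = \<Omega> \<inter> (\<Inter>b\<in>Basis. {p\<in>\<Omega>. D p b \<in> ball b \<eta>})" by (auto simp: \<Omega>'_def dist_commute)
    moreover have "open {p\<in>\<Omega>. D p b \<in> ball b \<eta>}" for b
      using continuous_open_preimage[OF cont \<Omega>(1) open_ball, of b b \<eta>] by (simp add: vimage_def Int_def conj_commute)
    ultimately show ?thesis using \<Omega>(1) by (auto intro!: open_Int open_INT)
  qed
  moreover have "(a, a) \<in> \<Omega>'" using \<Omega>(2) Da \<eta> by (simp add: \<Omega>'_def)
  ultimately obtain P Q where PQ: "open P" "open Q" "(a, a) \<in> P \<times> Q" "P \<times> Q \<subseteq> \<Omega>'"
    using open_prod_elim by metis
  then obtain \<epsilon> where \<epsilon>: "\<epsilon> > 0" "ball a \<epsilon> \<subseteq> P \<inter> Q"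
    using open_contains_ball[of "P \<inter> Q"] by (metis IntI SigmaE2 open_Int)
  have sub: "ball a \<epsilon> \<times> ball a \<epsilon> \<subseteq> \<Omega>'" using \<epsilon>(2) PQ(4) by blast
  have "norm (F (y, z) - F (y, y) - (z - y)) \<le> (1 / 2) * norm (z - y)"
    if y: "y \<in> ball a \<epsilon>" and z: "z \<in> ball a \<epsilon>" for y z
  proof -
    have "norm ((F (y, z) - z) - (F (y, y) - y)) \<le> (1 / 2) * norm (z - y)"
    proof (rule differentiable_bound[of "ball a \<epsilon>" "\<lambda>z. F (y, z) - z" "\<lambda>z w. D (y, z) w - w"])
      fix x assume x: "x \<in> ball a \<epsilon>"
      then have p: "(y, x) \<in> \<Omega>'" using y sub by blast
      have d: "((\<lambda>z. F (y, z)) has_derivative D (y, x)) (at x)"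
        unfolding D_def using smooth_on_partial_derivative[OF F] p by (auto simp: \<Omega>'_def)
      then have d': "((\<lambda>z. F (y, z) - z) has_derivative (\<lambda>w. D (y, x) w - w)) (at x)"
        by (intro has_derivative_diff has_derivative_ident)
      then show "((\<lambda>z. F (y, z) - z) has_derivative (\<lambda>w. D (y, x) w - w)) (at x within ball a \<epsilon>)"
        by (rule has_derivative_at_withinI)
      have "norm (D (y, x) b - b) \<le> \<eta>" if "b \<in> Basis" for b
        using p that by (auto simp: \<Omega>'_def dist_norm less_imp_le)
      then have "norm (D (y, x) w - w) \<le> real DIM('a) * \<eta> * norm w" for w
        by (rule linear_norm_le_sum_Basis[OF has_derivative_linear[OF d']])
      then show "onorm (\<lambda>w. D (y, x) w - w) \<le> 1 / 2" by (intro onorm_le) (simp add: \<eta>_def)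
    qed (use y z in auto)
    then show ?thesis by (simp add: algebra_simps)
  qed
  then show ?thesis using \<epsilon>(1) sub by (intro exI[of _ \<epsilon>]) (auto simp: \<Omega>'_def)
qed

section \<open>The adjoint orbit of a one-dimensional subgroup\<close>

text \<open>In \<open>Ad g\<close> the tangent space at the identity is identified with the model space through \<open>\<phi>\<close>.\<close>

locale lie_group_chart = lie_group G T A
  for G :: "('g, 'b) monoid_scheme" (structure) and T :: "'g topology"
    and A :: "('g, 'e::euclidean_space) chart set" +
  fixes U :: "'g set" and \<phi> :: "'g \<Rightarrow> 'e"
  assumes chart_in: "(U, \<phi>) \<in> A" and one_in: "\<one> \<in> U"
begin

definition param :: "'e \<Rightarrow> 'g" where "param = inv_into U \<phi>"

definition origin :: 'e where "origin = \<phi> \<one>"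

definition Ad :: "'g \<Rightarrow> 'e \<Rightarrow> 'e" where
  "Ad g = frechet_derivative (\<lambda>b. \<phi> (g \<otimes> param b \<otimes> inv g)) (at origin)"

lemma cover: "chart_cover T A"
  using manifold by (rule smooth_manifold_chart_cover)

lemma compatible: "c \<in> A \<Longrightarrow> c' \<in> A \<Longrightarrow> smoothly_compatible c c'"
  using manifold by (auto simp: smooth_manifold_def)

lemma chart: "is_chart T (U, \<phi>)"
  using cover chart_in by (auto simp: chart_cover_def)

lemma U_carrier: "x \<in> U \<Longrightarrow> x \<in> carrier G"
  using openin_subset[OF chart_open[OF chart]] topspace_eq by auto

lemma param_phi [simp]: "x \<in> U \<Longrightarrow> param (\<phi> x) = x"
  using chart_inj[OF chart] by (simp add: param_def)

lemma phi_param [simp]: "a \<in> \<phi> ` U \<Longrightarrow> \<phi> (param a) = a"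
  by (simp add: param_def f_inv_into_f)

lemma param_in [simp]: "a \<in> \<phi> ` U \<Longrightarrow> param a \<in> U"
  by (simp add: param_def inv_into_into)

lemma param_carrier [simp]: "a \<in> \<phi> ` U \<Longrightarrow> param a \<in> carrier G"
  using U_carrier param_in by blast

lemma origin_in [simp]: "origin \<in> \<phi> ` U"
  using one_in by (simp add: origin_def)

lemma param_origin [simp]: "param origin = \<one>"
  using one_in by (simp add: origin_def)

lemma open_image_U: "open (\<phi> ` U)"
  by (rule chart_open_image[OF chart chart_open[OF chart]]) simp

lemma smooth_mult_compose:
  assumes "chart_cover S B" "smooth_map S B T A f" "smooth_map S B T A g"
  shows "smooth_map S B T A (\<lambda>x. f x \<otimes> g x)"
  using smooth_map_compose[OF assms(1) chart_cover_prod[OF cover cover] cover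
      smooth_map_Pair[OF assms(1) cover cover assms(2,3)] smooth_mult] by simp

lemma smooth_inv_compose:
  assumes "chart_cover S B" "smooth_map S B T A f"
  shows "smooth_map S B T A (\<lambda>x. inv (f x))"
  using smooth_map_compose[OF assms(1) cover cover assms(2) smooth_inv] .

lemma smooth_self: "smooth_map T A T A (\<lambda>x. x)"
  using compatible by (rule smooth_map_id)

lemma smooth_conj:
  assumes "g \<in> carrier G" shows "smooth_map T A T A (\<lambda>x. g \<otimes> x \<otimes> inv g)"
  using assms topspace_eq
  by (intro smooth_mult_compose cover smooth_self smooth_map_const) auto

lemmas cover2 = chart_cover_prod[OF cover cover]
lemmas smooth_fst = smooth_map_fst[OF cover cover compatible]
lemmas smooth_snd = smooth_map_snd[OF cover cover compatible]

lemma smooth_conj2: "smooth_map (prod_topology T T) (product_atlas A A) T A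
    (\<lambda>p. fst p \<otimes> snd p \<otimes> inv (fst p))"
  by (intro smooth_mult_compose smooth_inv_compose cover2 smooth_fst smooth_snd)

lemma smooth_mult2: "smooth_map (prod_topology T T) (product_atlas A A) T A (\<lambda>p. fst p \<otimes> snd p)"
  by (intro smooth_mult_compose cover2 smooth_fst smooth_snd)

lemma smooth_div2: "smooth_map (prod_topology T T) (product_atlas A A) T A (\<lambda>p. inv (fst p) \<otimes> snd p)"
  by (intro smooth_mult_compose smooth_inv_compose cover2 smooth_fst smooth_snd)

lemma conj_domain:
  assumes "g \<in> carrier G"
  shows "open (\<phi> ` {x\<in>U. g \<otimes> x \<otimes> inv g \<in> U})"
    and "smooth_on (\<phi> ` {x\<in>U. g \<otimes> x \<otimes> inv g \<in> U}) (\<lambda>b. \<phi> (g \<otimes> param b \<otimes> inv g))"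
    and "origin \<in> \<phi> ` {x\<in>U. g \<otimes> x \<otimes> inv g \<in> U}"
  using smooth_map_coordinates[OF cover cover smooth_conj[OF assms] chart_in chart_in] assms one_in
  by (auto simp: param_def origin_def)

lemma Ad_has_derivative:
  assumes "g \<in> carrier G"
  shows "((\<lambda>b. \<phi> (g \<otimes> param b \<otimes> inv g)) has_derivative Ad g) (at origin)"
  unfolding Ad_def using smooth_on_has_derivative[OF conj_domain(2,3)[OF assms]] .

lemma linear_Ad: "g \<in> carrier G \<Longrightarrow> linear (Ad g)"
  using Ad_has_derivative has_derivative_linear by blast

lemma Ad_one: "Ad \<one> w = w"
proof -
  have "((\<lambda>b. b) has_derivative (\<lambda>w. w)) (at origin)" by (rule has_derivative_ident)
  then have "((\<lambda>b. \<phi> (\<one> \<otimes> param b \<otimes> inv \<one>)) has_derivative (\<lambda>w. w)) (at origin)"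
    by (rule has_derivative_transform_within_open[OF _ open_image_U origin_in]) simp
  from has_derivative_unique[OF Ad_has_derivative[OF one_closed] this] show ?thesis by metis
qed

lemma conj_mult:
  assumes "g \<in> carrier G" "h \<in> carrier G" "x \<in> carrier G"
  shows "(g \<otimes> h) \<otimes> x \<otimes> inv (g \<otimes> h) = g \<otimes> (h \<otimes> x \<otimes> inv h) \<otimes> inv g"
  using assms by (simp add: m_assoc inv_mult_group)

lemma Ad_mult:
  assumes g: "g \<in> carrier G" and h: "h \<in> carrier G"
  shows "Ad (g \<otimes> h) w = Ad g (Ad h w)"
proof -
  have eq: "\<phi> (h \<otimes> param origin \<otimes> inv h) = origin" using h by (simp add: origin_def[symmetric])
  have "((\<lambda>b. \<phi> (g \<otimes> param b \<otimes> inv g)) has_derivative Ad g) (at (\<phi> (h \<otimes> param origin \<otimes> inv h)))"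
    unfolding eq by (rule Ad_has_derivative[OF g])
  from diff_chain_at[OF Ad_has_derivative[OF h] this]
  have "((\<lambda>b. \<phi> (g \<otimes> param (\<phi> (h \<otimes> param b \<otimes> inv h)) \<otimes> inv g)) has_derivative (\<lambda>w. Ad g (Ad h w))) (at origin)"
    by (simp add: o_def)
  then have "((\<lambda>b. \<phi> ((g \<otimes> h) \<otimes> param b \<otimes> inv (g \<otimes> h))) has_derivative (\<lambda>w. Ad g (Ad h w))) (at origin)"
  proof (rule has_derivative_transform_within_open[OF _ conj_domain(1,3)[OF h]])
    fix b assume "b \<in> \<phi> ` {x\<in>U. h \<otimes> x \<otimes> inv h \<in> U}"
    then obtain x where "x \<in> U" "h \<otimes> x \<otimes> inv h \<in> U" "b = \<phi> x" by blast
    then show "\<phi> (g \<otimes> param (\<phi> (h \<otimes> param b \<otimes> inv h)) \<otimes> inv g) = \<phi> ((g \<otimes> h) \<otimes> param b \<otimes> inv (g \<otimes> h))"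
      using g h U_carrier conj_mult by simp
  qed
  from has_derivative_unique[OF Ad_has_derivative[OF m_closed[OF g h]] this] show ?thesis by metis
qed

lemma Ad_inv: "g \<in> carrier G \<Longrightarrow> Ad (inv g) (Ad g w) = w" "g \<in> carrier G \<Longrightarrow> Ad g (Ad (inv g) w) = w"
  using Ad_mult[of "inv g" g w] Ad_mult[of g "inv g" w] by (simp_all add: Ad_one)

lemma Ad_eq_0_iff: "g \<in> carrier G \<Longrightarrow> Ad g w = 0 \<longleftrightarrow> w = 0"
  using Ad_inv(1) linear_0[OF linear_Ad] by (metis inv_closed)

text \<open>\<open>Ad g\<close> is the partial derivative at \<open>origin\<close> of conjugation,
  seen as a jointly smooth map of both of its arguments, so it depends continuously on the
  coordinates of \<open>g\<close> in any chart of \<open>A\<close>.\<close>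

lemma Ad_param_continuous:
  assumes W: "(W, \<psi>) \<in> A"
  shows "continuous_on (\<psi> ` W) (\<lambda>a. Ad (inv_into W \<psi> a) w)"
proof -
  define F where "F p = \<phi> (inv_into W \<psi> (fst p) \<otimes> inv_into U \<phi> (snd p) \<otimes> inv (inv_into W \<psi> (fst p)))"
    for p :: "'e \<times> 'e"
  define \<Omega> where "\<Omega> = {(a, b). a \<in> \<psi> ` W \<and> b \<in> \<phi> ` U \<and>
    inv_into W \<psi> a \<otimes> inv_into U \<phi> b \<otimes> inv (inv_into W \<psi> a) \<in> U}"
  have F: "smooth_on \<Omega> F"
    using smooth_map_coordinates2(2)[OF cover cover cover smooth_conj2 W chart_in chart_in]
    unfolding \<Omega>_def F_def[abs_def] by (simp only: fst_conv snd_conv)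
  have chW: "is_chart T (W, \<psi>)" using cover W by (auto simp: chart_cover_def)
  have WG: "inv_into W \<psi> a \<in> carrier G" if "a \<in> \<psi> ` W" for a
    using inv_into_into[OF that] openin_subset[OF chart_open[OF chW]] topspace_eq by auto
  have mem: "(a, origin) \<in> \<Omega>" if "a \<in> \<psi> ` W" for a
    using that WG[OF that] one_in param_origin by (simp add: \<Omega>_def param_def[symmetric])
  have Ad_F: "Ad (inv_into W \<psi> a) w = frechet_derivative F (at (a, origin)) (0, w)" if "a \<in> \<psi> ` W" for a
  proof -
    have "((\<lambda>b. \<phi> (inv_into W \<psi> a \<otimes> param b \<otimes> inv (inv_into W \<psi> a))) has_derivative
        (\<lambda>w. frechet_derivative F (at (a, origin)) (0, w))) (at origin)"
    proof -
      have "((\<lambda>y. (a, y)) has_derivative (\<lambda>w. (0, w))) (at origin)"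
        by (auto intro!: derivative_eq_intros)
      from diff_chain_at[OF this smooth_on_has_derivative[OF F mem[OF that]]]
      show ?thesis by (simp add: o_def F_def param_def)
    qed
    from has_derivative_unique[OF Ad_has_derivative[OF WG[OF that]] this] show ?thesis by metis
  qed
  have "continuous_on \<Omega> (\<lambda>p. frechet_derivative F (at p) (0, w))"
    using smooth_on_imp_continuous_on[OF smooth_on_frechet_derivative[OF F]] .
  then have "continuous_on (\<psi> ` W) (\<lambda>a. frechet_derivative F (at (a, origin)) (0, w))"
    by (rule continuous_on_compose2[of _ _ _ "\<lambda>a. (a, origin)"]) (auto intro!: continuous_intros mem)
  then show ?thesis using Ad_F by (simp cong: continuous_on_cong)
qed

lemma openin_chart_vimage:
  assumes "is_chart T (W, \<psi>)" "open B" shows "openin T {x\<in>W. \<psi> x \<in> B}"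
proof -
  have "openin (subtopology T W) {x\<in>topspace (subtopology T W). \<psi> x \<in> B}"
    using openin_continuous_map_preimage[OF chart_continuous[OF assms(1)], of B] assms(2) by simp
  moreover have "topspace (subtopology T W) = W"
    using openin_subset[OF chart_open[OF assms(1)]] by (rule topspace_subtopology_subset)
  ultimately show ?thesis using openin_trans_full chart_open[OF assms(1)] by metis
qed

lemma openin_Ad_vimage:
  assumes "open B" shows "openin T {g \<in> carrier G. Ad g w \<in> B}"
proof (subst openin_subopen, intro ballI)
  fix g assume g: "g \<in> {g \<in> carrier G. Ad g w \<in> B}"
  obtain W \<psi> where W: "(W, \<psi>) \<in> A" "is_chart T (W, \<psi>)" "g \<in> W"
    using chart_coverD[OF cover, of g] g topspace_eq by auto
  have inj: "inv_into W \<psi> (\<psi> x) = x" if "x \<in> W" for x using chart_inj[OF W(2)] that by simp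
  have "open (\<psi> ` W)" by (rule chart_open_image[OF W(2) chart_open[OF W(2)]]) simp
  then have "open ((\<lambda>a. Ad (inv_into W \<psi> a) w) -` B \<inter> \<psi> ` W)"
    using Ad_param_continuous[OF W(1)] assms continuous_on_open_vimage by blast
  then have "openin T {x\<in>W. \<psi> x \<in> (\<lambda>a. Ad (inv_into W \<psi> a) w) -` B \<inter> \<psi> ` W}"
    by (rule openin_chart_vimage[OF W(2)])
  moreover have "{x\<in>W. \<psi> x \<in> (\<lambda>a. Ad (inv_into W \<psi> a) w) -` B \<inter> \<psi> ` W} = {x\<in>W. Ad x w \<in> B}"
  proof -
    have "\<psi> x \<in> (\<lambda>a. Ad (inv_into W \<psi> a) w) -` B \<inter> \<psi> ` W \<longleftrightarrow> Ad x w \<in> B" if "x \<in> W" for x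
      using inj[OF that] imageI[OF that, of \<psi>] by simp
    then show ?thesis by blast
  qed
  moreover have "W \<subseteq> carrier G" using openin_subset[OF chart_open[OF W(2)]] topspace_eq by auto
  ultimately show "\<exists>O'. openin T O' \<and> g \<in> O' \<and> O' \<subseteq> {g \<in> carrier G. Ad g w \<in> B}"
    using g W(3) by (intro exI[of _ "{x\<in>W. Ad x w \<in> B}"]) auto
qed

lemma openin_left_mult:
  assumes "openin T W" "g \<in> carrier G" shows "openin T {x \<in> carrier G. g \<otimes> x \<in> W}"
proof -
  have "smooth_map T A T A (\<lambda>x. g \<otimes> x)"
    using assms(2) topspace_eq by (intro smooth_mult_compose cover smooth_self smooth_map_const) auto
  then have "continuous_map T T (\<lambda>x. g \<otimes> x)" by (simp add: smooth_map_def)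
  from openin_continuous_map_preimage[OF this assms(1)] show ?thesis by (simp add: topspace_eq)
qed

lemma openin_right_mult:
  assumes "openin T W" "g \<in> carrier G" shows "openin T {x \<in> carrier G. x \<otimes> g \<in> W}"
proof -
  have "smooth_map T A T A (\<lambda>x. x \<otimes> g)"
    using assms(2) topspace_eq by (intro smooth_mult_compose cover smooth_self smooth_map_const) auto
  then have "continuous_map T T (\<lambda>x. x \<otimes> g)" by (simp add: smooth_map_def)
  from openin_continuous_map_preimage[OF this assms(1)] show ?thesis by (simp add: topspace_eq)
qed

end

section \<open>A one-dimensional subgroup in an adapted chart\<close>

locale lie_group_slice = lie_group_chart G T A U \<phi>
  for G :: "('g, 'b) monoid_scheme" (structure) and T :: "'g topology"
    and A :: "('g, 'e::euclidean_space) chart set" and U \<phi> +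
  fixes H :: "'g set" and l :: 'e
  assumes subgroup_H: "subgroup H G" and norm_l: "norm l = 1"
    and slice: "\<phi> ` (U \<inter> H) = \<phi> ` U \<inter> span {l}"
begin

lemma H_carrier: "H \<subseteq> carrier G"
  using subgroup_H subgroup.subset by blast

lemma one_H: "\<one> \<in> H"
  using subgroup_H subgroup.one_closed by blast

lemma l_l [simp]: "l \<bullet> l = 1"
  using norm_l by (simp add: dot_square_norm)

lemma l_nonzero: "l \<noteq> 0"
  using norm_l by auto

text \<open>The component transversal to the line: by the slice condition it vanishes, among the
  coordinates of points of \<open>U\<close>, exactly on those of points of \<open>H\<close>.\<close>

definition proj :: "'e \<Rightarrow> 'e" where "proj y = y - (y \<bullet> l) *\<^sub>R l"

lemma linear_proj: "linear proj"
  unfolding proj_def by (rule linearI) (auto simp: algebra_simps)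

lemma in_line_iff: "y \<in> span {l} \<longleftrightarrow> proj y = 0"
proof
  assume "y \<in> span {l}"
  then show "proj y = 0" by (auto simp: proj_def span_singleton)
next
  assume "proj y = 0"
  then have "y = (y \<bullet> l) *\<^sub>R l" by (simp add: proj_def)
  then show "y \<in> span {l}" by (metis rangeI span_singleton)
qed

lemma norm_proj_complement_le: "norm ((y \<bullet> l) *\<^sub>R l) \<le> norm y"
  using Cauchy_Schwarz_ineq2[of y l] norm_l by simp

lemma proj_inner [simp]: "proj y \<bullet> l = 0"
  by (simp add: proj_def inner_diff_left)

lemma norm_proj_le: "norm (proj y) \<le> norm y"
proof -
  have "norm (proj y) ^ 2 = (norm y)\<^sup>2 - (y \<bullet> l)\<^sup>2"
    unfolding power2_norm_eq_inner by (simp add: proj_def algebra_simps power2_eq_square inner_commute)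
  then have "norm (proj y) ^ 2 \<le> (norm y)\<^sup>2" by simp
  then show ?thesis by (rule power2_le_imp_le) simp
qed

lemma phi_in_line_iff: "x \<in> U \<Longrightarrow> \<phi> x \<in> span {l} \<longleftrightarrow> x \<in> H"
proof
  assume x: "x \<in> U" and "\<phi> x \<in> span {l}"
  then have "\<phi> x \<in> \<phi> ` (U \<inter> H)" using slice by blast
  then obtain y where "y \<in> U" "y \<in> H" "\<phi> x = \<phi> y" by auto
  then show "x \<in> H" using inj_onD[OF chart_inj[OF chart], of x y] x by simp
next
  assume "x \<in> U" "x \<in> H"
  then show "\<phi> x \<in> span {l}" using slice by blast
qed

lemma param_in_H_iff: "a \<in> \<phi> ` U \<Longrightarrow> param a \<in> H \<longleftrightarrow> a \<in> span {l}"
  using phi_in_line_iff[of "param a"] by simp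

text \<open>An adapted chart may send the identity to a point other than 0; this point still lies on
  the line, as the identity belongs to \<open>H\<close>.\<close>

lemma origin_line: "origin \<in> span {l}"
  unfolding origin_def using phi_in_line_iff[OF one_in] one_H by simp

lemma tangent_in_line:
  fixes c :: "real \<Rightarrow> 'e"
  assumes "(c has_vector_derivative X) (at t)" "open N" "t \<in> N" "\<And>s. s \<in> N \<Longrightarrow> c s \<in> span {l}"
  shows "X \<in> span {l}"
proof -
  have bl: "bounded_linear proj" using linear_proj linear_conv_bounded_linear by blast
  have "((\<lambda>s. proj (c s)) has_vector_derivative proj X) (at t)"
    by (rule bounded_linear.has_vector_derivative[OF bl assms(1)])
  moreover have "((\<lambda>s. proj (c s)) has_vector_derivative 0) (at t)"
    by (rule has_vector_derivative_transform_within_open[OF has_vector_derivative_const assms(2,3)])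
      (use assms(4) in \<open>simp add: in_line_iff\<close>)
  ultimately have "proj X = 0" by (rule vector_derivative_unique_at)
  then show ?thesis by (simp add: in_line_iff)
qed

text \<open>If \<open>Ad g\<close> preserves the line of \<open>H\<close>, then the component \<open>f\<close> transversal to \<open>H\<close> of the curve
  \<open>g (param (origin + t *\<^sub>R l)) g\<^sup>-\<^sup>1\<close> satisfies \<open>norm f' \<le> K * norm f\<close> and \<open>f 0 = 0\<close>, hence vanishes. This
  replaces the uniqueness of one-parameter subgroups.\<close>

lemma Ad_in_line_imp_local:
  assumes g: "g \<in> carrier G" and Adg: "Ad g l \<in> span {l}"
  shows "\<exists>\<delta>>0. \<forall>t. \<bar>t\<bar> \<le> \<delta> \<longrightarrow> origin + t *\<^sub>R l \<in> \<phi> ` U \<and> g \<otimes> param (origin + t *\<^sub>R l) \<otimes> inv g \<in> H"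
proof -
  define C where "C b = \<phi> (g \<otimes> param b \<otimes> inv g)" for b
  define M where "M p = \<phi> (param (fst p) \<otimes> param (snd p))" for p
  define R0 where "R0 p = \<phi> (inv (param (fst p)) \<otimes> param (snd p))" for p
  define \<Omega>C where "\<Omega>C = \<phi> ` {x\<in>U. g \<otimes> x \<otimes> inv g \<in> U}"
  define \<Omega>M where "\<Omega>M = {(a, b). a \<in> \<phi> ` U \<and> b \<in> \<phi> ` U \<and> param a \<otimes> param b \<in> U}"
  define \<Omega>R where "\<Omega>R = {(a, b). a \<in> \<phi> ` U \<and> b \<in> \<phi> ` U \<and> inv (param a) \<otimes> param b \<in> U}"
  have C: "open \<Omega>C" "smooth_on \<Omega>C C" "origin \<in> \<Omega>C"
    using conj_domain[OF g] by (simp_all add: \<Omega>C_def C_def[abs_def])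
  have M: "open \<Omega>M" "smooth_on \<Omega>M M"
    using smooth_map_coordinates2[OF cover cover cover smooth_mult2 chart_in chart_in chart_in]
    unfolding \<Omega>M_def M_def[abs_def] param_def by (simp_all only: fst_conv snd_conv)
  have R0: "open \<Omega>R" "smooth_on \<Omega>R R0"
    using smooth_map_coordinates2[OF cover cover cover smooth_div2 chart_in chart_in chart_in]
    unfolding \<Omega>R_def R0_def[abs_def] param_def by (simp_all only: fst_conv snd_conv)
  have C_in: "a \<in> \<phi> ` U" "C a \<in> \<phi> ` U" "param (C a) = g \<otimes> param a \<otimes> inv g" if "a \<in> \<Omega>C" for a
    using that by (auto simp: \<Omega>C_def C_def)
  have M_mem: "(a, origin) \<in> \<Omega>M" if "a \<in> \<phi> ` U" for a
    using that by (auto simp: \<Omega>M_def)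
  have R_mem: "(a, a) \<in> \<Omega>R" "R0 (a, a) = origin" if "a \<in> \<phi> ` U" for a
    using that one_in by (auto simp: \<Omega>R_def R0_def origin_def)
  have line_l: "l \<in> span {l}" by (rule span_base) simp
  \<comment> \<open>\<open>w (a t)\<close> is the logarithmic derivative of the curve at
    \<open>t\<close>: the velocity after left translation back to the identity.\<close>
  define w where "w a = frechet_derivative R0 (at (a, a)) (0, l)" for a
  define k where "k = Ad g l \<bullet> l"
  have Adg': "Ad g l = k *\<^sub>R l"
    using Adg by (simp add: in_line_iff proj_def k_def)
  \<comment> \<open>\<open>m b\<close> is the value at \<open>b\<close> of the left-invariant vector
    field generated by \<open>l\<close>, in coordinates.\<close>
  define m where "m a = frechet_derivative M (at (a, origin)) (0, l)" for a
  define a where "a t = origin + t *\<^sub>R l" for t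
  have a_line: "a t \<in> span {l}" for t
    unfolding a_def by (intro span_add origin_line span_scale line_l)
  have a_0: "a 0 = origin" by (simp add: a_def)
  have cont_a: "continuous_on UNIV a" unfolding a_def[abs_def] by (intro continuous_intros)
  have a_der: "(a has_vector_derivative l) (at t)" for t
    unfolding a_def[abs_def] by (auto intro!: derivative_eq_intros)
  have R_der: "((\<lambda>s. R0 (a t, a s)) has_vector_derivative w (a t)) (at t)" if "a t \<in> \<phi> ` U" for t
  proof -
    have "((\<lambda>y. R0 (a t, y)) has_derivative (\<lambda>v. frechet_derivative R0 (at (a t, a t)) (0, v))) (at (a t))"
      by (rule smooth_on_partial_derivative[OF R0(2) R_mem(1)[OF that]])
    from diff_chain_at[OF a_der[of t, unfolded has_vector_derivative_def] this]
    have "((\<lambda>s. R0 (a t, a s)) has_derivative (\<lambda>h. frechet_derivative R0 (at (a t, a t)) (0, h *\<^sub>R l))) (at t)"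
      by (simp add: o_def)
    moreover have "frechet_derivative R0 (at (a t, a t)) (0, h *\<^sub>R l) = h *\<^sub>R w (a t)" for h
      using linear_cmul[OF has_derivative_linear[OF smooth_on_has_derivative[OF R0(2) R_mem(1)[OF that]]], of h "(0, l)"]
      by (simp add: w_def)
    ultimately show ?thesis by (simp add: has_vector_derivative_def)
  qed
  have w_line: "w (a t) \<in> span {l}" if at: "a t \<in> \<phi> ` U" for t
  proof (rule tangent_in_line[OF R_der[OF at]])
    have "continuous_on UNIV (\<lambda>s. (a t, a s))" using cont_a by (intro continuous_intros) auto
    then show "open ((\<lambda>s. (a t, a s)) -` \<Omega>R)" by (rule open_vimage[OF R0(1)])
    show "t \<in> (\<lambda>s. (a t, a s)) -` \<Omega>R" using R_mem at by simp
    fix s assume "s \<in> (\<lambda>s. (a t, a s)) -` \<Omega>R"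
    then have s: "a s \<in> \<phi> ` U" "inv (param (a t)) \<otimes> param (a s) \<in> U" by (auto simp: \<Omega>R_def)
    have "param (a t) \<in> H" "param (a s) \<in> H" using param_in_H_iff at s a_line by blast+
    then have "inv (param (a t)) \<otimes> param (a s) \<in> H"
      using subgroup_H by (meson subgroup.m_closed subgroup.m_inv_closed)
    then show "R0 (a t, a s) \<in> span {l}" using phi_in_line_iff[OF s(2)] by (simp add: R0_def)
  qed
  \<comment> \<open>This field is tangent to \<open>H\<close> at points of \<open>H\<close>: for
    \<open>param b\<close> in \<open>H\<close> the curve
    \<open>param b \<otimes> param (a s)\<close> stays in \<open>H\<close>.\<close>
  have m0: "proj (m b) = 0" if b: "b \<in> \<phi> ` U" "b \<in> span {l}" for b
  proof -
    have 1: "((\<lambda>s. M (b, a s)) has_vector_derivative m b) (at 0)"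
    proof -
      have "((\<lambda>y. M (b, y)) has_derivative (\<lambda>v. frechet_derivative M (at (b, origin)) (0, v))) (at (a 0))"
        unfolding a_0 by (rule smooth_on_partial_derivative[OF M(2) M_mem[OF b(1)]])
      from diff_chain_at[OF a_der[of 0, unfolded has_vector_derivative_def] this]
      have "((\<lambda>s. M (b, a s)) has_derivative (\<lambda>h. frechet_derivative M (at (b, origin)) (0, h *\<^sub>R l))) (at 0)"
        by (simp add: o_def)
      moreover have "frechet_derivative M (at (b, origin)) (0, h *\<^sub>R l) = h *\<^sub>R m b" for h
        using linear_cmul[OF has_derivative_linear[OF smooth_on_has_derivative[OF M(2) M_mem[OF b(1)]]], of h "(0, l)"]
        by (simp add: m_def)
      ultimately show ?thesis by (simp add: has_vector_derivative_def)
    qed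
    have "m b \<in> span {l}"
    proof (rule tangent_in_line[OF 1])
      have "continuous_on UNIV (\<lambda>s. (b, a s))" using cont_a by (intro continuous_intros) auto
      then show "open ((\<lambda>s. (b, a s)) -` \<Omega>M)" by (rule open_vimage[OF M(1)])
      show "0 \<in> (\<lambda>s. (b, a s)) -` \<Omega>M" using M_mem b a_0 by simp
      fix s assume "s \<in> (\<lambda>s. (b, a s)) -` \<Omega>M"
      then have s: "a s \<in> \<phi> ` U" "param b \<otimes> param (a s) \<in> U" by (auto simp: \<Omega>M_def)
      have "param b \<in> H" "param (a s) \<in> H" using param_in_H_iff b s a_line by blast+
      then have "param b \<otimes> param (a s) \<in> H"
        using subgroup_H by (meson subgroup.m_closed)
      then show "M (b, a s) \<in> span {l}" using phi_in_line_iff[OF s(2)] by (simp add: M_def)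
    qed
    then show ?thesis by (simp add: in_line_iff)
  qed
  text \<open>The curve \<open>g (param (a t)) g\<^sup>-\<^sup>1\<close> is the product of its value at \<open>t\<close> with a curve through the
    identity whose velocity is a multiple of \<open>l\<close>.\<close>
  have C_der: "((\<lambda>s. C (a s)) has_vector_derivative ((w (a t) \<bullet> l) * k) *\<^sub>R m (C (a t))) (at t)"
    if at: "a t \<in> \<Omega>C" for t
  proof -
    have atU: "a t \<in> \<phi> ` U" using C_in(1)[OF at] .
    define q where "q s = C (R0 (a t, a s))" for s
    have q0: "R0 (a t, a t) = origin" using R_mem(2)[OF atU] .
    have wl: "w (a t) = (w (a t) \<bullet> l) *\<^sub>R l" using w_line[OF atU] by (simp add: in_line_iff proj_def)
    have Co: "C origin = origin" using g by (simp add: C_def origin_def[symmetric])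
    have "(C has_derivative Ad g) (at (R0 (a t, a t)))"
      unfolding q0 C_def[abs_def] by (rule Ad_has_derivative[OF g])
    from diff_chain_at[OF R_der[OF atU, unfolded has_vector_derivative_def] this]
    have "(q has_derivative (\<lambda>h. Ad g (h *\<^sub>R w (a t)))) (at t)"
      by (simp add: o_def q_def[abs_def])
    moreover have "Ad g (h *\<^sub>R w (a t)) = h *\<^sub>R ((w (a t) \<bullet> l) * k) *\<^sub>R l" for h
    proof -
      have "Ad g (h *\<^sub>R w (a t)) = Ad g ((h * (w (a t) \<bullet> l)) *\<^sub>R l)" using wl by (metis scaleR_scaleR)
      then show ?thesis by (simp add: linear_cmul[OF linear_Ad[OF g]] Adg' mult_ac)
    qed
    ultimately have q: "(q has_derivative (\<lambda>h. h *\<^sub>R ((w (a t) \<bullet> l) * k) *\<^sub>R l)) (at t)" by simp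
    have qt: "q t = origin" by (simp add: q_def q0 Co)
    have Mmem: "(C (a t), origin) \<in> \<Omega>M" by (rule M_mem[OF C_in(2)[OF at]])
    have "((\<lambda>y. M (C (a t), y)) has_derivative (\<lambda>v. frechet_derivative M (at (C (a t), origin)) (0, v))) (at (q t))"
      unfolding qt by (rule smooth_on_partial_derivative[OF M(2) Mmem])
    from diff_chain_at[OF q this]
    have "((\<lambda>s. M (C (a t), q s)) has_derivative
        (\<lambda>h. frechet_derivative M (at (C (a t), origin)) (0, h *\<^sub>R ((w (a t) \<bullet> l) * k) *\<^sub>R l))) (at t)"
      by (simp add: o_def)
    moreover have "frechet_derivative M (at (C (a t), origin)) (0, h *\<^sub>R r *\<^sub>R l) = h *\<^sub>R r *\<^sub>R m (C (a t))" for h r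
      using linear_cmul[OF has_derivative_linear[OF smooth_on_has_derivative[OF M(2) Mmem]], of "h * r" "(0, l)"]
      by (simp add: m_def)
    ultimately have d: "((\<lambda>s. M (C (a t), q s)) has_vector_derivative ((w (a t) \<bullet> l) * k) *\<^sub>R m (C (a t))) (at t)"
      by (simp add: has_vector_derivative_def)
    \<comment> \<open>The factorisation near \<open>t\<close>: \<open>g x g^-1\<close> times
      \<open>g (x^-1 y) g^-1\<close> is \<open>g y g^-1\<close>, with \<open>x\<close> and
      \<open>y\<close> the points of the curve at \<open>t\<close> and \<open>s\<close>. On
      \<open>N\<close> the coordinate formulas for the factors are valid.\<close>
    define N where "N = (\<lambda>s. (a t, a s)) -` {p\<in>\<Omega>R. R0 p \<in> \<Omega>C}"
    have "open {p\<in>\<Omega>R. R0 p \<in> \<Omega>C}"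
      using continuous_open_preimage[OF smooth_on_imp_continuous_on[OF R0(2)] R0(1) C(1)]
      by (simp add: vimage_def Int_def)
    moreover have "continuous_on UNIV (\<lambda>s. (a t, a s))" using cont_a by (intro continuous_intros) auto
    ultimately have oN: "open N" unfolding N_def by (rule open_vimage)
    have tN: "t \<in> N" using R_mem[OF atU] C(3) by (simp add: N_def)
    have "M (C (a t), q s) = C (a s)" if s: "s \<in> N" for s
    proof -
      have as: "a s \<in> \<phi> ` U" "inv (param (a t)) \<otimes> param (a s) \<in> U" "R0 (a t, a s) \<in> \<Omega>C"
        using s by (auto simp: N_def \<Omega>R_def)
      have "param (q s) = g \<otimes> (inv (param (a t)) \<otimes> param (a s)) \<otimes> inv g"
        using C_in(3)[OF as(3)] as(2) by (simp add: q_def R0_def)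
      moreover have "param (C (a t)) = g \<otimes> param (a t) \<otimes> inv g" using C_in(3)[OF at] .
      moreover have "(g \<otimes> x \<otimes> inv g) \<otimes> (g \<otimes> (inv x \<otimes> y) \<otimes> inv g) = g \<otimes> y \<otimes> inv g"
        if "x \<in> carrier G" "y \<in> carrier G" for x y
      proof -
        have "inv u \<otimes> (u \<otimes> v) = v" "u \<otimes> (inv u \<otimes> v) = v"
          if "u \<in> carrier G" "v \<in> carrier G" for u v
          using that by (simp_all add: m_assoc[symmetric])
        then show ?thesis using g that by (simp add: m_assoc)
      qed
      ultimately show ?thesis using atU as(1) by (simp add: M_def C_def)
    qed
    then show ?thesis by (rule has_vector_derivative_transform_within_open[OF d oN tN])
  qed
  have proj_m: "smooth_on (\<phi> ` U) (\<lambda>b. proj (m b))"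
  proof -
    have 1: "smooth_on \<Omega>M (\<lambda>p. frechet_derivative M (at p) (0, l))"
      by (rule smooth_on_frechet_derivative[OF M(2)])
    have 2: "smooth_on (\<phi> ` U) (\<lambda>b. (b, origin))"
      by (intro smooth_on_Pair[OF open_image_U] smooth_on_const smooth_on_bounded_linear bounded_linear_ident)
    have 3: "smooth_on (\<phi> ` U) m"
      unfolding m_def[abs_def] by (rule smooth_on_compose[OF open_image_U 2 1]) (rule M_mem)
    have 4: "smooth_on UNIV proj"
      using linear_proj linear_conv_bounded_linear smooth_on_bounded_linear by blast
    show ?thesis by (rule smooth_on_compose[OF open_image_U 3 4]) simp
  qed
  obtain \<epsilon> K where \<epsilon>: "\<epsilon> > 0" "cball origin \<epsilon> \<subseteq> \<phi> ` U"
    "\<And>x y. x \<in> cball origin \<epsilon> \<Longrightarrow> y \<in> cball origin \<epsilon> \<Longrightarrow> norm (proj (m x) - proj (m y)) \<le> K * norm (x - y)"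
    using smooth_on_locally_lipschitz[OF open_image_U proj_m origin_in] by blast
  \<comment> \<open>Comparison with the foot \<open>b'\<close> of \<open>b\<close> on the line,
    where the transversal part of \<open>m\<close> vanishes: the Lipschitz bound gives a multiple of
    the distance from \<open>b\<close> to the line. The foot stays in the ball because
    \<open>origin\<close> lies on the line.\<close>
  have m_le: "norm (proj (m b)) \<le> K * norm (proj b)" if b: "b \<in> cball origin \<epsilon>" for b
  proof -
    define b' where "b' = b - proj b"
    have "b' - origin = ((b - origin) \<bullet> l) *\<^sub>R l"
      using origin_line by (simp add: b'_def in_line_iff proj_def algebra_simps)
    then have "norm (b' - origin) \<le> norm (b - origin)" using norm_proj_complement_le by metis
    then have b': "b' \<in> cball origin \<epsilon>" using b by (simp add: dist_norm norm_minus_commute)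
    have "b' \<in> span {l}" unfolding b'_def proj_def by (simp add: span_scale line_l)
    then have "proj (m b') = 0" using m0 b' \<epsilon>(2) by blast
    then show ?thesis using \<epsilon>(3)[OF b b'] by (simp add: b'_def)
  qed
  define N where "N = a -` {b\<in>\<Omega>C. C b \<in> ball origin \<epsilon>}"
  have "open {b\<in>\<Omega>C. C b \<in> ball origin \<epsilon>}"
    using continuous_open_preimage[OF smooth_on_imp_continuous_on[OF C(2)] C(1) open_ball]
    by (simp add: vimage_def Int_def)
  then have "open N" unfolding N_def by (rule open_vimage[OF _ cont_a])
  moreover have "0 \<in> N" using C(3) \<epsilon>(1) g by (simp add: N_def a_0 C_def origin_def[symmetric])
  ultimately obtain r where r: "r > 0" "cball 0 r \<subseteq> N" using open_contains_cball by blast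
  have rN: "a t \<in> \<Omega>C" "C (a t) \<in> cball origin \<epsilon>" if "\<bar>t\<bar> \<le> r" for t
    using r(2) that by (auto simp: N_def subset_iff)
  have "continuous_on (cball 0 r) (\<lambda>t. w (a t) \<bullet> l)"
  proof -
    have "continuous_on \<Omega>R (\<lambda>p. frechet_derivative R0 (at p) (0, l))"
      by (rule smooth_on_imp_continuous_on[OF smooth_on_frechet_derivative[OF R0(2)]])
    moreover have "continuous_on (cball 0 r) (\<lambda>t. (a t, a t))"
      by (intro continuous_on_Pair continuous_on_subset[OF cont_a]) auto
    moreover have "(a t, a t) \<in> \<Omega>R" if "t \<in> cball 0 r" for t
      using R_mem C_in rN that by simp
    ultimately have "continuous_on (cball 0 r) (\<lambda>t. w (a t))"
      unfolding w_def using continuous_on_compose2 by blast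
    then show ?thesis by (intro continuous_intros)
  qed
  then have "bounded ((\<lambda>t. w (a t) \<bullet> l) ` cball 0 r)"
    by (intro compact_imp_bounded compact_continuous_image compact_cball)
  then obtain B where "\<forall>t\<in>cball 0 r. \<bar>w (a t) \<bullet> l\<bar> \<le> B"
    by (auto simp: bounded_iff)
  then have B: "\<bar>w (a t) \<bullet> l\<bar> \<le> B" if "\<bar>t\<bar> \<le> r" for t
    using that by simp
  have B0: "0 \<le> B" using B[of 0] r(1) by simp
  define f where "f t = proj (C (a t))" for t
  have bl: "bounded_linear proj" using linear_proj linear_conv_bounded_linear by blast
  have "\<exists>\<delta>>0. \<forall>t. \<bar>t\<bar> \<le> \<delta> \<longrightarrow> f t = 0"
  proof (rule vanishing_of_derivative_bound[OF r(1)])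
    fix t assume t: "\<bar>t\<bar> \<le> r"
    show "(f has_vector_derivative ((w (a t) \<bullet> l) * k) *\<^sub>R proj (m (C (a t)))) (at t)"
      using bounded_linear.has_vector_derivative[OF bl C_der[OF rN(1)[OF t]]]
      by (simp add: f_def[abs_def] linear_cmul[OF linear_proj])
    have "\<bar>(w (a t) \<bullet> l) * k\<bar> \<le> B * \<bar>k\<bar>" using B[OF t] by (simp add: abs_mult mult_right_mono)
    then have "norm (((w (a t) \<bullet> l) * k) *\<^sub>R proj (m (C (a t)))) \<le> (B * \<bar>k\<bar>) * (K * norm (f t))"
      unfolding norm_scaleR f_def by (intro mult_mono m_le rN(2)[OF t]) (use B0 in auto)
    then show "norm (((w (a t) \<bullet> l) * k) *\<^sub>R proj (m (C (a t)))) \<le> (B * \<bar>k\<bar> * K) * norm (f t)"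
      by (simp add: mult_ac)
  next
    have "C (a 0) = origin" using g by (simp add: a_0 C_def origin_def[symmetric])
    then show "f 0 = 0" using origin_line by (simp add: f_def in_line_iff)
  qed
  then obtain \<delta> where \<delta>: "\<delta> > 0" "\<And>t. \<bar>t\<bar> \<le> \<delta> \<Longrightarrow> f t = 0" by blast
  show ?thesis
  proof (intro exI[of _ "min \<delta> r"] conjI allI impI)
    show "min \<delta> r > 0" using \<delta> r by simp
    fix t assume t: "\<bar>t\<bar> \<le> min \<delta> r"
    have at: "a t \<in> \<Omega>C" using rN t by simp
    show "origin + t *\<^sub>R l \<in> \<phi> ` U" using C_in(1)[OF at] by (simp add: a_def)
    have "C (a t) \<in> span {l}" using \<delta>(2)[of t] t by (simp add: f_def in_line_iff)
    then have "param (C (a t)) \<in> H" using param_in_H_iff C_in(2)[OF at] by blast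
    then show "g \<otimes> param (origin + t *\<^sub>R l) \<otimes> inv g \<in> H" using C_in(3)[OF at] by (simp add: a_def)
  qed
qed

end

section \<open>From an invariant line to the normalizer and the open cone over the orbit\<close>

lemma (in group) conjugate_eq_image:
  "conjugate G g K = (\<lambda>x. g \<otimes> x \<otimes> inv g) ` K"
  unfolding l_coset_def r_coset_def by auto

locale lie_group_rigid = lie_group_slice G T A U \<phi> H l
  for G :: "('g, 'b) monoid_scheme" (structure) and T :: "'g topology"
    and A :: "('g, 'e::euclidean_space) chart set" and U \<phi> H l +
  assumes closed_H: "closedin T H" and connected_H: "connectedin T H"
    and finite_index: "finite (carrier ((G\<lparr>carrier := normalizer G H\<rparr>) Mod H))"
begin

text \<open>The elements of \<open>H\<close> whose conjugate by \<open>g\<close> stays in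
  \<open>H\<close> form a subgroup \<open>K\<close>. By the local statement it contains a
  neighbourhood of the identity in \<open>H\<close>, so it is open in \<open>H\<close>, and a
  connected group has no proper open subgroup.\<close>

lemma Ad_in_line_imp_subset:
  assumes g: "g \<in> carrier G" and Adg: "Ad g l \<in> span {l}" and x: "x \<in> H"
  shows "g \<otimes> x \<otimes> inv g \<in> H"
proof -
  obtain \<delta> where \<delta>: "\<delta> > 0" "\<And>t. \<bar>t\<bar> \<le> \<delta> \<Longrightarrow> g \<otimes> param (origin + t *\<^sub>R l) \<otimes> inv g \<in> H"
    using Ad_in_line_imp_local[OF g Adg] by blast
  define K where "K = {x\<in>H. g \<otimes> x \<otimes> inv g \<in> H}"
  define W where "W = {x\<in>U. \<phi> x \<in> ball origin \<delta>}"
  have W: "openin T W" unfolding W_def by (rule openin_chart_vimage[OF chart open_ball])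
  have oneW: "\<one> \<in> W" using one_in \<delta>(1) by (simp add: W_def origin_def)
  have WK: "y \<in> K" if y: "y \<in> W" "y \<in> H" for y
  proof -
    have yU: "y \<in> U" using y by (simp add: W_def)
    have "\<phi> y - origin \<in> span {l}"
      using phi_in_line_iff[OF yU] y(2) origin_line span_diff by blast
    then obtain t where t: "\<phi> y - origin = t *\<^sub>R l" by (auto simp: span_singleton)
    have "norm (\<phi> y - origin) < \<delta>" using y(1) by (simp add: W_def dist_norm norm_minus_commute)
    then have "\<bar>t\<bar> \<le> \<delta>" unfolding t using norm_l by simp
    moreover have "origin + t *\<^sub>R l = \<phi> y" using t by (simp add: algebra_simps)
    ultimately have "g \<otimes> y \<otimes> inv g \<in> H" using \<delta>(2)[of t] yU by simp
    then show ?thesis using y(2) by (simp add: K_def)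
  qed
  have KH: "K \<subseteq> H" by (auto simp: K_def)
  have HG: "y \<in> carrier G" if "y \<in> H" for y using that H_carrier by blast
  have Hm: "y \<otimes> z \<in> H" if "y \<in> H" "z \<in> H" for y z
    using that subgroup_H by (rule_tac subgroup.m_closed)
  have Hi: "inv y \<in> H" if "y \<in> H" for y
    using that subgroup_H by (rule_tac subgroup.m_inv_closed)
  have cancel: "inv u \<otimes> (u \<otimes> v) = v" "u \<otimes> (inv u \<otimes> v) = v"
    if "u \<in> carrier G" "v \<in> carrier G" for u v
    using that by (simp_all add: m_assoc[symmetric])
  have Km: "y \<otimes> z \<in> K" if "y \<in> K" "z \<in> K" for y z
  proof -
    have yz: "y \<in> carrier G" "z \<in> carrier G" using that KH HG by auto
    have "g \<otimes> (y \<otimes> z) \<otimes> inv g = (g \<otimes> y \<otimes> inv g) \<otimes> (g \<otimes> z \<otimes> inv g)"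
      using g yz by (simp add: m_assoc cancel)
    then show ?thesis using that Hm by (auto simp: K_def)
  qed
  have Ki: "inv y \<in> K" if "y \<in> K" for y
  proof -
    have yz: "y \<in> carrier G" using that KH HG by auto
    have "g \<otimes> inv y \<otimes> inv g = inv (g \<otimes> y \<otimes> inv g)"
      using g yz by (simp add: m_assoc inv_mult_group)
    then show ?thesis using that Hi by (auto simp: K_def)
  qed
  \<comment> \<open>The union of the left translates of \<open>W\<close> by elements of
    \<open>S\<close>. For \<open>K\<close> and for its complement in \<open>H\<close> this yields
    open sets of the whole group that would separate \<open>H\<close>.\<close>
  define E where "E S = (\<Union>x\<in>S. {y \<in> carrier G. inv x \<otimes> y \<in> W})" for S
  have openE: "openin T (E S)" if "S \<subseteq> H" for S
    unfolding E_def using that HG by (intro openin_Union) (auto intro!: openin_left_mult[OF W])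
  have SE: "S \<subseteq> E S" if "S \<subseteq> H" for S
  proof
    fix y assume y: "y \<in> S"
    then have "y \<in> carrier G" using that HG by blast
    then have "inv y \<otimes> y \<in> W" using oneW by simp
    then show "y \<in> E S" unfolding E_def using y \<open>y \<in> carrier G\<close> by blast
  qed
  have "K = H"
  proof (rule ccontr)
    assume "K \<noteq> H"
    show False
    proof (rule connectedinD[OF connected_H openE[OF KH] openE[of "H - K"]])
      show "H \<subseteq> E K \<union> E (H - K)" using SE[OF KH] SE[of "H - K"] by blast
      have "\<one> \<in> K" using WK[OF oneW one_H] .
      then show "E K \<inter> H \<noteq> {}" using SE[OF KH] one_H by blast
      show "E (H - K) \<inter> H \<noteq> {}" using SE[of "H - K"] \<open>K \<noteq> H\<close> KH by blast
      \<comment> \<open>If \<open>y = u w = v w'\<close> with \<open>u\<close> in \<open>K\<close>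
        and \<open>v\<close>, \<open>y\<close> in \<open>H\<close>, then \<open>w\<close> and
        \<open>w'\<close> lie in \<open>W\<close> and in \<open>H\<close>, hence in
        \<open>K\<close>, and so does \<open>v\<close>.\<close>
      show "E K \<inter> E (H - K) \<inter> H = {}"
      proof (rule ccontr)
        assume "E K \<inter> E (H - K) \<inter> H \<noteq> {}"
        then obtain y u v where y: "y \<in> H" "u \<in> K" "v \<in> H" "v \<notin> K" "inv u \<otimes> y \<in> W" "inv v \<otimes> y \<in> W"
          by (auto simp: E_def)
        have uH: "u \<in> H" using y(2) KH by blast
        have "inv u \<otimes> y \<in> K" using WK[OF y(5)] Hm Hi uH y(1) by blast
        from Km[OF y(2) this] have yK: "y \<in> K" using cancel(2)[of u y] HG uH y(1) by simp
        have "inv v \<otimes> y \<in> K" using WK[OF y(6)] Hm Hi y(1,3) by blast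
        from Km[OF yK Ki[OF this]] have "y \<otimes> inv (inv v \<otimes> y) \<in> K" .
        moreover have "y \<otimes> inv (inv v \<otimes> y) = v"
          using HG[OF y(1)] HG[OF y(3)] cancel(2)[of y v] by (simp add: inv_mult_group)
        ultimately show False using y(4) by simp
      qed
    qed auto
  qed
  then show ?thesis using x by (auto simp: K_def)
qed

text \<open>\<open>Ad g\<close> acts on the line by a non-zero factor because it is injective, so
  \<open>inv g\<close> preserves the line as well; the inclusions for \<open>g\<close> and for
  \<open>inv g\<close> together give equality.\<close>

lemma Ad_in_line_imp_normalizer:
  assumes g: "g \<in> carrier G" and Adg: "Ad g l \<in> span {l}"
  shows "g \<in> normalizer G H"
proof -
  obtain k where k: "Ad g l = k *\<^sub>R l" using Adg by (auto simp: span_singleton)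
  have "k \<noteq> 0"
  proof
    assume "k = 0"
    then have "Ad g l = 0" using k by simp
    then show False using Ad_eq_0_iff[OF g] l_nonzero by blast
  qed
  have "l = Ad (inv g) (k *\<^sub>R l)" using Ad_inv(1)[OF g, of l] unfolding k by (rule sym)
  also have "\<dots> = k *\<^sub>R Ad (inv g) l" by (rule linear_cmul[OF linear_Ad[OF inv_closed[OF g]]])
  finally have "(1 / k) *\<^sub>R l = (1 / k) *\<^sub>R (k *\<^sub>R Ad (inv g) l)" by (rule arg_cong)
  then have "Ad (inv g) l = (1 / k) *\<^sub>R l" using \<open>k \<noteq> 0\<close> by simp
  then have Adg': "Ad (inv g) l \<in> span {l}" by (simp add: span_scale span_base)
  have "conjugate G g H = H"
  proof
    show "conjugate G g H \<subseteq> H"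
      unfolding conjugate_eq_image using Ad_in_line_imp_subset[OF g Adg] by blast
    show "H \<subseteq> conjugate G g H"
    proof
      fix x assume x: "x \<in> H"
      then have xG: "x \<in> carrier G" using H_carrier by blast
      have "inv g \<otimes> x \<otimes> g \<in> H" using Ad_in_line_imp_subset[OF inv_closed[OF g] Adg' x] g by simp
      moreover have "g \<otimes> (inv g \<otimes> x \<otimes> g) \<otimes> inv g = x"
        using g xG by (simp add: m_assoc[symmetric]) (simp add: m_assoc)
      ultimately show "x \<in> conjugate G g H" unfolding conjugate_eq_image by (metis imageI)
    qed
  qed
  moreover have "conjugate G \<one> H = H" using H_carrier by (simp add: lcos_mult_one coset_mult_one)
  ultimately show ?thesis using conjugate_eq_iff[OF g one_closed H_carrier] g by simp
qed

text \<open>The normalizer is a finite union of closed cosets of \<open>H\<close>; removing those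
  other than \<open>H\<close> from the group leaves an open neighbourhood of the identity.\<close>

lemma normalizer_near_one:
  "\<exists>W. openin T W \<and> \<one> \<in> W \<and> W \<inter> normalizer G H \<subseteq> H"
proof -
  have NG: "normalizer G H \<subseteq> carrier G" by (auto simp: normalizer_def stabilizer_def)
  define F where "F = (\<lambda>n. H #> n) ` normalizer G H"
  have "F = carrier ((G\<lparr>carrier := normalizer G H\<rparr>) Mod H)"
    by (auto simp: F_def FactGroup_def RCOSETS_def r_coset_def)
  then have finF: "finite F" using finite_index by simp
  have mem: "x \<in> H #> n \<longleftrightarrow> x \<in> carrier G \<and> x \<otimes> inv n \<in> H" if n: "n \<in> carrier G" for n x
  proof
    assume "x \<in> H #> n"
    then obtain h where h: "h \<in> H" "x = h \<otimes> n" by (auto simp: r_coset_def)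
    then show "x \<in> carrier G \<and> x \<otimes> inv n \<in> H"
      using n H_carrier by (auto simp: m_assoc subset_iff)
  next
    assume a: "x \<in> carrier G \<and> x \<otimes> inv n \<in> H"
    then have "x = (x \<otimes> inv n) \<otimes> n" using n by (simp add: m_assoc)
    then show "x \<in> H #> n" using a unfolding r_coset_def by blast
  qed
  have closed: "closedin T c" if c: "c \<in> F" for c
  proof -
    obtain n where n: "c = H #> n" "n \<in> carrier G" using c NG by (auto simp: F_def)
    have "openin T {x \<in> carrier G. x \<otimes> inv n \<in> topspace T - H}"
      using closed_H n(2) by (intro openin_right_mult) (auto simp: closedin_def)
    moreover have "{x \<in> carrier G. x \<otimes> inv n \<in> topspace T - H} = topspace T - c"
      using mem[OF n(2)] n by (auto simp: topspace_eq)
    moreover have "c \<subseteq> topspace T" using mem[OF n(2)] n by (auto simp: topspace_eq)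
    ultimately show ?thesis by (simp add: closedin_def)
  qed
  define W where "W = topspace T - \<Union>(F - {H})"
  have "openin T W"
    unfolding W_def using finF closed by (intro openin_diff openin_topspace closedin_Union) auto
  moreover have "\<one> \<in> W"
  proof -
    have "c = H" if c: "c \<in> F" "\<one> \<in> c" for c
    proof -
      obtain n where n: "c = H #> n" "n \<in> carrier G" using c NG by (auto simp: F_def)
      then have "inv n \<in> H" using c(2) mem[OF n(2), of \<one>] by simp
      then have "n \<in> H" using subgroup.m_inv_closed[OF subgroup_H] n(2) by fastforce
      then show ?thesis using n(1) coset_join2[OF n(2) subgroup_H] by simp
    qed
    then show ?thesis using topspace_eq by (auto simp: W_def)
  qed
  moreover have "W \<inter> normalizer G H \<subseteq> H"
  proof
    fix x assume x: "x \<in> W \<inter> normalizer G H"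
    then have xG: "x \<in> carrier G" using NG by blast
    have "H #> x \<in> F" using x by (auto simp: F_def)
    moreover have xx: "x \<in> H #> x" using mem[OF xG] xG one_H by simp
    ultimately have "H #> x = H" using x by (auto simp: W_def)
    then show "x \<in> H" using xx by simp
  qed
  ultimately show ?thesis by blast
qed

text \<open>If two points of a small slice, with coordinates \<open>y\<close> and \<open>z\<close>,
  lie in the same coset of the normalizer, their quotient lies in \<open>H\<close>, so its
  coordinates lie on the line. But these differ from \<open>origin + (z - y)\<close> by at most half
  of \<open>norm (z - y)\<close>, and \<open>z - y\<close> is orthogonal to the line, which leaves
  only \<open>z = y\<close>.\<close>

lemma slice_injective:
  "\<exists>\<epsilon>>0. ball origin \<epsilon> \<subseteq> \<phi> ` U \<and> (\<forall>y\<in>ball origin \<epsilon>. \<forall>z\<in>ball origin \<epsilon>.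
     (z - y) \<bullet> l = 0 \<longrightarrow> inv (param y) \<otimes> param z \<in> normalizer G H \<longrightarrow> z = y)"
proof -
  define R0 where "R0 p = \<phi> (inv (param (fst p)) \<otimes> param (snd p))" for p
  define \<Omega> where "\<Omega> = {(a, b). a \<in> \<phi> ` U \<and> b \<in> \<phi> ` U \<and> inv (param a) \<otimes> param b \<in> U}"
  have R0: "open \<Omega>" "smooth_on \<Omega> R0"
    using smooth_map_coordinates2[OF cover cover cover smooth_div2 chart_in chart_in chart_in]
    unfolding \<Omega>_def R0_def[abs_def] param_def by (simp_all only: fst_conv snd_conv)
  obtain W where W: "openin T W" "\<one> \<in> W" "W \<inter> normalizer G H \<subseteq> H" using normalizer_near_one by blast
  have "open (\<phi> ` (U \<inter> W))"
    using W(1) chart_open[OF chart] by (intro chart_open_image[OF chart]) auto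
  then have o: "open {p\<in>\<Omega>. R0 p \<in> \<phi> ` (U \<inter> W)}"
    using continuous_open_preimage[OF smooth_on_imp_continuous_on[OF R0(2)] R0(1)]
    by (simp add: vimage_def Int_def)
  have oo: "(origin, origin) \<in> {p\<in>\<Omega>. R0 p \<in> \<phi> ` (U \<inter> W)}"
    using one_in W(2) by (auto simp: \<Omega>_def R0_def)
  have "R0 (origin, b) = b" if "b \<in> \<phi> ` U" for b using that by (simp add: R0_def)
  from smooth_on_near_translation[OF o oo smooth_on_subset[OF R0(2)] open_image_U origin_in this]
  obtain \<epsilon> where \<epsilon>: "\<epsilon> > 0" "ball origin \<epsilon> \<times> ball origin \<epsilon> \<subseteq> {p\<in>\<Omega>. R0 p \<in> \<phi> ` (U \<inter> W)}"
    "\<And>y z. y \<in> ball origin \<epsilon> \<Longrightarrow> z \<in> ball origin \<epsilon> \<Longrightarrow>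
       norm (R0 (y, z) - R0 (y, y) - (z - y)) \<le> (1 / 2) * norm (z - y)"
    by auto
  have "z = y" if y: "y \<in> ball origin \<epsilon>" and z: "z \<in> ball origin \<epsilon>" and perp: "(z - y) \<bullet> l = 0"
    and N: "inv (param y) \<otimes> param z \<in> normalizer G H" for y z
  proof -
    have p: "(y, z) \<in> \<Omega>" "R0 (y, z) \<in> \<phi> ` (U \<inter> W)" using y z \<epsilon>(2) by blast+
    have yU: "y \<in> \<phi> ` U" and d: "inv (param y) \<otimes> param z \<in> U" using p(1) by (auto simp: \<Omega>_def)
    obtain x where "x \<in> U" "x \<in> W" "R0 (y, z) = \<phi> x" using p(2) by blast
    then have "inv (param y) \<otimes> param z \<in> W"
      using inj_onD[OF chart_inj[OF chart], of _ x] d by (auto simp: R0_def)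
    then have "inv (param y) \<otimes> param z \<in> H" using N W(3) by blast
    then have "R0 (y, z) \<in> span {l}" using phi_in_line_iff[OF d] by (simp add: R0_def)
    then have 1: "proj (R0 (y, z)) = 0" by (simp add: in_line_iff)
    have "R0 (y, y) = origin" using yU by (simp add: R0_def origin_def)
    then have 2: "proj (R0 (y, y)) = 0" using origin_line by (simp add: in_line_iff)
    have 3: "proj (z - y) = z - y" using perp by (simp add: proj_def)
    have "z - y = - proj (R0 (y, z) - R0 (y, y) - (z - y))"
      by (simp add: linear_diff[OF linear_proj] 1 2) (use 3 linear_diff[OF linear_proj] in metis)
    then have "norm (z - y) \<le> norm (R0 (y, z) - R0 (y, y) - (z - y))"
      using norm_proj_le by (metis norm_minus_cancel)
    also have "\<dots> \<le> (1 / 2) * norm (z - y)" by (rule \<epsilon>(3)[OF y z])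
    finally show ?thesis by simp
  qed
  moreover have "ball origin \<epsilon> \<subseteq> \<phi> ` U" using \<epsilon>(1,2) by (auto simp: \<Omega>_def)
  ultimately show ?thesis using \<epsilon>(1) by blast
qed

text \<open>By invariance of domain an injective continuous parametrisation of the cone over the orbit of
  the line through \<open>l\<close> has an open image.\<close>

lemma orbit_cone_open_near_one:
  assumes W: "openin T W" "\<one> \<in> W"
  shows "\<exists>B. open B \<and> B \<noteq> {} \<and> (\<forall>y\<in>B. \<exists>g\<in>W. \<exists>r. r \<noteq> 0 \<and> y = r *\<^sub>R Ad g l)"
proof -
  obtain \<epsilon>1 where \<epsilon>1: "\<epsilon>1 > 0" "ball origin \<epsilon>1 \<subseteq> \<phi> ` U"
    "\<And>y z. y \<in> ball origin \<epsilon>1 \<Longrightarrow> z \<in> ball origin \<epsilon>1 \<Longrightarrow> (z - y) \<bullet> l = 0 \<Longrightarrow>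
       inv (param y) \<otimes> param z \<in> normalizer G H \<Longrightarrow> z = y"
    using slice_injective by blast
  have "open (\<phi> ` (U \<inter> W))"
    using W(1) chart_open[OF chart] by (intro chart_open_image[OF chart]) auto
  moreover have "origin \<in> \<phi> ` (U \<inter> W)" using one_in W(2) by (simp add: origin_def)
  ultimately obtain \<epsilon>2 where \<epsilon>2: "\<epsilon>2 > 0" "ball origin \<epsilon>2 \<subseteq> \<phi> ` (U \<inter> W)"
    using open_contains_ball by blast
  define \<epsilon> where "\<epsilon> = min \<epsilon>1 \<epsilon>2"
  have \<epsilon>: "\<epsilon> > 0" using \<epsilon>1 \<epsilon>2 by (simp add: \<epsilon>_def)
  \<comment> \<open>The parameters form an open set of the model space: the component orthogonal to
    \<open>l\<close> names a point of the slice, the component along \<open>l\<close> is the scale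
    factor, kept positive.\<close>
  define S where "S = {x. proj x \<in> ball 0 \<epsilon> \<and> x \<bullet> l > 0}"
  define P where "P x = param (origin + proj x)" for x
  define \<Phi> where "\<Phi> x = (x \<bullet> l) *\<^sub>R Ad (P x) l" for x
  have bl: "bounded_linear proj" using linear_proj linear_conv_bounded_linear by blast
  have cp: "continuous_on X proj" for X using bl by (rule linear_continuous_on)
  have in_ball: "origin + proj x \<in> ball origin \<epsilon>1" "origin + proj x \<in> ball origin \<epsilon>2" if "x \<in> S" for x
    using that by (auto simp: S_def \<epsilon>_def dist_norm)
  have in_U: "origin + proj x \<in> \<phi> ` U" if "x \<in> S" for x using in_ball[OF that] \<epsilon>1(2) by blast
  have P_W: "P x \<in> W" if "x \<in> S" for x
    using in_ball(2)[OF that] \<epsilon>2(2) by (auto simp: P_def)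
  have P_G: "P x \<in> carrier G" if "x \<in> S" for x using in_U[OF that] by (simp add: P_def)
  have openS: "open S"
  proof -
    have "S = proj -` ball 0 \<epsilon> \<inter> (\<lambda>x. x \<bullet> l) -` {0<..}" by (auto simp: S_def)
    then show ?thesis by (auto intro!: open_Int open_vimage continuous_intros cp)
  qed
  have "l \<in> S" using \<epsilon> by (simp add: S_def proj_def)
  have cont: "continuous_on S \<Phi>"
  proof -
    have "continuous_on (\<phi> ` U) (\<lambda>a. Ad (param a) l)"
      unfolding param_def by (rule Ad_param_continuous[OF chart_in])
    then have "continuous_on S (\<lambda>x. Ad (P x) l)"
      unfolding P_def using in_U
      by (rule_tac continuous_on_compose2[of _ _ _ "\<lambda>x. origin + proj x"]) (auto intro!: continuous_intros cp)
    then show ?thesis unfolding \<Phi>_def by (intro continuous_intros)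
  qed
  have inj: "inj_on \<Phi> S"
  proof (rule inj_onI)
    fix x x' assume x: "x \<in> S" and x': "x' \<in> S" and eq: "\<Phi> x = \<Phi> x'"
    have pos: "x \<bullet> l > 0" "x' \<bullet> l > 0" using x x' by (auto simp: S_def)
    have g: "P x \<in> carrier G" "P x' \<in> carrier G" using P_G x x' by auto
    \<comment> \<open>Undoing \<open>Ad (P x)\<close> turns the equality of two points of the cone
      into the statement that the quotient of the two slice points preserves the line.\<close>
    have "Ad (inv (P x)) ((x \<bullet> l) *\<^sub>R Ad (P x) l) = (x \<bullet> l) *\<^sub>R l"
      using g by (simp add: linear_cmul[OF linear_Ad] Ad_inv(1))
    moreover have "Ad (inv (P x)) ((x' \<bullet> l) *\<^sub>R Ad (P x') l) = (x' \<bullet> l) *\<^sub>R Ad (inv (P x) \<otimes> P x') l"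
      using g by (simp add: linear_cmul[OF linear_Ad] Ad_mult)
    ultimately have e: "(x' \<bullet> l) *\<^sub>R Ad (inv (P x) \<otimes> P x') l = (x \<bullet> l) *\<^sub>R l"
      using eq by (simp add: \<Phi>_def)
    have "Ad (inv (P x) \<otimes> P x') l = (1 / (x' \<bullet> l)) *\<^sub>R ((x' \<bullet> l) *\<^sub>R Ad (inv (P x) \<otimes> P x') l)"
      using pos by simp
    then have "Ad (inv (P x) \<otimes> P x') l \<in> span {l}"
      unfolding e by (metis span_scale span_base singletonI)
    then have N: "inv (P x) \<otimes> P x' \<in> normalizer G H" using Ad_in_line_imp_normalizer g by simp
    have "origin + proj x' = origin + proj x"
      by (rule \<epsilon>1(3)[OF in_ball(1)[OF x] in_ball(1)[OF x']]) (use N in \<open>simp_all add: P_def inner_diff_left\<close>)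
    then have pp: "proj x' = proj x" by simp
    then have "(x \<bullet> l) *\<^sub>R Ad (P x) l = (x' \<bullet> l) *\<^sub>R Ad (P x) l" using eq by (simp add: \<Phi>_def P_def)
    then have "x \<bullet> l = x' \<bullet> l" using Ad_eq_0_iff[OF g(1)] l_nonzero by simp
    then show "x = x'" using pp by (simp add: proj_def)
  qed
  have "open (\<Phi> ` S)" by (rule invariance_of_domain[OF cont openS inj])
  moreover have "\<exists>g\<in>W. \<exists>r. r \<noteq> 0 \<and> \<Phi> x = r *\<^sub>R Ad g l" if "x \<in> S" for x
    using P_W[OF that] that by (intro bexI[of _ "P x"] exI[of _ "x \<bullet> l"]) (auto simp: \<Phi>_def S_def)
  ultimately show ?thesis using \<open>l \<in> S\<close> by (intro exI[of _ "\<Phi> ` S"]) auto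
qed

text \<open>Left translation to the identity changes the cone by the invertible linear map
  \<open>Ad g0\<close>, which preserves openness.\<close>

lemma orbit_cone_open:
  assumes W: "openin T W" "g0 \<in> W"
  shows "\<exists>B. open B \<and> B \<noteq> {} \<and> (\<forall>y\<in>B. \<exists>g\<in>W. \<exists>r. r \<noteq> 0 \<and> y = r *\<^sub>R Ad g l)"
proof -
  have g0: "g0 \<in> carrier G" using W openin_subset topspace_eq by blast
  obtain B where B: "open B" "B \<noteq> {}"
    "\<forall>y\<in>B. \<exists>g\<in>{x \<in> carrier G. g0 \<otimes> x \<in> W}. \<exists>r. r \<noteq> 0 \<and> y = r *\<^sub>R Ad g l"
    using orbit_cone_open_near_one[OF openin_left_mult[OF W(1) g0]] g0 W(2) by auto
  have "open (Ad g0 ` B)"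
  proof (rule open_surjective_linear_image[OF B(1) linear_Ad[OF g0]])
    show "surj (Ad g0)" using Ad_inv(2)[OF g0] by (metis surjI)
  qed
  moreover have "\<exists>g\<in>W. \<exists>r. r \<noteq> 0 \<and> Ad g0 y = r *\<^sub>R Ad g l" if y: "y \<in> B" for y
  proof -
    obtain g r where g: "g \<in> carrier G" "g0 \<otimes> g \<in> W" "r \<noteq> 0" "y = r *\<^sub>R Ad g l" using B(3) y by blast
    then have "Ad g0 y = r *\<^sub>R Ad (g0 \<otimes> g) l"
      using g0 by (simp add: linear_cmul[OF linear_Ad[OF g0]] Ad_mult)
    then show ?thesis using g by blast
  qed
  ultimately show ?thesis using B(2) by (intro exI[of _ "Ad g0 ` B"]) auto
qed

end

section \<open>Change of atlas and Lie algebras of conjugate subgroups\<close>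

lemma chart_cover_real: "chart_cover euclideanreal {(UNIV :: real set, id)}"
  by (simp add: chart_cover_def is_chart_def)

lemma smooth_map_real_coordinates:
  fixes \<gamma> :: "real \<Rightarrow> 'm" and \<psi> :: "'m \<Rightarrow> 'e::euclidean_space"
  assumes "chart_cover T A" "smooth_map euclideanreal {(UNIV, id)} T A \<gamma>" "(W, \<psi>) \<in> A"
  shows "open {t. \<gamma> t \<in> W}" "smooth_on {t. \<gamma> t \<in> W} (\<lambda>t. \<psi> (\<gamma> t))"
proof -
  have "inv_into UNIV id a = a" for a :: real by (rule inv_into_f_eq) auto
  then show "open {t. \<gamma> t \<in> W}" "smooth_on {t. \<gamma> t \<in> W} (\<lambda>t. \<psi> (\<gamma> t))"
    using smooth_map_coordinates[OF chart_cover_real assms(1,2) _ assms(3), of UNIV id] by simp_all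
qed

text \<open>Atlases are not maximal, so the chart adapted to \<open>H\<close> may be missing from
  \<open>A\<close>. Adding it keeps the group operations smooth, as they factor through the identity
  maps between the two atlases.\<close>

lemma (in lie_group) lie_group_insert_chart:
  assumes "is_chart T c" "\<And>c'. c' \<in> A \<Longrightarrow> smoothly_compatible c c'"
  shows "lie_group G T (insert c A)"
proof -
  obtain U \<phi> where c: "c = (U, \<phi>)" by (cases c)
  have ch: "is_chart T (U, \<phi>)" using assms(1) c by simp
  have sym: "smoothly_compatible c' c" if "c' \<in> A" for c'
    using assms(2)[OF that] by (auto simp: smoothly_compatible_def Int_commute)
  have self: "smoothly_compatible c c"
  proof -
    have "open (\<phi> ` U)" using ch by (simp add: is_chart_def)
    then have "smooth_on (\<phi> ` U) (\<phi> \<circ> inv_into U \<phi>)"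
      by (rule smooth_on_cong[OF _ _ smooth_on_bounded_linear[OF bounded_linear_ident]])
        (simp add: f_inv_into_f)
    then show ?thesis by (simp add: smoothly_compatible_def c)
  qed
  have old: "smoothly_compatible c1 c2" if "c1 \<in> A" "c2 \<in> A" for c1 c2
    using manifold that by (simp add: smooth_manifold_def)
  have compat: "smoothly_compatible c1 c2" if "c1 \<in> insert c A" "c2 \<in> insert c A" for c1 c2
    using that sym self old assms(2) by blast
  have cov: "chart_cover T A" using manifold by (rule smooth_manifold_chart_cover)
  have "U \<subseteq> topspace T" using openin_subset[OF chart_open[OF ch]] .
  then have cov': "chart_cover T (insert c A)"
    using cov ch by (auto simp: chart_cover_def c)
  have man: "smooth_manifold T (insert c A)"
    using manifold cov' compat by (simp add: smooth_manifold_def chart_cover_def)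
  have into: "smooth_map T A T (insert c A) (\<lambda>x. x)" and out: "smooth_map T (insert c A) T A (\<lambda>x. x)"
    using compat by (auto intro!: smooth_map_id)
  note cov2' = chart_cover_prod[OF cov' cov']
  have f: "smooth_map (prod_topology T T) (product_atlas (insert c A) (insert c A)) T A fst"
    by (rule smooth_map_compose[OF cov2' cov' cov smooth_map_fst[OF cov' cov' compat] out])
  have s: "smooth_map (prod_topology T T) (product_atlas (insert c A) (insert c A)) T A snd"
    by (rule smooth_map_compose[OF cov2' cov' cov smooth_map_snd[OF cov' cov' compat] out])
  have "smooth_map (prod_topology T T) (product_atlas (insert c A) (insert c A)) T A
      (\<lambda>p. (\<lambda>(x, y). x \<otimes> y) (fst p, snd p))"
    by (rule smooth_map_compose[OF cov2' chart_cover_prod[OF cov cov] cov smooth_map_Pair[OF cov2' cov cov f s] smooth_mult])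
  from smooth_map_compose[OF cov2' cov cov' this into]
  have m: "smooth_map (prod_topology T T) (product_atlas (insert c A) (insert c A)) T (insert c A) (\<lambda>(x, y). x \<otimes> y)"
    by (simp add: case_prod_unfold)
  have i: "smooth_map T (insert c A) T (insert c A) (\<lambda>x. inv x)"
    using smooth_map_compose[OF cov' cov cov' smooth_map_compose[OF cov' cov cov out smooth_inv] into] .
  show ?thesis
    by (intro lie_group.intro group_axioms lie_group_axioms.intro topspace_eq man m i)
qed

context lie_group_slice
begin

text \<open>\<open>lie_algebra\<close> asks for curves defined on the whole real line, so each
  vector of the line has to be the velocity of a global curve; this one moreover stays inside the
  chart.\<close>

lemma line_curve:
  assumes w: "w \<in> span {l}"
  obtains \<gamma> :: "real \<Rightarrow> 'g" where "smooth_map euclideanreal {(UNIV, id)} T A \<gamma>" "range \<gamma> \<subseteq> H" "\<gamma> 0 = \<one>"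
    "range \<gamma> \<subseteq> U" "((\<lambda>t. \<phi> (\<gamma> t)) has_vector_derivative w) (at 0)"
proof -
  obtain \<epsilon> where \<epsilon>: "\<epsilon> > 0" "cball origin \<epsilon> \<subseteq> \<phi> ` U"
    using open_image_U origin_in open_contains_cball by blast
  \<comment> \<open>The amplitude keeps the curve within \<open>c * norm w \<le> \<epsilon>\<close>,
    and the \<open>+ 1\<close> covers \<open>w = 0\<close>. The derivative of
    \<open>c * sin (t / c)\<close> at 0 is 1 for every non-zero \<open>c\<close>.\<close>
  define c where "c = \<epsilon> / (norm w + 1)"
  have c: "c > 0" using \<epsilon> by (simp add: c_def add_nonneg_pos)
  have cw: "c * norm w \<le> \<epsilon>"
  proof -
    have "c * norm w \<le> c * (norm w + 1)" using c by (intro mult_left_mono) auto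
    also have "\<dots> = \<epsilon>" using norm_ge_zero[of w] by (simp add: c_def add_nonneg_eq_0_iff)
    finally show ?thesis .
  qed
  define a where "a t = origin + (c * sin (t / c)) *\<^sub>R w" for t :: real
  have a_U: "a t \<in> \<phi> ` U" for t
  proof -
    have "norm ((c * sin (t / c)) *\<^sub>R w) \<le> c * norm w"
    proof -
      have "\<bar>c * sin (t / c)\<bar> \<le> c * 1" using c by (simp add: abs_mult)
      then show ?thesis unfolding norm_scaleR by (intro mult_right_mono) auto
    qed
    then have "a t \<in> cball origin \<epsilon>" using cw by (simp add: a_def dist_norm)
    then show ?thesis using \<epsilon>(2) by blast
  qed
  have a_smooth: "smooth_on UNIV a" unfolding a_def[abs_def] using c by (intro smooth_on_sin_curve) simp
  have a_line: "a t \<in> span {l}" for t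
    unfolding a_def by (intro span_add origin_line span_scale w)
  define \<gamma> where "\<gamma> t = param (a t)" for t
  have ca: "continuous_map euclideanreal (top_of_set (\<phi> ` U)) a"
    using smooth_on_imp_continuous_on[OF a_smooth] a_U by (auto simp: continuous_map_in_subtopology)
  have c\<gamma>: "continuous_map euclideanreal T \<gamma>"
    using continuous_map_compose[OF ca chart_inverse_continuous[OF chart]]
    by (simp add: o_def \<gamma>_def[abs_def] param_def)
  have claim: "smooth_on {t. \<gamma> t \<in> W} (\<xi> \<circ> \<gamma>)" if W: "(W, \<xi>) \<in> A" for W \<xi>
  proof -
    have "is_chart T (W, \<xi>)" using cover W by (auto simp: chart_cover_def)
    then have o: "open {t. \<gamma> t \<in> W}"
      using openin_continuous_map_preimage[OF c\<gamma> chart_open] by simp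
    have 1: "smooth_on (\<phi> ` (U \<inter> W)) (\<xi> \<circ> inv_into U \<phi>)"
      using compatible[OF chart_in W] by (simp add: smoothly_compatible_def)
    have "smooth_on {t. \<gamma> t \<in> W} (\<lambda>t. (\<xi> \<circ> inv_into U \<phi>) (a t))"
    proof (rule smooth_on_compose[OF o smooth_on_subset[OF a_smooth] 1])
      fix t assume "t \<in> {t. \<gamma> t \<in> W}"
      then have "\<gamma> t \<in> U \<inter> W" using a_U[of t] by (simp add: \<gamma>_def)
      then have "\<phi> (\<gamma> t) \<in> \<phi> ` (U \<inter> W)" by (rule imageI)
      then show "a t \<in> \<phi> ` (U \<inter> W)" using a_U by (simp add: \<gamma>_def)
    qed simp
    then show ?thesis by (simp add: o_def \<gamma>_def[abs_def] param_def)
  qed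
  have "inv_into UNIV id t = t" for t :: real by (rule inv_into_f_eq) auto
  then have "inv_into UNIV id = (id :: real \<Rightarrow> real)" by (simp add: fun_eq_iff)
  then have "smooth_map euclideanreal {(UNIV, id)} T A \<gamma>"
    unfolding smooth_map_def using c\<gamma> claim by auto
  moreover have "range \<gamma> \<subseteq> H" using a_line a_U param_in_H_iff by (auto simp: \<gamma>_def)
  moreover have "\<gamma> 0 = \<one>" by (simp add: \<gamma>_def a_def)
  moreover have "range \<gamma> \<subseteq> U" using a_U by (auto simp: \<gamma>_def)
  moreover have "((\<lambda>t. \<phi> (\<gamma> t)) has_vector_derivative w) (at 0)"
  proof -
    have "((\<lambda>t. c * sin (t / c)) has_real_derivative 1) (at 0)"
      using c by (auto intro!: derivative_eq_intros)
    then have "(a has_vector_derivative 1 *\<^sub>R w) (at 0)"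
      unfolding a_def[abs_def] has_real_derivative_iff_has_vector_derivative
      by (intro has_vector_derivative_add[where f' = 0, simplified] has_vector_derivative_const
          bounded_linear.has_vector_derivative[OF bounded_linear_scaleR_left])
    then show ?thesis using a_U by (simp add: \<gamma>_def)
  qed
  ultimately show ?thesis by (rule that)
qed

text \<open>Conjugation by \<open>g\<close> matches the curves in \<open>H\<close> through the
  identity with those in the conjugate, and transforms velocities by \<open>Ad g\<close> followed by
  the coordinate change \<open>\<tau>\<close>. The chart \<open>\<psi>\<close> is arbitrary because
  the Lie algebra is read in \<open>id_chart\<close>, which need not be adapted to
  \<open>H\<close>.\<close>

lemma tangent_space_conjugate:
  assumes V: "(V, \<psi>) \<in> A" "\<one> \<in> V" and g: "g \<in> carrier G"
  defines "\<tau> \<equiv> frechet_derivative (\<lambda>b. \<psi> (param b)) (at origin)"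
  shows "{X. \<exists>\<gamma> :: real \<Rightarrow> 'g. smooth_map euclideanreal {(UNIV, id)} T A \<gamma> \<and>
      range \<gamma> \<subseteq> conjugate G g H \<and> \<gamma> 0 = \<one> \<and> ((\<psi> \<circ> \<gamma>) has_vector_derivative X) (at 0)} = span {\<tau> (Ad g l)}"
    and "linear \<tau>" and "surj \<tau>"
proof -
  have chV: "is_chart T (V, \<psi>)" using cover V by (auto simp: chart_cover_def)
  have oUV: "open (\<phi> ` (U \<inter> V))" "open (\<psi> ` (V \<inter> U))"
    using chart_open[OF chart] chart_open[OF chV]
    by (auto intro!: chart_open_image[OF chart] chart_open_image[OF chV])
  have origin_mem: "origin \<in> \<phi> ` (U \<inter> V)" using one_in V(2) by (auto simp: origin_def)
  have sm: "smooth_on (\<phi> ` (U \<inter> V)) (\<lambda>b. \<psi> (param b))" "smooth_on (\<psi> ` (V \<inter> U)) (\<lambda>b. \<phi> (inv_into V \<psi> b))"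
    using compatible[OF chart_in V(1)] compatible[OF V(1) chart_in]
    by (simp_all add: smoothly_compatible_def o_def param_def)
  have \<tau>: "((\<lambda>b. \<psi> (param b)) has_derivative \<tau>) (at origin)"
    unfolding \<tau>_def by (rule smooth_on_has_derivative[OF sm(1) origin_mem])
  show lin: "linear \<tau>" using \<tau> has_derivative_linear by blast
  have inv\<psi>: "inv_into V \<psi> (\<psi> x) = x" if "x \<in> V" for x using chart_inj[OF chV] that by simp
  define \<sigma> where "\<sigma> = frechet_derivative (\<lambda>b. \<phi> (inv_into V \<psi> b)) (at (\<psi> \<one>))"
  have \<sigma>: "((\<lambda>b. \<phi> (inv_into V \<psi> b)) has_derivative \<sigma>) (at (\<psi> \<one>))"
    unfolding \<sigma>_def by (rule smooth_on_has_derivative[OF sm(2)]) (use one_in V(2) in auto)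
  have "((\<lambda>b. b) has_derivative (\<tau> \<circ> \<sigma>)) (at (\<psi> \<one>))"
  proof -
    have eq: "\<phi> (inv_into V \<psi> (\<psi> \<one>)) = origin" using inv\<psi>[OF V(2)] by (simp add: origin_def)
    have "((\<lambda>b. \<psi> (param b)) \<circ> (\<lambda>b. \<phi> (inv_into V \<psi> b)) has_derivative (\<tau> \<circ> \<sigma>)) (at (\<psi> \<one>))"
      by (rule diff_chain_at[OF \<sigma>]) (simp add: eq \<tau>)
    then show ?thesis
    proof (rule has_derivative_transform_within_open[OF _ oUV(2)])
      show "\<psi> \<one> \<in> \<psi> ` (V \<inter> U)" using one_in V(2) by auto
      fix b assume "b \<in> \<psi> ` (V \<inter> U)"
      then show "((\<lambda>b. \<psi> (param b)) \<circ> (\<lambda>b. \<phi> (inv_into V \<psi> b))) b = b" using inv\<psi> by auto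
    qed
  qed
  from has_derivative_unique[OF this has_derivative_ident] have "\<tau> (\<sigma> w) = w" for w by (metis comp_apply)
  then show "surj \<tau>" by (metis surjI)
  have conj_curve: "((\<psi> \<circ> (\<lambda>t. g \<otimes> \<gamma> t \<otimes> inv g)) has_vector_derivative \<tau> (Ad g w)) (at 0)"
    if \<gamma>: "smooth_map euclideanreal {(UNIV, id)} T A \<gamma>" "\<gamma> 0 = \<one>"
      "((\<lambda>t. \<phi> (\<gamma> t)) has_vector_derivative w) (at 0)" for \<gamma> :: "real \<Rightarrow> 'g" and w
  proof -
    have 0: "\<phi> (\<gamma> 0) = origin" using \<gamma>(2) by (simp add: origin_def)
    have eq: "\<phi> (g \<otimes> param origin \<otimes> inv g) = origin" using g by (simp add: origin_def[symmetric])
    have 1: "((\<lambda>b. \<phi> (g \<otimes> param b \<otimes> inv g)) has_derivative Ad g) (at (\<phi> (\<gamma> 0)))"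
      unfolding 0 by (rule Ad_has_derivative[OF g])
    have 2: "((\<lambda>b. \<psi> (param b)) has_derivative \<tau>) (at (((\<lambda>b. \<phi> (g \<otimes> param b \<otimes> inv g)) \<circ> (\<lambda>t. \<phi> (\<gamma> t))) 0))"
      unfolding o_def 0 eq by (rule \<tau>)
    have d: "((\<lambda>b. \<psi> (param b)) \<circ> ((\<lambda>b. \<phi> (g \<otimes> param b \<otimes> inv g)) \<circ> (\<lambda>t. \<phi> (\<gamma> t)))
        has_derivative (\<tau> \<circ> (Ad g \<circ> (\<lambda>h. h *\<^sub>R w)))) (at 0)"
      by (rule diff_chain_at[OF diff_chain_at[OF \<gamma>(3)[unfolded has_vector_derivative_def] 1] 2])
    have sc: "smooth_map euclideanreal {(UNIV, id)} T A (\<lambda>t. g \<otimes> \<gamma> t \<otimes> inv g)"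
      by (rule smooth_map_compose[OF chart_cover_real cover cover \<gamma>(1) smooth_conj[OF g]])
    define N where "N = {t. \<gamma> t \<in> U} \<inter> {t. g \<otimes> \<gamma> t \<otimes> inv g \<in> U}"
    have oN: "open N" unfolding N_def
      by (intro open_Int smooth_map_real_coordinates(1)[OF cover \<gamma>(1) chart_in]
          smooth_map_real_coordinates(1)[OF cover sc chart_in])
    have N0: "0 \<in> N" using \<gamma>(2) one_in g by (simp add: N_def)
    have "((\<psi> \<circ> (\<lambda>t. g \<otimes> \<gamma> t \<otimes> inv g)) has_derivative (\<tau> \<circ> (Ad g \<circ> (\<lambda>h. h *\<^sub>R w)))) (at 0)"
      by (rule has_derivative_transform_within_open[OF d oN N0]) (simp add: N_def)
    moreover have "(\<tau> \<circ> (Ad g \<circ> (\<lambda>h. h *\<^sub>R w))) = (\<lambda>h. h *\<^sub>R \<tau> (Ad g w))"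
      by (auto simp: fun_eq_iff linear_cmul[OF linear_Ad[OF g]] linear_cmul[OF lin])
    ultimately show ?thesis by (simp add: has_vector_derivative_def)
  qed
  show "{X. \<exists>\<gamma> :: real \<Rightarrow> 'g. smooth_map euclideanreal {(UNIV, id)} T A \<gamma> \<and>
      range \<gamma> \<subseteq> conjugate G g H \<and> \<gamma> 0 = \<one> \<and> ((\<psi> \<circ> \<gamma>) has_vector_derivative X) (at 0)} = span {\<tau> (Ad g l)}"
  proof (intro equalityI subsetI)
    fix X assume "X \<in> span {\<tau> (Ad g l)}"
    then obtain k where X: "X = k *\<^sub>R \<tau> (Ad g l)" by (auto simp: span_singleton)
    have w: "k *\<^sub>R l \<in> span {l}" by (simp add: span_scale span_base)
    obtain \<gamma> where \<gamma>: "smooth_map euclideanreal {(UNIV, id)} T A \<gamma>" "range \<gamma> \<subseteq> H" "\<gamma> 0 = \<one>"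
      "((\<lambda>t. \<phi> (\<gamma> t)) has_vector_derivative (k *\<^sub>R l)) (at 0)"
      using line_curve[OF w] by metis
    have "smooth_map euclideanreal {(UNIV, id)} T A (\<lambda>t. g \<otimes> \<gamma> t \<otimes> inv g)"
      by (rule smooth_map_compose[OF chart_cover_real cover cover \<gamma>(1) smooth_conj[OF g]])
    moreover have "range (\<lambda>t. g \<otimes> \<gamma> t \<otimes> inv g) \<subseteq> conjugate G g H"
      unfolding conjugate_eq_image using \<gamma>(2) by auto
    moreover have "g \<otimes> \<gamma> 0 \<otimes> inv g = \<one>" using g \<gamma>(3) by simp
    moreover have "((\<psi> \<circ> (\<lambda>t. g \<otimes> \<gamma> t \<otimes> inv g)) has_vector_derivative X) (at 0)"
      using conj_curve[OF \<gamma>(1,3,4)] by (simp add: X linear_cmul[OF linear_Ad[OF g]] linear_cmul[OF lin])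
    ultimately show "X \<in> {X. \<exists>\<gamma> :: real \<Rightarrow> 'g. smooth_map euclideanreal {(UNIV, id)} T A \<gamma> \<and>
      range \<gamma> \<subseteq> conjugate G g H \<and> \<gamma> 0 = \<one> \<and> ((\<psi> \<circ> \<gamma>) has_vector_derivative X) (at 0)}"
      by (intro CollectI exI[of _ "\<lambda>t. g \<otimes> \<gamma> t \<otimes> inv g"] conjI)
  next
    fix X assume "X \<in> {X. \<exists>\<gamma> :: real \<Rightarrow> 'g. smooth_map euclideanreal {(UNIV, id)} T A \<gamma> \<and>
      range \<gamma> \<subseteq> conjugate G g H \<and> \<gamma> 0 = \<one> \<and> ((\<psi> \<circ> \<gamma>) has_vector_derivative X) (at 0)}"
    then obtain \<gamma> :: "real \<Rightarrow> 'g" where \<gamma>: "smooth_map euclideanreal {(UNIV, id)} T A \<gamma>"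
      "range \<gamma> \<subseteq> conjugate G g H" "\<gamma> 0 = \<one>" "((\<psi> \<circ> \<gamma>) has_vector_derivative X) (at 0)" by blast
    define \<delta> where "\<delta> t = inv g \<otimes> \<gamma> t \<otimes> inv (inv g)" for t
    have cancel: "inv u \<otimes> (u \<otimes> v) = v" "u \<otimes> (inv u \<otimes> v) = v"
      if "u \<in> carrier G" "v \<in> carrier G" for u v
      using that by (simp_all add: m_assoc[symmetric])
    have \<delta>\<gamma>: "\<delta> t \<in> H" "g \<otimes> \<delta> t \<otimes> inv g = \<gamma> t" for t
    proof -
      obtain h where h: "h \<in> H" "\<gamma> t = g \<otimes> h \<otimes> inv g"
        using \<gamma>(2) unfolding conjugate_eq_image by blast
      then have "h \<in> carrier G" using H_carrier by blast
      then have "\<delta> t = h" using g h(2) by (simp add: \<delta>_def m_assoc cancel)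
      then show "\<delta> t \<in> H" "g \<otimes> \<delta> t \<otimes> inv g = \<gamma> t" using h by auto
    qed
    have sd: "smooth_map euclideanreal {(UNIV, id)} T A \<delta>"
      unfolding \<delta>_def[abs_def]
      by (rule smooth_map_compose[OF chart_cover_real cover cover \<gamma>(1) smooth_conj[OF inv_closed[OF g]]])
    have d0: "\<delta> 0 = \<one>" using \<gamma>(3) g by (simp add: \<delta>_def)
    note co = smooth_map_real_coordinates[OF cover sd chart_in]
    have mem0: "0 \<in> {t. \<delta> t \<in> U}" using d0 one_in by simp
    define w where "w = frechet_derivative (\<lambda>t. \<phi> (\<delta> t)) (at 0) 1"
    have wd: "((\<lambda>t. \<phi> (\<delta> t)) has_vector_derivative w) (at 0)"
    proof -
      have "((\<lambda>t. \<phi> (\<delta> t)) has_derivative frechet_derivative (\<lambda>t. \<phi> (\<delta> t)) (at 0)) (at 0)"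
        by (rule smooth_on_has_derivative[OF co(2) mem0])
      moreover from has_derivative_linear[OF this]
      have "frechet_derivative (\<lambda>t. \<phi> (\<delta> t)) (at 0) = (\<lambda>h. h *\<^sub>R w)"
        unfolding w_def by (metis linear_cmul mult.right_neutral real_scaleR_def)
      ultimately show ?thesis by (simp add: has_vector_derivative_def)
    qed
    have "w \<in> span {l}"
      by (rule tangent_in_line[OF wd co(1) mem0]) (use \<delta>\<gamma>(1) phi_in_line_iff in blast)
    then obtain k where k: "w = k *\<^sub>R l" by (auto simp: span_singleton)
    have "((\<psi> \<circ> (\<lambda>t. g \<otimes> \<delta> t \<otimes> inv g)) has_vector_derivative \<tau> (Ad g w)) (at 0)"
      by (rule conj_curve[OF sd d0 wd])
    then have "(\<psi> \<circ> \<gamma> has_vector_derivative \<tau> (Ad g w)) (at 0)" unfolding \<delta>\<gamma>(2) .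
    then have "X = \<tau> (Ad g w)" using vector_derivative_unique_at \<gamma>(4) by blast
    then have "X = k *\<^sub>R \<tau> (Ad g l)" by (simp add: k linear_cmul[OF linear_Ad[OF g]] linear_cmul[OF lin])
    then show "X \<in> span {\<tau> (Ad g l)}" by (simp add: span_scale span_base)
  qed
qed

end

text \<open>The interface between Lie theory and the linear problem: \<open>x g\<close> is the image
  of \<open>l\<close> under \<open>Ad g\<close>, in the coordinates of \<open>id_chart\<close>.
  Continuity of \<open>x\<close> and openness of right translates serve the openness of the generic
  set in the coset topology; the open sets inside the cones serve its density.\<close>

lemma conjugate_lie_algebras:
  fixes G :: "'g monoid" and A :: "('g, 'e::euclidean_space) chart set"
  assumes "lie_group G T A" "closed_lie_subgroup G T A 1 H" "connectedin T H"
    and "finite (carrier ((G\<lparr>carrier := normalizer G H\<rparr>) Mod H))"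
  obtains x :: "'g \<Rightarrow> 'e" where
    "\<And>g. g \<in> carrier G \<Longrightarrow> lie_algebra G T A (conjugate G g H) = span {x g}"
    "\<And>B. open B \<Longrightarrow> openin T {g \<in> carrier G. x g \<in> B}"
    "\<And>W h. openin T W \<Longrightarrow> h \<in> carrier G \<Longrightarrow> openin T {g \<in> carrier G. g \<otimes>\<^bsub>G\<^esub> h \<in> W}"
    "\<And>W. openin T W \<Longrightarrow> W \<noteq> {} \<Longrightarrow>
      \<exists>B. open B \<and> B \<noteq> {} \<and> (\<forall>y\<in>B. \<exists>g\<in>W. \<exists>r. r \<noteq> 0 \<and> y = r *\<^sub>R x g)"
proof -
  interpret lie_group G T A by (rule assms(1))
  have H: "subgroup H G" "closedin T H" "embedded_submanifold T A 1 H"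
    using assms(2) by (auto simp: closed_lie_subgroup_def)
  have oneH: "\<one>\<^bsub>G\<^esub> \<in> H" using H(1) by (rule subgroup.one_closed)
  then obtain U \<phi> L where U: "\<one>\<^bsub>G\<^esub> \<in> U" "is_chart T (U, \<phi>)" "\<forall>c\<in>A. smoothly_compatible (U, \<phi>) c"
    "subspace L" "dim L = 1" "\<phi> ` (U \<inter> H) = \<phi> ` U \<inter> L"
    using H(3) unfolding embedded_submanifold_def by blast
  obtain l where l: "norm l = 1" "L = span {l}"
  proof -
    obtain B where B: "B \<subseteq> L" "independent B" "span B = L" "card B = 1"
      using basis_subspace_exists[OF U(4)] U(5) by metis
    then obtain b where b: "B = {b}" using card_1_singletonE by metis
    then have "b \<noteq> 0" using B(2) by auto
    then have "norm ((1 / norm b) *\<^sub>R b) = 1" by simp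
    moreover have "span {(1 / norm b) *\<^sub>R b} = span {b}"
      using span_image_scale[of "{b}" "\<lambda>_. 1 / norm b"] \<open>b \<noteq> 0\<close> by simp
    ultimately show ?thesis using that B(3) b by metis
  qed
  define A' where "A' = insert (U, \<phi>) A"
  have L': "lie_group G T A'"
    unfolding A'_def using U(3) by (intro lie_group_insert_chart[OF U(2)]) auto
  have chart': "lie_group_chart G T A' U \<phi>"
    by (rule lie_group_chart.intro[OF L' lie_group_chart_axioms.intro]) (simp_all add: A'_def U(1))
  have slice': "lie_group_slice G T A' U \<phi> H l"
    by (rule lie_group_slice.intro[OF chart' lie_group_slice_axioms.intro[OF H(1) l(1) U(6)[unfolded l(2)]]])
  interpret R: lie_group_rigid G T A' U \<phi> H l
    by (rule lie_group_rigid.intro[OF slice' lie_group_rigid_axioms.intro[OF H(2) assms(3,4)]])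
  define c where "c = id_chart G A"
  have cov: "chart_cover T A" using manifold by (rule smooth_manifold_chart_cover)
  have "\<exists>c. c \<in> A \<and> \<one>\<^bsub>G\<^esub> \<in> fst c"
  proof -
    have "\<one>\<^bsub>G\<^esub> \<in> topspace T" using topspace_eq by simp
    then obtain U' \<phi>' where "(U', \<phi>') \<in> A" "\<one>\<^bsub>G\<^esub> \<in> U'" using chart_coverD[OF cov] by blast
    then show ?thesis by (intro exI[of _ "(U', \<phi>')"]) simp
  qed
  then have c: "c \<in> A \<and> \<one>\<^bsub>G\<^esub> \<in> fst c" unfolding c_def id_chart_def by (rule someI_ex)
  define V where "V = fst c"
  define \<psi> where "\<psi> = snd c"
  have V: "(V, \<psi>) \<in> A'" "\<one>\<^bsub>G\<^esub> \<in> V" using c by (auto simp: V_def \<psi>_def A'_def)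
  define \<tau> where "\<tau> = frechet_derivative (\<lambda>b. \<psi> (R.param b)) (at R.origin)"
  note tan = R.tangent_space_conjugate[OF V, folded \<tau>_def]
  have lin: "linear \<tau>" and surj: "surj \<tau>" using tan(2,3) one_closed by blast+
  have into: "smooth_map T A T A' (\<lambda>x. x)" and out: "smooth_map T A' T A (\<lambda>x. x)"
    using R.compatible by (auto intro!: smooth_map_id simp: A'_def)
  have sm_iff: "smooth_map euclideanreal {(UNIV, id)} T A \<gamma> \<longleftrightarrow> smooth_map euclideanreal {(UNIV, id)} T A' \<gamma>"
    for \<gamma> :: "real \<Rightarrow> 'g"
    using smooth_map_compose[OF chart_cover_real cov R.cover _ into, of \<gamma>]
      smooth_map_compose[OF chart_cover_real R.cover cov _ out, of \<gamma>] by blast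
  define x where "x g = \<tau> (R.Ad g l)" for g
  show ?thesis
  proof (rule that[of x])
    fix g assume g: "g \<in> carrier G"
    show "lie_algebra G T A (conjugate G g H) = span {x g}"
      unfolding lie_algebra_def sm_iff c_def[symmetric] \<psi>_def[symmetric] x_def by (rule tan(1)[OF g])
  next
    fix B :: "'e set" assume "open B"
    then have "open (\<tau> -` B)"
      using lin linear_continuous_on linear_conv_bounded_linear open_vimage by blast
    then show "openin T {g \<in> carrier G. x g \<in> B}"
      using R.openin_Ad_vimage[of "\<tau> -` B" l] by (simp add: x_def)
  next
    show "openin T {g \<in> carrier G. g \<otimes>\<^bsub>G\<^esub> h \<in> W}" if "openin T W" "h \<in> carrier G" for W h
      using R.openin_right_mult that .
  next
    fix W assume W: "openin T W" "W \<noteq> {}"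
    then obtain B where B: "open B" "B \<noteq> {}" "\<forall>y\<in>B. \<exists>g\<in>W. \<exists>r. r \<noteq> 0 \<and> y = r *\<^sub>R R.Ad g l"
      using R.orbit_cone_open by blast
    have "open (\<tau> ` B)" by (rule open_surjective_linear_image[OF B(1) lin surj])
    moreover have "\<exists>g\<in>W. \<exists>r. r \<noteq> 0 \<and> \<tau> y = r *\<^sub>R x g" if y: "y \<in> B" for y
    proof -
      obtain g r where gr: "g \<in> W" "r \<noteq> 0" "y = r *\<^sub>R R.Ad g l" using B(3) y by blast
      then have "\<tau> y = r *\<^sub>R x g" by (simp add: x_def linear_cmul[OF lin])
      then show ?thesis using gr by blast
    qed
    ultimately show "\<exists>B. open B \<and> B \<noteq> {} \<and> (\<forall>y\<in>B. \<exists>g\<in>W. \<exists>r. r \<noteq> 0 \<and> y = r *\<^sub>R x g)"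
      using B(2) by (intro exI[of _ "\<tau> ` B"]) auto
  qed
qed

section \<open>The first cohomology of the motion sheaf\<close>

definition translate :: "'a::ab_group_add set \<Rightarrow> 'a \<Rightarrow> 'a set" where
  "translate N c = (\<lambda>n. n + c) ` N"

lemma mem_translate: "z \<in> translate N c \<longleftrightarrow> z - c \<in> N"
  unfolding translate_def by (auto simp: image_iff) (metis diff_add_cancel)

lemma a_r_coset_euclidean: "N +>\<^bsub>euclidean_module\<^esub> c = translate N c"
  by (auto simp: a_r_coset_def' translate_def euclidean_module_def)

lemma set_add_euclidean:
  "X <+>\<^bsub>euclidean_module\<^esub> Y = {x + y |x y. x \<in> X \<and> y \<in> Y}"
  by (auto simp: set_add_def' euclidean_module_def)

lemma carrier_quotient: "carrier (quotient_module euclidean_module N) = range (translate N)"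
  by (auto simp: quotient_module_def A_RCOSETS_def' a_r_coset_euclidean) (auto simp: euclidean_module_def)

lemma zero_quotient: "\<zero>\<^bsub>quotient_module euclidean_module N\<^esub> = translate N 0"
  by (simp add: quotient_module_def translate_def)

context
  fixes N :: "'a::euclidean_space set" assumes N: "subspace N"
begin

lemma translate_eq_iff: "translate N c = translate N c' \<longleftrightarrow> c - c' \<in> N"
proof
  assume "translate N c = translate N c'"
  moreover have "c \<in> translate N c" using N subspace_0 by (auto simp: mem_translate)
  ultimately show "c - c' \<in> N" by (auto simp: mem_translate)
next
  assume c: "c - c' \<in> N"
  have "z - c \<in> N \<longleftrightarrow> z - c' \<in> N" for z
  proof
    assume "z - c \<in> N"
    from subspace_add[OF N this c] show "z - c' \<in> N" by simp
  next
    assume "z - c' \<in> N"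
    from subspace_diff[OF N this c] show "z - c \<in> N" by simp
  qed
  then show "translate N c = translate N c'" by (intro Set.set_eqI) (simp add: mem_translate)
qed

lemma translate_add_subset:
  assumes "M \<subseteq> N" "0 \<in> M" shows "translate M c <+>\<^bsub>euclidean_module\<^esub> N = translate N c"
proof -
  have "z \<in> translate M c <+>\<^bsub>euclidean_module\<^esub> N \<longleftrightarrow> z - c \<in> N" for z
  proof
    assume "z \<in> translate M c <+>\<^bsub>euclidean_module\<^esub> N"
    then obtain p q where "p - c \<in> M" "q \<in> N" "z = p + q"
      by (auto simp: set_add_euclidean mem_translate)
    then show "z - c \<in> N" using subspace_add[OF N, of "p - c" q] assms(1) by (auto simp: algebra_simps)
  next
    assume "z - c \<in> N"
    then show "z \<in> translate M c <+>\<^bsub>euclidean_module\<^esub> N"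
      unfolding set_add_euclidean mem_translate using assms(2)
      by (intro CollectI exI[of _ c] exI[of _ "z - c"]) auto
  qed
  then show ?thesis by (intro Set.set_eqI) (simp add: mem_translate)
qed

lemma add_quotient:
  "translate N c \<oplus>\<^bsub>quotient_module euclidean_module N\<^esub> translate N c' = translate N (c + c')"
proof -
  have "z \<in> translate N c <+>\<^bsub>euclidean_module\<^esub> translate N c' \<longleftrightarrow> z - (c + c') \<in> N" for z
  proof
    assume "z \<in> translate N c <+>\<^bsub>euclidean_module\<^esub> translate N c'"
    then obtain p q where "p - c \<in> N" "q - c' \<in> N" "z = p + q"
      by (auto simp: set_add_euclidean mem_translate)
    then show "z - (c + c') \<in> N" using subspace_add[OF N, of "p - c" "q - c'"] by (simp add: algebra_simps)
  next
    assume "z - (c + c') \<in> N"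
    then show "z \<in> translate N c <+>\<^bsub>euclidean_module\<^esub> translate N c'"
      unfolding set_add_euclidean mem_translate using subspace_0[OF N]
      by (intro CollectI exI[of _ c] exI[of _ "z - c"]) (auto simp: algebra_simps)
  qed
  then show ?thesis unfolding quotient_module_def by (intro Set.set_eqI) (simp add: mem_translate)
qed

lemma smult_quotient:
  "r \<odot>\<^bsub>quotient_module euclidean_module N\<^esub> translate N c = translate N (r *\<^sub>R c)"
proof -
  have eq: "translate N (r *\<^sub>R y) = translate N (r *\<^sub>R c)" if "y \<in> translate N c" for y
    unfolding translate_eq_iff using subspace_scale[OF N, of "y - c" r] that
    by (simp add: mem_translate scaleR_diff_right)
  have "r \<odot>\<^bsub>quotient_module euclidean_module N\<^esub> translate N c =
      (\<Union>y\<in>translate N c. N +>\<^bsub>euclidean_module\<^esub> (r \<odot>\<^bsub>euclidean_module\<^esub> y))"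
    by (simp add: quotient_module_def)
  also have "\<dots> = (\<Union>y\<in>translate N c. translate N (r *\<^sub>R y))"
    unfolding a_r_coset_euclidean by (simp add: euclidean_module_def)
  also have "\<dots> = (\<Union>y\<in>translate N c. translate N (r *\<^sub>R c))"
    by (rule SUP_cong[OF refl eq])
  also have "\<dots> = translate N (r *\<^sub>R c)"
  proof -
    have "c \<in> translate N c" using N subspace_0 by (simp add: mem_translate)
    then show ?thesis by blast
  qed
  finally show ?thesis .
qed

lemma abelian_monoid_quotient: "abelian_monoid (quotient_module euclidean_module N)"
proof (rule abelian_monoidI)
  show "\<zero>\<^bsub>quotient_module euclidean_module N\<^esub> \<in> carrier (quotient_module euclidean_module N)"
    unfolding zero_quotient carrier_quotient by blast
qed (auto simp: carrier_quotient add_quotient zero_quotient algebra_simps)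

lemma finsum_pair_quotient:
  assumes "x \<noteq> y" "f x = translate N a" "f y = translate N b"
  shows "(\<Oplus>\<^bsub>quotient_module euclidean_module N\<^esub> z \<in> {x, y}. f z) = translate N (a + b)"
proof -
  interpret abelian_monoid "quotient_module euclidean_module N" by (rule abelian_monoid_quotient)
  have c: "translate N c \<in> carrier (quotient_module euclidean_module N)" for c
    by (simp add: carrier_quotient)
  have "finsum (quotient_module euclidean_module N) f {y} = translate N b"
    using finsum_insert[of "{}" y f] assms(3) c by simp
  then have "finsum (quotient_module euclidean_module N) f {x, y} =
      translate N a \<oplus>\<^bsub>quotient_module euclidean_module N\<^esub> translate N b"
    using finsum_insert[of "{y}" x f] assms c by simp
  then show ?thesis unfolding add_quotient .
qed

end

text \<open>The stalk at an edge \<open>e\<close> of the graph only matters through its image in the stalks at the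
  incidences, whence the weak assumptions on it.\<close>

lemma is_zero_H1_iff:
  fixes x :: "'v \<Rightarrow> 'e::euclidean_space" and \<rho> :: "'v + 'v set \<Rightarrow> 'g set"
    and G :: "('g, 'b) monoid_scheme"
  assumes E: "\<And>e. e \<in> E \<Longrightarrow> e \<subseteq> V"
    and \<sigma>: "sign_convention (incidence_graph V E) \<sigma>"
    and lv: "\<And>v. v \<in> V \<Longrightarrow> lie_algebra G T A (\<rho> (Inl v)) = span {x v}"
    and le: "\<And>e v. e \<in> E \<Longrightarrow> v \<in> e \<Longrightarrow> lie_algebra G T A (\<rho> (Inr e)) \<subseteq> span {x v}"
    and l0: "\<And>e. e \<in> E \<Longrightarrow> 0 \<in> lie_algebra G T A (\<rho> (Inr e))"
  shows "is_zero_module (H1 (incidence_graph V E) \<sigma> (motion_sheaf G T A \<rho>)) \<longleftrightarrow>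
    (\<forall>b. \<exists>a c. \<forall>e\<in>E. \<forall>v\<in>e. \<exists>t. a v - c e - b v e = t *\<^sub>R x v)"
proof -
  define \<Gamma> where "\<Gamma> = incidence_graph V E"
  define F where "F = motion_sheaf G T A \<rho>"
  define h where "h y = lie_algebra G T A (\<rho> y)" for y
  define S where "S v = span {x v}" for v
  have S: "subspace (S v)" for v by (simp add: S_def)
  have ed: "edges \<Gamma> = {(v, e). e \<in> E \<and> v \<in> e}" and vs: "verts \<Gamma> = V <+> E"
    and en: "ends \<Gamma> (v, e) = {Inl v, Inr e}" for v e
    by (auto simp: \<Gamma>_def incidence_graph_def)
  have hv: "h (Inl v) = S v" if "v \<in> V" for v using lv[OF that] by (simp add: h_def S_def)
  have vstalk: "vertex_stalk F y = quotient_module euclidean_module (h y)" for y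
    by (simp add: F_def motion_sheaf_def h_def)
  have estalk: "edge_stalk F (v, e) = quotient_module euclidean_module (S v)" if "v \<in> V" for v e
    using hv[OF that] by (simp add: F_def motion_sheaf_def h_def)
  \<comment> \<open>Cochains are handled through vector representatives: \<open>cls\<close> takes
    one vector per incidence to a 1-cochain, and below \<open>coch\<close> does the same for
    0-cochains, while \<open>\<delta>\<close> lifts the coboundary to representatives.\<close>
  define cls where "cls \<beta> = (\<lambda>i\<in>edges \<Gamma>. translate (S (fst i)) (\<beta> i))" for \<beta> :: "'v \<times> 'v set \<Rightarrow> 'e"
  have inV: "v \<in> V" "e \<in> E" "v \<in> e" if "(v, e) \<in> edges \<Gamma>" for v e using that E ed by auto
  have C1: "carrier (C1 \<Gamma> F) = range cls"
  proof (intro equalityI subsetI)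
    fix y assume "y \<in> carrier (C1 \<Gamma> F)"
    then have y: "y \<in> (\<Pi>\<^sub>E i\<in>edges \<Gamma>. carrier (edge_stalk F i))" by (simp add: C1_def direct_sum_def)
    have "\<exists>c. y i = translate (S (fst i)) c" if "i \<in> edges \<Gamma>" for i
    proof -
      obtain v e where i: "i = (v, e)" by (cases i)
      have "y i \<in> carrier (edge_stalk F (v, e))" using y that i by (auto simp: PiE_iff)
      then show ?thesis using estalk[of v e] inV that i by (auto simp: carrier_quotient)
    qed
    then obtain \<beta> where "\<And>i. i \<in> edges \<Gamma> \<Longrightarrow> y i = translate (S (fst i)) (\<beta> i)" by metis
    moreover have "y \<in> extensional (edges \<Gamma>)" using y by (simp add: PiE_iff)
    ultimately have "y = cls \<beta>" by (intro extensionalityI[of _ "edges \<Gamma>"]) (auto simp: cls_def)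
    then show "y \<in> range cls" by blast
  next
    fix y assume "y \<in> range cls"
    then obtain \<beta> where "y = cls \<beta>" by blast
    then show "y \<in> carrier (C1 \<Gamma> F)"
      using estalk inV by (auto simp: C1_def direct_sum_def cls_def carrier_quotient)
  qed
  have add: "cls \<beta> \<oplus>\<^bsub>C1 \<Gamma> F\<^esub> cls \<beta>' = cls (\<lambda>i. \<beta> i + \<beta>' i)" for \<beta> \<beta>'
  proof -
    have "cls \<beta> \<oplus>\<^bsub>C1 \<Gamma> F\<^esub> cls \<beta>' = (\<lambda>i\<in>edges \<Gamma>. cls \<beta> i \<oplus>\<^bsub>edge_stalk F i\<^esub> cls \<beta>' i)"
      by (simp add: C1_def direct_sum_def)
    also have "\<dots> = cls (\<lambda>i. \<beta> i + \<beta>' i)"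
      unfolding cls_def using estalk inV by (intro restrict_ext) (auto simp: add_quotient[OF S])
    finally show ?thesis .
  qed
  have cls_eq: "cls \<beta> = cls \<beta>' \<longleftrightarrow> (\<forall>i\<in>edges \<Gamma>. \<beta> i - \<beta>' i \<in> S (fst i))" for \<beta> \<beta>'
  proof
    assume eq: "cls \<beta> = cls \<beta>'"
    show "\<forall>i\<in>edges \<Gamma>. \<beta> i - \<beta>' i \<in> S (fst i)"
    proof
      fix i assume "i \<in> edges \<Gamma>"
      then show "\<beta> i - \<beta>' i \<in> S (fst i)"
        using fun_cong[OF eq, of i] translate_eq_iff[OF S] by (simp add: cls_def)
    qed
  next
    assume "\<forall>i\<in>edges \<Gamma>. \<beta> i - \<beta>' i \<in> S (fst i)"
    then show "cls \<beta> = cls \<beta>'"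
      unfolding cls_def by (intro restrict_ext) (simp add: translate_eq_iff[OF S])
  qed
  define \<delta> where "\<delta> a = (\<lambda>(v, e). \<sigma> (Inl v) (v, e) *\<^sub>R a (Inl v) + \<sigma> (Inr e) (v, e) *\<^sub>R a (Inr e))"
    for a :: "'v + 'v set \<Rightarrow> 'e"
  define coch where "coch a = (\<lambda>y\<in>verts \<Gamma>. translate (h y) (a y))" for a
  have C0: "carrier (C0 \<Gamma> F) = range coch"
  proof (intro equalityI subsetI)
    fix w assume "w \<in> carrier (C0 \<Gamma> F)"
    then have w: "w \<in> (\<Pi>\<^sub>E y\<in>verts \<Gamma>. range (translate (h y)))"
      by (simp add: C0_def direct_sum_def vstalk carrier_quotient)
    then have "\<forall>y\<in>verts \<Gamma>. \<exists>c. w y = translate (h y) c" by (auto simp: PiE_iff)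
    then obtain a where "\<And>y. y \<in> verts \<Gamma> \<Longrightarrow> w y = translate (h y) (a y)" by metis
    moreover have "w \<in> extensional (verts \<Gamma>)" using w by (simp add: PiE_iff)
    ultimately have "w = coch a" by (intro extensionalityI[of _ "verts \<Gamma>"]) (auto simp: coch_def)
    then show "w \<in> range coch" by blast
  next
    fix w assume "w \<in> range coch"
    then show "w \<in> carrier (C0 \<Gamma> F)"
      by (auto simp: C0_def direct_sum_def vstalk carrier_quotient coch_def)
  qed
  have cob: "coboundary \<Gamma> \<sigma> F (coch a) = cls (\<delta> a)" for a
    unfolding coboundary_def cls_def
  proof (rule restrict_ext)
    fix i assume i: "i \<in> edges \<Gamma>"
    obtain v e where ve: "i = (v, e)" by (cases i)
    have m: "v \<in> V" "e \<in> E" "v \<in> e" using inV i ve by auto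
    have 1: "restriction F (Inl v) (v, e) (coch a (Inl v)) = translate (S v) (a (Inl v))"
      using m vs hv[OF m(1)] by (simp add: F_def motion_sheaf_def coch_def InlI)
    have "h (Inr e) \<subseteq> S v" "0 \<in> h (Inr e)" using le[OF m(2,3)] l0[OF m(2)] by (auto simp: h_def S_def)
    then have 2: "restriction F (Inr e) (v, e) (coch a (Inr e)) = translate (S v) (a (Inr e))"
      using m vs hv[OF m(1)] translate_add_subset[OF S, of "h (Inr e)" v "a (Inr e)"]
      by (simp add: F_def motion_sheaf_def coch_def InrI h_def)
    show "(\<Oplus>\<^bsub>edge_stalk F i\<^esub>y\<in>ends \<Gamma> i. \<sigma> y i \<odot>\<^bsub>edge_stalk F i\<^esub> restriction F y i (coch a y)) =
        translate (S (fst i)) (\<delta> a i)"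
      unfolding ve en estalk[OF m(1)] fst_conv \<delta>_def prod.case
      by (rule finsum_pair_quotient[OF S]) (simp_all add: 1 2 smult_quotient[OF S])
  qed
  define N where "N = coboundary \<Gamma> \<sigma> F ` carrier (C0 \<Gamma> F)"
  have N: "N = range (\<lambda>a. cls (\<delta> a))" unfolding N_def C0 image_image cob ..
  have H1: "carrier (H1 \<Gamma> \<sigma> F) = {N +>\<^bsub>C1 \<Gamma> F\<^esub> y |y. y \<in> carrier (C1 \<Gamma> F)}"
    "\<zero>\<^bsub>H1 \<Gamma> \<sigma> F\<^esub> = N"
    by (auto simp: H1_def quotient_module_def N_def A_RCOSETS_def' a_r_coset_def')
  have coset: "N +>\<^bsub>C1 \<Gamma> F\<^esub> cls \<beta> = range (\<lambda>a. cls (\<lambda>i. \<delta> a i + \<beta> i))" for \<beta>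
    unfolding a_r_coset_def' N by (auto simp: add)
  \<comment> \<open>The coset of a cochain contains the cochain, as the choice \<open>a = 0\<close>
    shows; so a trivial cokernel puts every cochain into the image \<open>N\<close>.\<close>
  have "is_zero_module (H1 \<Gamma> \<sigma> F) \<longleftrightarrow> range cls \<subseteq> N"
  proof
    assume "is_zero_module (H1 \<Gamma> \<sigma> F)"
    then have eq: "{N +>\<^bsub>C1 \<Gamma> F\<^esub> y |y. y \<in> range cls} = {N}"
      by (simp add: is_zero_module_def H1 C1)
    show "range cls \<subseteq> N"
    proof
      fix y assume "y \<in> range cls"
      then obtain \<beta> where y: "y = cls \<beta>" by blast
      have "N +>\<^bsub>C1 \<Gamma> F\<^esub> cls \<beta> \<in> {N +>\<^bsub>C1 \<Gamma> F\<^esub> y |y. y \<in> range cls}" by blast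
      then have "N +>\<^bsub>C1 \<Gamma> F\<^esub> cls \<beta> = N" unfolding eq by simp
      moreover have "cls (\<lambda>i. \<delta> (\<lambda>_. 0) i + \<beta> i) \<in> N +>\<^bsub>C1 \<Gamma> F\<^esub> cls \<beta>" unfolding coset by blast
      moreover have "(\<lambda>i. \<delta> (\<lambda>_. 0) i + \<beta> i) = \<beta>" by (auto simp: \<delta>_def)
      ultimately show "y \<in> N" using y by simp
    qed
  next
    assume sub: "range cls \<subseteq> N"
    then have Nall: "N = range cls" using N by auto
    have "N +>\<^bsub>C1 \<Gamma> F\<^esub> cls \<beta> = N" for \<beta>
    proof
      show "N +>\<^bsub>C1 \<Gamma> F\<^esub> cls \<beta> \<subseteq> N" unfolding coset unfolding Nall by blast
      show "N \<subseteq> N +>\<^bsub>C1 \<Gamma> F\<^esub> cls \<beta>"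
      proof
        fix y assume "y \<in> N"
        then obtain \<beta>' where y: "y = cls \<beta>'" unfolding Nall by blast
        have "cls (\<lambda>i. \<beta>' i - \<beta> i) \<in> N" unfolding Nall by blast
        then obtain a where "cls (\<lambda>i. \<beta>' i - \<beta> i) = cls (\<delta> a)" unfolding N by blast
        then have "cls \<beta>' = cls (\<lambda>i. \<delta> a i + \<beta> i)" unfolding cls_eq by (simp add: algebra_simps)
        then show "y \<in> N +>\<^bsub>C1 \<Gamma> F\<^esub> cls \<beta>" unfolding coset y by blast
      qed
    qed
    then have "{N +>\<^bsub>C1 \<Gamma> F\<^esub> y |y. y \<in> range cls} = {N}" by auto
    then show "is_zero_module (H1 \<Gamma> \<sigma> F)" by (simp add: is_zero_module_def H1 C1)
  qed
  also have "\<dots> \<longleftrightarrow> (\<forall>\<beta>. \<exists>a. cls \<beta> = cls (\<delta> a))"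
    unfolding N by blast
  also have "\<dots> \<longleftrightarrow> (\<forall>\<beta>. \<exists>a. \<forall>i\<in>edges \<Gamma>. \<beta> i - \<delta> a i \<in> S (fst i))"
    unfolding cls_eq ..
  also have "\<dots> \<longleftrightarrow> (\<forall>b. \<exists>a c. \<forall>e\<in>E. \<forall>v\<in>e. \<exists>t. a v - c e - b v e = t *\<^sub>R x v)"
  proof -
    have sg: "\<sigma> (Inr e) (v, e) = - \<sigma> (Inl v) (v, e)" "\<sigma> (Inl v) (v, e) * \<sigma> (Inl v) (v, e) = 1"
      if "e \<in> E" "v \<in> e" for e v
    proof -
      have "(v, e) \<in> edges \<Gamma>" using that ed by simp
      then have s: "\<forall>y\<in>{Inl v, Inr e}. \<sigma> y (v, e) \<in> {1, -1} \<and>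
          (\<forall>u\<in>{Inl v, Inr e}. u \<noteq> y \<longrightarrow> \<sigma> y (v, e) = - \<sigma> u (v, e))"
        using \<sigma> unfolding sign_convention_def \<Gamma>_def[symmetric] en[of v e, symmetric] by blast
      have r: "\<forall>u\<in>{Inl v, Inr e}. u \<noteq> Inr e \<longrightarrow> \<sigma> (Inr e) (v, e) = - \<sigma> u (v, e)"
        by (rule conjunct2[OF bspec[OF s]]) simp
      show "\<sigma> (Inr e) (v, e) = - \<sigma> (Inl v) (v, e)"
        by (rule mp[OF bspec[OF r, of "Inl v"]]) simp_all
      have "\<sigma> (Inl v) (v, e) \<in> {1, -1}"
        by (rule conjunct1[OF bspec[OF s]]) simp
      then show "\<sigma> (Inl v) (v, e) * \<sigma> (Inl v) (v, e) = 1" by auto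
    qed
    \<comment> \<open>For a sign \<open>s\<close>, taking out the factor \<open>- s\<close> turns
      the signed equation into the normal form \<open>p - q - b\<close>; membership in a line is
      insensitive to it.\<close>
    have key: "s *\<^sub>R b - (s *\<^sub>R p + (- s) *\<^sub>R q) \<in> S v \<longleftrightarrow> (\<exists>t. p - q - b = t *\<^sub>R x v)"
      if s: "s * s = 1" for s :: real and p q b v
    proof -
      have "s *\<^sub>R b - (s *\<^sub>R p + (- s) *\<^sub>R q) = (- s) *\<^sub>R (p - q - b)" by (simp add: algebra_simps)
      moreover have "(- s) *\<^sub>R z \<in> S v \<longleftrightarrow> z \<in> S v" for z
      proof
        assume "(- s) *\<^sub>R z \<in> S v"
        from subspace_scale[OF S this, of "- s"] show "z \<in> S v" using s by simp
      qed (rule subspace_scale[OF S])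
      ultimately show ?thesis by (auto simp: S_def span_singleton)
    qed
    show ?thesis
    proof (intro iffI allI)
      fix b
      assume a: "\<forall>\<beta>. \<exists>a. \<forall>i\<in>edges \<Gamma>. \<beta> i - \<delta> a i \<in> S (fst i)"
      obtain a where a: "\<forall>i\<in>edges \<Gamma>. (case i of (v, e) \<Rightarrow> \<sigma> (Inl v) (v, e) *\<^sub>R b v e) - \<delta> a i \<in> S (fst i)"
        using a[THEN spec[of _ "\<lambda>i. case i of (v, e) \<Rightarrow> \<sigma> (Inl v) (v, e) *\<^sub>R b v e"]] by blast
      have "\<exists>t. a (Inl v) - a (Inr e) - b v e = t *\<^sub>R x v" if ev: "e \<in> E" "v \<in> e" for e v
      proof -
        have "(v, e) \<in> edges \<Gamma>" using ev ed by simp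
        from bspec[OF a this] show ?thesis
          unfolding \<delta>_def prod.case fst_conv sg(1)[OF ev] key[OF sg(2)[OF ev]] .
      qed
      then show "\<exists>a c. \<forall>e\<in>E. \<forall>v\<in>e. \<exists>t. a v - c e - b v e = t *\<^sub>R x v"
        by (intro exI[of _ "\<lambda>v. a (Inl v)"] exI[of _ "\<lambda>e. a (Inr e)"]) blast
    next
      fix \<beta> :: "'v \<times> 'v set \<Rightarrow> 'e"
      assume solv: "\<forall>b. \<exists>a c. \<forall>e\<in>E. \<forall>v\<in>e. \<exists>t. a v - c e - b v e = t *\<^sub>R x v"
      obtain a c where ac: "\<forall>e\<in>E. \<forall>v\<in>e. \<exists>t. a v - c e - \<sigma> (Inl v) (v, e) *\<^sub>R \<beta> (v, e) = t *\<^sub>R x v"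
        using solv[THEN spec[of _ "\<lambda>v e. \<sigma> (Inl v) (v, e) *\<^sub>R \<beta> (v, e)"]] by blast
      have "\<beta> i - \<delta> (case_sum a c) i \<in> S (fst i)" if i: "i \<in> edges \<Gamma>" for i
      proof -
        obtain v e where ve: "i = (v, e)" by (cases i)
        have ev: "e \<in> E" "v \<in> e" using inV i ve by auto
        have "\<sigma> (Inl v) (v, e) *\<^sub>R (\<sigma> (Inl v) (v, e) *\<^sub>R \<beta> (v, e)) -
            (\<sigma> (Inl v) (v, e) *\<^sub>R a v + (- \<sigma> (Inl v) (v, e)) *\<^sub>R c e) \<in> S v"
          unfolding key[OF sg(2)[OF ev]] using ac ev by blast
        then show ?thesis
          unfolding ve \<delta>_def prod.case fst_conv sg(1)[OF ev] by (simp add: sg(2)[OF ev])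
      qed
      then show "\<exists>a. \<forall>i\<in>edges \<Gamma>. \<beta> i - \<delta> a i \<in> S (fst i)" by blast
    qed
  qed
  finally show ?thesis by (simp add: \<Gamma>_def F_def)
qed

section \<open>Generic realisations\<close>

lemma sparse_parallel_copies_iff:
  assumes "finite E"
  shows "sparse_multigraph d k (parallel_copies a V E) \<longleftrightarrow>
    (\<forall>V'\<subseteq>V. 2 \<le> card V' \<longrightarrow> a * card {e\<in>E. e \<subseteq> V'} + k \<le> d * card V')"
proof -
  have card: "card {i \<in> E \<times> {..<a}. fst i \<subseteq> V'} = a * card {e\<in>E. e \<subseteq> V'}" for V'
  proof -
    have "{i \<in> E \<times> {..<a}. fst i \<subseteq> V'} = {e\<in>E. e \<subseteq> V'} \<times> {..<a}" by auto
    then show ?thesis by (simp add: card_cartesian_product)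
  qed
  have ineq: "int p \<le> int d * int q - int k \<longleftrightarrow> p + k \<le> d * q" for p q
    unfolding of_nat_mult[symmetric] by linarith
  show ?thesis
    unfolding sparse_multigraph_def parallel_copies_def by (simp only: multigraph.select_convs card ineq)
qed

text \<open>The flag \<open>s\<close> stands for the sparsity of the graph: without it no stress-free configuration exists,
  and only pairwise non-parallelism can be required.\<close>

definition generic_lines :: "'v set \<Rightarrow> 'v set set \<Rightarrow> bool \<Rightarrow> ('v \<Rightarrow> 'a::euclidean_space) \<Rightarrow> bool" where
  "generic_lines V E s y \<longleftrightarrow>
    (\<forall>p\<in>{(u, v). u \<in> V \<and> v \<in> V \<and> u \<noteq> v}. y (fst p) \<notin> span {y (snd p)} \<and> y (snd p) \<noteq> 0) \<and>
    (s \<longrightarrow> stress_free V E y)"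

text \<open>Each single pair of vertices can be made non-parallel by two different basis vectors,
  and irreducibility combines these finitely many conditions, together with stress-freeness when
  \<open>s\<close> holds.\<close>

lemma zariski_open_generic_lines:
  fixes V :: "'v set"
  assumes V: "finite V" and E: "\<And>e. e \<in> E \<Longrightarrow> e \<subseteq> V" and n: "2 \<le> DIM('a::euclidean_space)"
    and s: "s \<Longrightarrow> \<exists>y :: 'v \<Rightarrow> 'a. stress_free V E y"
  shows "zariski_open (generic_lines V E s :: ('v \<Rightarrow> 'a) \<Rightarrow> bool)"
    and "\<exists>y :: 'v \<Rightarrow> 'a. generic_lines V E s y"
proof -
  define P where "P = {(u, v). u \<in> V \<and> v \<in> V \<and> u \<noteq> v}"
  define Q where "Q = (\<lambda>y :: 'v \<Rightarrow> 'a. \<forall>p\<in>P. y (fst p) \<notin> span {y (snd p)} \<and> y (snd p) \<noteq> 0)"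
  have "P \<subseteq> V \<times> V" by (auto simp: P_def)
  then have finP: "finite P" using V finite_subset by blast
  obtain b c :: 'a where bc: "b \<in> Basis" "c \<in> Basis" "b \<noteq> c"
    using n by (metis card_le_Suc0_iff_eq finite_Basis not_less_eq_eq numeral_2_eq_2)
  have "b \<notin> span {c}"
  proof
    assume "b \<in> span {c}"
    then obtain k where k: "b = k *\<^sub>R c" by (auto simp: span_singleton)
    then have "b \<bullet> b = k * (c \<bullet> b)" by (metis inner_scaleR_left)
    then show False using bc inner_not_same_Basis[of c b] by (simp add: inner_same_Basis)
  qed
  have "\<exists>y :: 'v \<Rightarrow> 'a. y (fst p) \<notin> span {y (snd p)} \<and> y (snd p) \<noteq> 0" if "p \<in> P" for p
    using that bc \<open>b \<notin> span {c}\<close> nonzero_Basis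
    by (intro exI[of _ "\<lambda>z. if z = fst p then b else c"]) (auto simp: P_def)
  from zariski_open_ball[OF finP zariski_open_nonparallel this]
  have Q: "zariski_open Q" "\<exists>y. Q y" by (auto simp: Q_def)
  have gl: "generic_lines V E s = (\<lambda>y :: 'v \<Rightarrow> 'a. Q y \<and> (s \<longrightarrow> stress_free V E y))"
    by (simp add: generic_lines_def Q_def P_def fun_eq_iff)
  show "zariski_open (generic_lines V E s :: ('v \<Rightarrow> 'a) \<Rightarrow> bool)"
    unfolding gl using zariski_open_conj[OF Q(1) zariski_open_stress_free[OF V E]] Q(1) by (cases s) simp_all
  show "\<exists>y :: 'v \<Rightarrow> 'a. generic_lines V E s y"
    unfolding gl using zariski_open_conj_ex[OF Q(1) zariski_open_stress_free[OF V E] Q(2)] Q(2) s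
    by (cases s) simp_all
qed

text \<open>Non-parallelism and the equations \<open>l v e \<bullet> x v = 0\<close> depend only on
  the lines. Values outside \<open>V\<close> may change freely, so the lemma also serves to replace
  them.\<close>

lemma generic_lines_scale:
  assumes E: "\<And>e. e \<in> E \<Longrightarrow> e \<subseteq> V" and y: "generic_lines V E s y"
    and r: "\<And>v. v \<in> V \<Longrightarrow> \<exists>r. r \<noteq> 0 \<and> y v = r *\<^sub>R z v"
  shows "generic_lines V E s z"
proof -
  obtain r where r: "\<And>v. v \<in> V \<Longrightarrow> r v \<noteq> 0" "\<And>v. v \<in> V \<Longrightarrow> y v = r v *\<^sub>R z v"
    using r by metis
  have "z u \<notin> span {z v} \<and> z v \<noteq> 0" if uv: "u \<in> V" "v \<in> V" "u \<noteq> v" for u v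
  proof -
    have yy: "y u \<notin> span {y v}" "y v \<noteq> 0"
      using y uv unfolding generic_lines_def by force+
    have "z u \<notin> span {z v}"
    proof
      assume "z u \<in> span {z v}"
      then have "y u \<in> span {z v}" using r(2)[OF uv(1)] span_scale by metis
      moreover have "span {z v} = span {y v}"
        using r(1,2)[OF uv(2)] span_image_scale[of "{z v}" "\<lambda>_. r v"] by simp
      ultimately show False using yy by simp
    qed
    moreover have "z v \<noteq> 0" using yy(2) r(2)[OF uv(2)] by auto
    ultimately show ?thesis by blast
  qed
  moreover have "stress_free V E z" if "s"
  proof -
    have sf: "stress_free V E y" using y that by (simp add: generic_lines_def)
    have "m \<bullet> y v = 0" if "m \<bullet> z v = 0" "v \<in> V" for m v using r(2)[OF that(2)] that(1) by simp
    then have *: "(\<forall>e\<in>E. \<forall>v\<in>e. l v e \<bullet> z v = 0) \<Longrightarrow> (\<forall>e\<in>E. \<forall>v\<in>e. l v e \<bullet> y v = 0)" for l :: "_ \<Rightarrow> _ \<Rightarrow> 'b"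
      using E by (meson subsetD)
    show ?thesis
      unfolding stress_free_def
    proof (intro allI impI)
      fix l :: "'a \<Rightarrow> 'a set \<Rightarrow> 'b"
      assume "\<forall>v\<in>V. (\<Sum>e\<in>{e\<in>E. v \<in> e}. l v e) = 0" "\<forall>e\<in>E. (\<Sum>v\<in>e. l v e) = 0"
        "\<forall>e\<in>E. \<forall>v\<in>e. l v e \<bullet> z v = 0"
      then show "\<forall>e\<in>E. \<forall>v\<in>e. l v e = 0"
        using sf[unfolded stress_free_def, THEN spec[of _ l]] *[of l] by argo
    qed
  qed
  ultimately show ?thesis by (auto simp: generic_lines_def)
qed

text \<open>If \<open>s\<close> holds, stress-freeness solves the system for every right-hand side;
  if the system is solvable, non-parallel lines already yield the count. So the same notion of
  genericity covers sparse and non-sparse graphs.\<close>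

lemma generic_lines_H1_iff:
  fixes V :: "'v set" and y :: "'v \<Rightarrow> 'e::euclidean_space"
    and G :: "('g, 'b) monoid_scheme" and \<rho> :: "'v + 'v set \<Rightarrow> 'g set"
  assumes V: "finite V" and E: "\<And>e. e \<in> E \<Longrightarrow> e \<subseteq> V" "\<And>e. e \<in> E \<Longrightarrow> card e = 2"
    and y: "generic_lines V E s y" and s: "s \<longleftrightarrow> (\<forall>V'\<subseteq>V. 2 \<le> card V' \<longrightarrow>
      (DIM('e) - 2) * card {e\<in>E. e \<subseteq> V'} + DIM('e) \<le> (DIM('e) - 1) * card V')"
    and \<sigma>: "sign_convention (incidence_graph V E) \<sigma>"
    and lv: "\<And>v. v \<in> V \<Longrightarrow> lie_algebra G T A (\<rho> (Inl v)) = span {y v}"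
    and \<rho>e: "\<And>e. e \<in> E \<Longrightarrow> \<rho> (Inr e) = (\<Inter>v\<in>e. \<rho> (Inl v))"
    and one: "\<one>\<^bsub>G\<^esub> \<in> topspace T" "\<And>v. v \<in> V \<Longrightarrow> \<one>\<^bsub>G\<^esub> \<in> \<rho> (Inl v)"
  shows "is_zero_module (H1 (incidence_graph V E) \<sigma> (motion_sheaf G T A \<rho>)) \<longleftrightarrow> s"
proof -
  have le: "lie_algebra G T A (\<rho> (Inr e)) \<subseteq> span {y v}" if "e \<in> E" "v \<in> e" for e v
  proof -
    have "\<rho> (Inr e) \<subseteq> \<rho> (Inl v)" using \<rho>e that by auto
    then have "lie_algebra G T A (\<rho> (Inr e)) \<subseteq> lie_algebra G T A (\<rho> (Inl v))"
      by (fastforce simp: lie_algebra_def)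
    moreover have "v \<in> V" using E(1) that by blast
    ultimately show ?thesis using lv by simp
  qed
  have l0: "0 \<in> lie_algebra G T A (\<rho> (Inr e))" if "e \<in> E" for e
  proof -
    have "\<one>\<^bsub>G\<^esub> \<in> \<rho> (Inr e)" using \<rho>e[OF that] one(2) E(1)[OF that] by auto
    then show ?thesis
      unfolding lie_algebra_def
      using smooth_map_const[OF one(1), of euclideanreal "{(UNIV, id)}" A]
      by (intro CollectI exI[of _ "\<lambda>_. \<one>\<^bsub>G\<^esub>"]) (auto simp: o_def)
  qed
  note iff = is_zero_H1_iff[of E V \<sigma> G T A \<rho> y, OF E(1) \<sigma> lv le l0]
  have "(\<forall>b. \<exists>a c. \<forall>e\<in>E. \<forall>v\<in>e. \<exists>t. a v - c e - b v e = t *\<^sub>R y v) \<longleftrightarrow> s"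
  proof
    assume solv: "\<forall>b. \<exists>a c. \<forall>e\<in>E. \<forall>v\<in>e. \<exists>t. a v - c e - b v e = t *\<^sub>R y v"
    have gen: "y u \<notin> span {y v}" if "u \<in> V" "v \<in> V" "u \<noteq> v" for u v
      using y that unfolding generic_lines_def by force
    have "(DIM('e) - 2) * card {e\<in>E. e \<subseteq> V'} + DIM('e) \<le> (DIM('e) - 1) * card V'"
      if "V' \<subseteq> V" "2 \<le> card V'" for V'
      by (rule solvable_imp_sparse[OF V E(2) gen _ that]) (use solv in blast)+
    then show s using s by blast
  next
    assume s
    then have "stress_free V E y" using y by (simp add: generic_lines_def)
    from stress_free_imp_solvable[OF V E(1) this]
    show "\<forall>b. \<exists>a c. \<forall>e\<in>E. \<forall>v\<in>e. \<exists>t. a v - c e - b v e = t *\<^sub>R y v" by blast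
  qed
  then show ?thesis using iff by simp
qed

theorem mainTheorem2:
  fixes G :: "'g monoid" and T :: "'g topology" and A :: "('g, 'e::euclidean_space) chart set"
    and H :: "'g set" and V :: "'v set" and E :: "'v set set"
  assumes "lie_group G T A" and "DIM('e) \<ge> 3"
    and "closed_lie_subgroup G T A 1 H" and "connectedin T H"
    and "finite (carrier ((G\<lparr>carrier := normalizer G H\<rparr>) Mod H))"
    and "finite_graph V E"
  shows "\<exists>U. openin (realisation_topology G T H V E) U \<and>
    realisation_topology G T H V E closure_of U = realisations G H V E \<and>
    (\<forall>\<rho>\<in>U. \<forall>\<sigma>. sign_convention (incidence_graph V E) \<sigma> \<longrightarrow>
       (is_zero_module (H1 (incidence_graph V E) \<sigma> (motion_sheaf G T A \<rho>)) \<longleftrightarrow>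
        sparse_multigraph (DIM('e) - 1) (DIM('e)) (parallel_copies (DIM('e) - 2) V E)))"
proof -
  interpret lie_group G T A by (rule assms(1))
  have V: "finite V" and E: "\<And>e. e \<in> E \<Longrightarrow> e \<subseteq> V" "\<And>e. e \<in> E \<Longrightarrow> card e = 2"
    using assms(6) by (auto simp: finite_graph_def)
  have finE: "finite E" using finite_subset[of E "Pow V"] E(1) V by blast
  have subH: "subgroup H G" using assms(3) by (simp add: closed_lie_subgroup_def)
  have H: "H \<subseteq> carrier G" using subH by (rule subgroup.subset)
  obtain x :: "'g \<Rightarrow> 'e" where x:
    "\<And>g. g \<in> carrier G \<Longrightarrow> lie_algebra G T A (conjugate G g H) = span {x g}"
    "\<And>B. open B \<Longrightarrow> openin T {g \<in> carrier G. x g \<in> B}"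
    "\<And>W h. openin T W \<Longrightarrow> h \<in> carrier G \<Longrightarrow> openin T {g \<in> carrier G. g \<otimes>\<^bsub>G\<^esub> h \<in> W}"
    "\<And>W. openin T W \<Longrightarrow> W \<noteq> {} \<Longrightarrow>
      \<exists>B. open B \<and> B \<noteq> {} \<and> (\<forall>y\<in>B. \<exists>g\<in>W. \<exists>r. r \<noteq> 0 \<and> y = r *\<^sub>R x g)"
    using conjugate_lie_algebras[OF assms(1,3,4,5)] by blast
  define s where "s \<longleftrightarrow> sparse_multigraph (DIM('e) - 1) (DIM('e)) (parallel_copies (DIM('e) - 2) V E)"
  have s_iff: "s \<longleftrightarrow> (\<forall>V'\<subseteq>V. 2 \<le> card V' \<longrightarrow>
      (DIM('e) - 2) * card {e\<in>E. e \<subseteq> V'} + DIM('e) \<le> (DIM('e) - 1) * card V')"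
    unfolding s_def by (rule sparse_parallel_copies_iff[OF finE])
  have ex_sf: "\<exists>y :: 'v \<Rightarrow> 'e. stress_free V E y" if s
    using sparse_imp_stress_free[OF V _ assms(2), of E] E that s_iff by blast
  have zar: "zariski_open (generic_lines V E s :: ('v \<Rightarrow> 'e) \<Rightarrow> bool)"
    and nonempty: "\<exists>y :: 'v \<Rightarrow> 'e. generic_lines V E s y"
    using zariski_open_generic_lines[OF V E(1) _ ex_sf] assms(2) by simp_all
  have rescale: "generic_lines V E s z"
    if "generic_lines V E s y" "\<And>v. v \<in> V \<Longrightarrow> \<exists>r. r \<noteq> 0 \<and> y v = r *\<^sub>R z v" for y z :: "'v \<Rightarrow> 'e"
    using generic_lines_scale[of E V s y z] E(1) that by blast
  define N where "N = normalizer G H"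
  have N: "subgroup N G" unfolding N_def by (rule normalizer_imp_subgroup[OF H])
  have NG: "N \<subseteq> carrier G" using N by (rule subgroup.subset)
  define rc where "rc = realisation_cosets G H V"
  define X where "X = product_topology (\<lambda>_ :: 'v. coset_topology G T N) V"
  define R where "R = realisations G H V E"
  have RT: "realisation_topology G T H V E = pullback_topology R rc X"
    by (simp add: realisation_topology_def R_def rc_def X_def N_def)
  have topR: "topspace (pullback_topology R rc X) = R"
    unfolding RT[symmetric] unfolding R_def
    using E(1) by (intro topspace_realisation_topology[OF group_axioms topspace_eq H]) blast
  have bij: "bij_betw rc R (\<Pi>\<^sub>E v\<in>V. lcosets\<^bsub>G\<^esub> N)"
    unfolding rc_def R_def N_def using E(1) by (intro bij_betw_realisation_cosets[OF H]) auto
  have rc_apply: "rc \<rho> v = {g \<in> carrier G. conjugate G g H = \<rho> (Inl v)}" if "v \<in> V" for \<rho> v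
    using that by (simp add: rc_def realisation_cosets_def)
  have coset_self: "g \<in> g <#\<^bsub>G\<^esub> N" if "g \<in> carrier G" for g
    using subgroup.one_closed[OF N] that unfolding l_coset_def by force
  have coset_iff: "rc \<rho> v = g <#\<^bsub>G\<^esub> N \<longleftrightarrow> \<rho> (Inl v) = conjugate G g H"
    if "v \<in> V" "g \<in> carrier G" for \<rho> v g
  proof
    assume "rc \<rho> v = g <#\<^bsub>G\<^esub> N"
    then have "g \<in> rc \<rho> v" using coset_self[OF that(2)] by simp
    then show "\<rho> (Inl v) = conjugate G g H" using rc_apply[OF that(1)] by simp
  next
    assume "\<rho> (Inl v) = conjugate G g H"
    then show "rc \<rho> v = g <#\<^bsub>G\<^esub> N"
      unfolding rc_apply[OF that(1)] N_def using conjugators_eq_coset[OF that(2) H] by simp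
  qed
  \<comment> \<open>The existential choice of representatives makes openness a matter of images of
    open sets of \<open>G\<close> under the projection to cosets.\<close>
  define good where "good c \<longleftrightarrow> (\<exists>g. (\<forall>v\<in>V. g v \<in> carrier G \<and> c v = g v <#\<^bsub>G\<^esub> N) \<and>
    generic_lines V E s (\<lambda>v. x (g v)))" for c
  define O1 where "O1 = {c \<in> \<Pi>\<^sub>E v\<in>V. lcosets\<^bsub>G\<^esub> N. good c}"
  define U where "U = rc -` O1 \<inter> R"
  \<comment> \<open>The projection to cosets is open: the preimage of the image of \<open>W\<close>
    is a union of right translates of \<open>W\<close>, one for each element of
    \<open>N\<close>.\<close>
  have coset_open: "openin (coset_topology G T N) ((\<lambda>h. h <#\<^bsub>G\<^esub> N) ` W)" if W: "openin T W" for W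
    unfolding openin_coset_topology
  proof
    have WG: "W \<subseteq> carrier G" using openin_subset[OF W] topspace_eq by simp
    then show "(\<lambda>h. h <#\<^bsub>G\<^esub> N) ` W \<subseteq> lcosets\<^bsub>G\<^esub> N" by (auto simp: LCOSETS_def)
    have eq: "{h \<in> topspace T. h <#\<^bsub>G\<^esub> N \<in> (\<lambda>h. h <#\<^bsub>G\<^esub> N) ` W} =
        (\<Union>n\<in>N. {h \<in> carrier G. h \<otimes>\<^bsub>G\<^esub> n \<in> W})"
    proof (intro equalityI subsetI)
      fix h assume "h \<in> {h \<in> topspace T. h <#\<^bsub>G\<^esub> N \<in> (\<lambda>h. h <#\<^bsub>G\<^esub> N) ` W}"
      then obtain k where k: "h \<in> carrier G" "k \<in> W" "h <#\<^bsub>G\<^esub> N = k <#\<^bsub>G\<^esub> N"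
        by (auto simp: topspace_eq)
      then have "k \<in> h <#\<^bsub>G\<^esub> N" using coset_self WG by blast
      then show "h \<in> (\<Union>n\<in>N. {h \<in> carrier G. h \<otimes>\<^bsub>G\<^esub> n \<in> W})" using k by (auto simp: l_coset_def)
    next
      fix h assume "h \<in> (\<Union>n\<in>N. {h \<in> carrier G. h \<otimes>\<^bsub>G\<^esub> n \<in> W})"
      then obtain n where n: "n \<in> N" "h \<in> carrier G" "h \<otimes>\<^bsub>G\<^esub> n \<in> W" by blast
      then have "h \<otimes>\<^bsub>G\<^esub> n \<in> h <#\<^bsub>G\<^esub> N" by (auto simp: l_coset_def)
      then have "h <#\<^bsub>G\<^esub> N = (h \<otimes>\<^bsub>G\<^esub> n) <#\<^bsub>G\<^esub> N" using l_repr_independence[OF _ n(2) N] by blast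
      then show "h \<in> {h \<in> topspace T. h <#\<^bsub>G\<^esub> N \<in> (\<lambda>h. h <#\<^bsub>G\<^esub> N) ` W}"
        using n by (auto simp: topspace_eq)
    qed
    show "openin T {h \<in> topspace T. h <#\<^bsub>G\<^esub> N \<in> (\<lambda>h. h <#\<^bsub>G\<^esub> N) ` W}"
      unfolding eq by (rule openin_Union) (use x(3)[OF W] NG in auto)
  qed
  have "openin X O1"
    unfolding X_def openin_product_topology_alt
  proof (intro ballI)
    fix c assume c: "c \<in> O1"
    then obtain g where g: "\<And>v. v \<in> V \<Longrightarrow> g v \<in> carrier G" "\<And>v. v \<in> V \<Longrightarrow> c v = g v <#\<^bsub>G\<^esub> N"
      "generic_lines V E s (\<lambda>v. x (g v))" by (auto simp: O1_def good_def)
    have "openin (product_topology (\<lambda>_. euclidean) UNIV) {y :: 'v \<Rightarrow> 'e. generic_lines V E s y}"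
      using zariski_open_imp_open[OF zar] by (simp add: open_fun_def)
    from bspec[OF this[unfolded openin_product_topology_alt], of "\<lambda>v. x (g v)"] g(3)
    obtain B where B': "\<forall>v\<in>UNIV :: 'v set. openin euclidean (B v)" "(\<lambda>v. x (g v)) \<in> Pi\<^sub>E UNIV B"
      "Pi\<^sub>E UNIV B \<subseteq> {y :: 'v \<Rightarrow> 'e. generic_lines V E s y}" by blast
    then have B: "\<And>v. open (B v)" "(\<lambda>v. x (g v)) \<in> Pi\<^sub>E UNIV B"
      "Pi\<^sub>E UNIV B \<subseteq> {y :: 'v \<Rightarrow> 'e. generic_lines V E s y}" by simp_all
    define \<U> where "\<U> v = (\<lambda>h. h <#\<^bsub>G\<^esub> N) ` {h \<in> carrier G. x h \<in> B v}" for v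
    have "finite {i \<in> V. \<U> i \<noteq> topspace (coset_topology G T N)}" using V by simp
    moreover have "\<forall>v\<in>V. openin (coset_topology G T N) (\<U> v)"
      unfolding \<U>_def using coset_open x(2) B(1) by blast
    moreover have "c \<in> Pi\<^sub>E V \<U>"
      using c g(1,2) B(2) by (auto simp: PiE_iff \<U>_def O1_def)
    moreover have "Pi\<^sub>E V \<U> \<subseteq> O1"
    proof
      fix c' assume c': "c' \<in> Pi\<^sub>E V \<U>"
      then have "\<forall>v\<in>V. \<exists>h. h \<in> carrier G \<and> x h \<in> B v \<and> c' v = h <#\<^bsub>G\<^esub> N"
        by (auto simp: PiE_iff \<U>_def)
      then obtain g' where g': "\<And>v. v \<in> V \<Longrightarrow> g' v \<in> carrier G" "\<And>v. v \<in> V \<Longrightarrow> x (g' v) \<in> B v"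
        "\<And>v. v \<in> V \<Longrightarrow> c' v = g' v <#\<^bsub>G\<^esub> N" by metis
      \<comment> \<open>Outside \<open>V\<close> the coordinates of the old configuration are kept,
        to stay in a box of the product over the whole type; \<open>rescale\<close> with factor 1
        then forgets them.\<close>
      have "(\<lambda>v. if v \<in> V then x (g' v) else x (g v)) \<in> Pi\<^sub>E UNIV B"
        using g'(2) B(2) by auto
      then have "generic_lines V E s (\<lambda>v. if v \<in> V then x (g' v) else x (g v))" using B(3) by blast
      then have "generic_lines V E s (\<lambda>v. x (g' v))"
        by (rule rescale) (auto intro!: exI[of _ 1])
      then have "good c'" unfolding good_def using g' by blast
      moreover have "c' \<in> (\<Pi>\<^sub>E v\<in>V. lcosets\<^bsub>G\<^esub> N)"
        using c' g'(1,3) by (auto simp: PiE_iff LCOSETS_def)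
      ultimately show "c' \<in> O1" by (simp add: O1_def)
    qed
    ultimately show "\<exists>U. finite {i \<in> V. U i \<noteq> topspace (coset_topology G T N)} \<and>
        (\<forall>i\<in>V. openin (coset_topology G T N) (U i)) \<and> c \<in> Pi\<^sub>E V U \<and> Pi\<^sub>E V U \<subseteq> O1" by blast
  qed
  then have openU: "openin (pullback_topology R rc X) U"
    unfolding openin_pullback_topology U_def by blast
  have "pullback_topology R rc X closure_of U = R"
  proof
    show "pullback_topology R rc X closure_of U \<subseteq> R"
      using closure_of_subset_topspace[of "pullback_topology R rc X" U] topR by simp
    show "R \<subseteq> pullback_topology R rc X closure_of U"
    proof
      fix \<rho>0 assume \<rho>0: "\<rho>0 \<in> R"
      have "\<exists>\<rho>. \<rho> \<in> U \<and> \<rho> \<in> S" if S: "\<rho>0 \<in> S" "openin (pullback_topology R rc X) S" for S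
      proof -
        obtain O2 where O2: "openin X O2" "S = rc -` O2 \<inter> R"
          using S(2) by (auto simp: openin_pullback_topology)
        have "rc \<rho>0 \<in> O2" using S(1) O2(2) by simp
        from bspec[OF O2(1)[unfolded X_def openin_product_topology_alt] this]
        obtain \<U> where "\<forall>v\<in>V. openin (coset_topology G T N) (\<U> v)"
          and \<U>: "rc \<rho>0 \<in> Pi\<^sub>E V \<U>" "Pi\<^sub>E V \<U> \<subseteq> O2" by blast
        then have \<U>_open: "openin (coset_topology G T N) (\<U> v)" if "v \<in> V" for v
          using that by blast
        \<comment> \<open>The preimages in \<open>G\<close> of the sides of a basic box around
          \<open>\<rho>0\<close>; the cones over their orbits contain the open sets
          \<open>B v\<close>.\<close>
        define W where "W v = {h \<in> topspace T. h <#\<^bsub>G\<^esub> N \<in> \<U> v}" for v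
        have W: "openin T (W v)" if "v \<in> V" for v
          using \<U>_open[OF that] by (simp add: openin_coset_topology W_def)
        have Wne: "W v \<noteq> {}" if "v \<in> V" for v
        proof -
          have "rc \<rho>0 v \<in> \<U> v" using PiE_mem[OF \<U>(1) that] .
          moreover have "rc \<rho>0 v \<in> lcosets\<^bsub>G\<^esub> N"
            using bij_betwE[OF bij] \<rho>0 that by (auto simp: PiE_iff)
          ultimately show ?thesis by (auto simp: W_def LCOSETS_def topspace_eq)
        qed
        have "\<forall>v\<in>V. \<exists>B. open B \<and> B \<noteq> {} \<and> (\<forall>y\<in>B. \<exists>g\<in>W v. \<exists>r. r \<noteq> 0 \<and> y = r *\<^sub>R x g)"
          using x(4)[OF W Wne] by blast
        then obtain B where B: "\<And>v. v \<in> V \<Longrightarrow> open (B v)" "\<And>v. v \<in> V \<Longrightarrow> B v \<noteq> {}"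
          "\<And>v y. v \<in> V \<Longrightarrow> y \<in> B v \<Longrightarrow> \<exists>g\<in>W v. \<exists>r. r \<noteq> 0 \<and> y = r *\<^sub>R x g" by metis
        \<comment> \<open>A non-empty open cylinder of configurations, so it contains a generic
          \<open>y\<close>. Each \<open>y v\<close> is a non-zero multiple of some
          \<open>x (g v)\<close> with \<open>g v\<close> in \<open>W v\<close>, and the realisation
          given by these \<open>g v\<close> is generic and lies in the box.\<close>
        define Z where "Z = (\<Inter>v\<in>V. (\<lambda>y :: 'v \<Rightarrow> 'e. y v) -` B v)"
        have "open Z"
          unfolding Z_def using V
          by (intro open_INT ballI open_vimage[OF B(1)] continuous_on_product_coordinates) auto
        moreover have "(\<lambda>v. SOME b. b \<in> B v) \<in> Z"
          unfolding Z_def using B(2) by (auto simp: some_in_eq)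
        moreover obtain y0 :: "'v \<Rightarrow> 'e" where "generic_lines V E s y0" using nonempty by blast
        ultimately obtain y where y: "y \<in> Z" "generic_lines V E s y"
          using zariski_open_dense[OF zar] by meson
        have "\<forall>v\<in>V. \<exists>g. g \<in> W v \<and> (\<exists>r. r \<noteq> 0 \<and> y v = r *\<^sub>R x g)"
        proof
          fix v assume v: "v \<in> V"
          then have "y v \<in> B v" using y(1) by (simp add: Z_def)
          from B(3)[OF v this] show "\<exists>g. g \<in> W v \<and> (\<exists>r. r \<noteq> 0 \<and> y v = r *\<^sub>R x g)" by blast
        qed
        then obtain g where g: "\<And>v. v \<in> V \<Longrightarrow> g v \<in> W v" "\<And>v. v \<in> V \<Longrightarrow> \<exists>r. r \<noteq> 0 \<and> y v = r *\<^sub>R x (g v)"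
          by metis
        have gl: "generic_lines V E s (\<lambda>v. x (g v))"
          by (rule rescale[OF y(2) g(2)])
        have gG: "g v \<in> carrier G" if "v \<in> V" for v using g(1)[OF that] by (simp add: W_def topspace_eq)
        define c where "c = (\<lambda>v\<in>V. g v <#\<^bsub>G\<^esub> N)"
        have cl: "c \<in> (\<Pi>\<^sub>E v\<in>V. lcosets\<^bsub>G\<^esub> N)" using gG by (auto simp: c_def LCOSETS_def)
        then obtain \<rho> where \<rho>: "\<rho> \<in> R" "rc \<rho> = c"
          using bij by (metis bij_betw_imp_surj_on imageE)
        have "good c" unfolding good_def using gG gl by (intro exI[of _ g]) (simp add: c_def)
        then have "\<rho> \<in> U" using \<rho> cl by (simp add: U_def O1_def)
        moreover have "c \<in> Pi\<^sub>E V \<U>" using g(1) by (auto simp: c_def W_def)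
        then have "\<rho> \<in> S" using \<rho> \<U>(2) O2(2) by blast
        ultimately show ?thesis by blast
      qed
      then show "\<rho>0 \<in> pullback_topology R rc X closure_of U"
        unfolding in_closure_of topR using \<rho>0 by blast
    qed
  qed
  moreover have "is_zero_module (H1 (incidence_graph V E) \<sigma> (motion_sheaf G T A \<rho>)) \<longleftrightarrow> s"
    if \<rho>U: "\<rho> \<in> U" and \<sigma>: "sign_convention (incidence_graph V E) \<sigma>" for \<rho> \<sigma>
  proof -
    have \<rho>: "\<rho> \<in> R" "good (rc \<rho>)" using \<rho>U by (auto simp: U_def O1_def)
    obtain g where g: "\<And>v. v \<in> V \<Longrightarrow> g v \<in> carrier G" "\<And>v. v \<in> V \<Longrightarrow> rc \<rho> v = g v <#\<^bsub>G\<^esub> N"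
      "generic_lines V E s (\<lambda>v. x (g v))" using \<rho>(2) by (auto simp: good_def)
    have conj: "\<rho> (Inl v) = conjugate G (g v) H" if "v \<in> V" for v
      using coset_iff[OF that g(1)[OF that]] g(2)[OF that] by blast
    have one_mem: "\<one>\<^bsub>G\<^esub> \<in> \<rho> (Inl v)" if "v \<in> V" for v
      unfolding conj[OF that] conjugate_eq_image
      using g(1)[OF that] subgroup.one_closed[OF subH] by (intro image_eqI[of _ _ "\<one>\<^bsub>G\<^esub>"]) auto
    have \<rho>e: "\<rho> (Inr e) = (\<Inter>v\<in>e. \<rho> (Inl v))" if "e \<in> E" for e
      using \<rho>(1) that by (simp add: R_def realisations_def)
    have lv: "lie_algebra G T A (\<rho> (Inl v)) = span {x (g v)}" if "v \<in> V" for v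
      unfolding conj[OF that] by (rule x(1)[OF g(1)[OF that]])
    show ?thesis
      by (rule generic_lines_H1_iff[OF V E(1) E(2) g(3) s_iff \<sigma> lv \<rho>e _ one_mem]) (auto simp: topspace_eq)
  qed
  ultimately show ?thesis
    unfolding RT R_def[symmetric] s_def[symmetric] using openU by blast
qed

end
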